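(* Let $\mathcal N=\begin{pmatrix}N&\pi\\ \sigma&-N^*\end{pmatrix}$ be a paired operator on the standard Courant algebroid $A\oplus A^*$ with $\mathcal N^2=-\mathrm{Id}_{A\oplus A^*}$. If $\mathcal T_{\mathcal N}(\alpha,\beta)=0$ for all $\alpha,\beta\in\Gamma(A^* )$ and $\mathcal T_{\mathcal N}(X,Y)=0$ for all $X,Y\in\Gamma(A)$, then $(A\oplus A^* )_{\mathcal N}=(A\oplus A^*,[\![\cdot,\cdot]\!]_{\mathcal N},\rho_{\mathcal N},\langle\cdot,\cdot\rangle_{\mathcal N})$ is a Courant algebroid, and it coincides (same bracket, anchor and pairing) with the double of the quasi-Lie bialgebroid $(A^*_\pi,\mathrm{d}_N,\mathrm{d}\sigma)$.
   Context: $(A,[\cdot,\cdot],\rho)$ is a Lie algebroid with differential $\mathrm{d}$. Standard Courant algebroid on $A\oplus A^*$: pairing $\langle X+\alpha,Y+\beta\rangle=\alpha(Y)+\beta(X)$, anchor $\rho(X)$, bracket $[\![X+\alpha,Y+\beta]\!]=[X,Y]+\mathcal L_X\beta-\mathcal L_Y\alpha+\tfrac12\mathrm{d}(\alpha(Y)-\beta(X))$. Paired operator: bundle map $\mathcal N$ over the identity with $\langle e_1,\mathcal Ne_2\rangle+\langle\mathcal Ne_1,e_2\rangle=0$, of the form $\begin{pmatrix}N&\pi\\ \sigma&-N^*\end{pmatrix}$, $\pi\in\Gamma(\wedge^2A)$ ($\pi^\sharp\alpha=i_\alpha\pi$), $\sigma\in\Gamma(\wedge^2A^* )$ ($X\mapsto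 i_X\sigma$). $[\![e_1,e_2]\!]_{\mathcal N}=[\![\mathcal Ne_1,e_2]\!]+[\![e_1,\mathcal Ne_2]\!]-\mathcal N[\![e_1,e_2]\!]$; $\mathcal T_{\mathcal N}(e_1,e_2)=[\![\mathcal Ne_1,\mathcal Ne_2]\!]-\mathcal N[\![e_1,e_2]\!]_{\mathcal N}$; $\langle e_1,e_2\rangle_{\mathcal N}=\langle\mathcal Ne_1,\mathcal Ne_2\rangle$; $\rho_{\mathcal N}(X+\alpha)=\rho(NX)+\rho(\pi^\sharp\alpha)$. $A^*_\pi=(A^*,[\cdot,\cdot]_\pi,\rho\circ\pi^\sharp)$, $[\alpha,\beta]_\pi=\mathcal L_{\pi^\sharp\alpha}\beta-\mathcal L_{\pi^\sharp\beta}\alpha-\mathrm{d}(\pi(\alpha,\beta))$; $\mathrm{d}_N=i_N\mathrm{d}-\mathrm{d}i_N$ with $(i_N\alpha)(X_1,..,X_k)=\sum_j\alpha(..,NX_j,..)$. Quasi-Lie bialgebroid $(B,\mathrm{d}_*,Q)$: Lie algebroid $B$, degree-one derivation $\mathrm{d}_*$ of $(\Gamma(\wedge^\bullet B),\wedge,[\cdot,\cdot]_B)$, $Q\in\Gamma(\wedge^3B)$, $\mathrm{d}_*Q=0$, $\mathrm{d}_*^2=[Q,\cdot]_B$; induced anchor $\rho_{B^*}(\xi)f=\langle\xi,\mathrm{d}_*f\rangle$, bracket $\langle[\xi,\eta]_*,X\rangle=\rho_{B^*}(\xi)\langle\eta,X\rangle-\rho_{B^*}(\eta)\langle\xi,X\rangle-(\mathrm{d}_*X)(\xi,\eta)$.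 Its double $B\oplus B^*$ has pairing $\langle X+\xi,Y+\eta\rangle=\xi(Y)+\eta(X)$, anchor $\rho_B+\rho_{B^*}$ and skew bracket $[\![X+\xi,Y+\eta]\!]=[X,Y]_B+\mathcal L^*_\xi Y-\mathcal L^*_\eta X-\tfrac12\mathrm{d}_*(\xi(Y)-\eta(X))+Q(\xi,\eta,\cdot)+[\xi,\eta]_*+\mathcal L_X\eta-\mathcal L_Y\xi+\tfrac12\mathrm{d}_B(\xi(Y)-\eta(X))$ with $\mathcal L^*_\xi=i_\xi\mathrm{d}_*+\mathrm{d}_*i_\xi$. Here $B=A^*_\pi$ (so $B^*=A$, and $B\oplus B^*$ is identified with $A\oplus A^*$), $\mathrm{d}_*=\mathrm{d}_N$, $Q=\mathrm{d}\sigma$. *)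

theory Defs
  imports Complex_Main "HOL-Combinatorics.Permutations" "HOL-Library.Function_Algebras" "HOL-Library.Product_Plus"
begin

text \<open>Algebraic (Lie--Rinehart / Serre--Swan) setting.  The ring of functions is a commutative
real algebra 'r (playing the role of the smooth functions on the base), sections of a vector bundle
form a finitely generated projective 'r-module (given by a finite dual basis).\<close>

definition r_module :: "'x set \<Rightarrow> ('r::comm_ring_1 \<Rightarrow> 'x \<Rightarrow> 'x::ab_group_add) \<Rightarrow> bool" where
  "r_module C sm \<longleftrightarrow> 0 \<in> C \<and> (\<forall>x\<in>C. \<forall>y\<in>C. x + y \<in> C) \<and> (\<forall>x\<in>C. - x \<in> C)
     \<and> (\<forall>f. \<forall>x\<in>C. sm f x \<in> C)
     \<and> (\<forall>f g. \<forall>x\<in>C. sm (f + g) x = sm f x + sm g x)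
     \<and> (\<forall>f. \<forall>x\<in>C. \<forall>y\<in>C. sm f (x + y) = sm f x + sm f y)
     \<and> (\<forall>f g. \<forall>x\<in>C. sm (f * g) x = sm f (sm g x))
     \<and> (\<forall>x\<in>C. sm 1 x = x)"

definition lin_functional :: "'x set \<Rightarrow> ('r::comm_ring_1 \<Rightarrow> 'x \<Rightarrow> 'x::ab_group_add) \<Rightarrow> ('x \<Rightarrow> 'r) \<Rightarrow> bool" where
  "lin_functional C sm \<phi> \<longleftrightarrow> (\<forall>x\<in>C. \<forall>y\<in>C. \<phi> (x + y) = \<phi> x + \<phi> y) \<and> (\<forall>f. \<forall>x\<in>C. \<phi> (sm f x) = f * \<phi> x)"

text \<open>A finite dual basis (e_i, phi_i): every section x equals sum phi_i(x) e_i.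
  Existence of one characterizes finitely generated projective modules (sections of vector bundles).\<close>
definition is_dual_basis :: "'x set \<Rightarrow> ('r::comm_ring_1 \<Rightarrow> 'x \<Rightarrow> 'x::ab_group_add) \<Rightarrow> ('x \<times> ('x \<Rightarrow> 'r)) list \<Rightarrow> bool" where
  "is_dual_basis C sm bs \<longleftrightarrow> (\<forall>(e, \<phi>)\<in>set bs. e \<in> C \<and> lin_functional C sm \<phi>)
     \<and> (\<forall>x\<in>C. x = (\<Sum>(e, \<phi>)\<leftarrow>bs. sm (\<phi> x) e))"

definition fg_projective :: "'x set \<Rightarrow> ('r::comm_ring_1 \<Rightarrow> 'x \<Rightarrow> 'x::ab_group_add) \<Rightarrow> bool" where
  "fg_projective C sm \<longleftrightarrow> (\<exists>bs. is_dual_basis C sm bs)"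

text \<open>Vector fields = derivations of the function algebra.\<close>
definition is_derivation :: "('r::{comm_ring_1,real_algebra_1} \<Rightarrow> 'r) \<Rightarrow> bool" where
  "is_derivation D \<longleftrightarrow> (\<forall>f g. D (f + g) = D f + D g) \<and> (\<forall>c f. D (scaleR c f) = scaleR c (D f))
     \<and> (\<forall>f g. D (f * g) = D f * g + f * D g)"

definition lie_algebroid :: "'x set \<Rightarrow> ('r::{comm_ring_1,real_algebra_1} \<Rightarrow> 'x \<Rightarrow> 'x::ab_group_add)
    \<Rightarrow> ('x \<Rightarrow> 'x \<Rightarrow> 'x) \<Rightarrow> ('x \<Rightarrow> 'r \<Rightarrow> 'r) \<Rightarrow> bool" where
  "lie_algebroid C sm br rho \<longleftrightarrow> r_module C sm \<and> fg_projective C sm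
     \<and> (\<forall>x\<in>C. \<forall>y\<in>C. br x y \<in> C)
     \<and> (\<forall>x\<in>C. \<forall>y\<in>C. \<forall>z\<in>C. br (x + y) z = br x z + br y z)
     \<and> (\<forall>c. \<forall>x\<in>C. \<forall>y\<in>C. br (sm (of_real c) x) y = sm (of_real c) (br x y))
     \<and> (\<forall>x\<in>C. \<forall>y\<in>C. br x y = - br y x)
     \<and> (\<forall>x\<in>C. \<forall>y\<in>C. \<forall>z\<in>C. br x (br y z) + br y (br z x) + br z (br x y) = 0)
     \<and> (\<forall>x\<in>C. is_derivation (rho x))
     \<and> (\<forall>x\<in>C. \<forall>y\<in>C. \<forall>f. rho (x + y) f = rho x f + rho y f)
     \<and> (\<forall>g. \<forall>x\<in>C. \<forall>f. rho (sm g x) f = g * rho x f)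
     \<and> (\<forall>x\<in>C. \<forall>y\<in>C. \<forall>f. rho (br x y) f = rho x (rho y f) - rho y (rho x f))
     \<and> (\<forall>f. \<forall>x\<in>C. \<forall>y\<in>C. br x (sm f y) = sm f (br x y) + sm (rho x f) y)"

section \<open>Courant algebroids (Liu--Weinstein--Xu, skew-symmetric bracket)\<close>

definition courantD :: "'e set \<Rightarrow> ('e \<Rightarrow> 'e \<Rightarrow> 'r::{comm_ring_1,real_algebra_1}) \<Rightarrow> ('e \<Rightarrow> 'r \<Rightarrow> 'r) \<Rightarrow> 'r \<Rightarrow> 'e" where
  "courantD C pr anc f = (SOME v. v \<in> C \<and> (\<forall>e\<in>C. pr v e = scaleR (1/2) (anc e f)))"

definition courantT :: "('e \<Rightarrow> 'e \<Rightarrow> 'r::{comm_ring_1,real_algebra_1}) \<Rightarrow> ('e \<Rightarrow> 'e \<Rightarrow> 'e) \<Rightarrow> 'e \<Rightarrow> 'e \<Rightarrow> 'e \<Rightarrow> 'r" where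
  "courantT pr brk x y z = scaleR (1/3) (pr (brk x y) z + pr (brk y z) x + pr (brk z x) y)"

definition courant_algebroid :: "'e set \<Rightarrow> ('r::{comm_ring_1,real_algebra_1} \<Rightarrow> 'e \<Rightarrow> 'e::ab_group_add)
    \<Rightarrow> ('e \<Rightarrow> 'e \<Rightarrow> 'r) \<Rightarrow> ('e \<Rightarrow> 'r \<Rightarrow> 'r) \<Rightarrow> ('e \<Rightarrow> 'e \<Rightarrow> 'e) \<Rightarrow> bool" where
  "courant_algebroid C sm pr anc brk \<longleftrightarrow> r_module C sm \<and> fg_projective C sm
     \<comment> \<open>symmetric nondegenerate bilinear form\<close>
     \<and> (\<forall>x\<in>C. \<forall>y\<in>C. pr x y = pr y x)
     \<and> (\<forall>x\<in>C. \<forall>y\<in>C. \<forall>z\<in>C. pr (x + y) z = pr x z + pr y z)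
     \<and> (\<forall>f. \<forall>x\<in>C. \<forall>y\<in>C. pr (sm f x) y = f * pr x y)
     \<and> (\<forall>x\<in>C. (\<forall>y\<in>C. pr x y = 0) \<longrightarrow> x = 0)
     \<and> (\<forall>\<phi>. lin_functional C sm \<phi> \<longrightarrow> (\<exists>x\<in>C. \<forall>y\<in>C. \<phi> y = pr x y))
     \<comment> \<open>anchor: bundle map to the tangent bundle (derivations)\<close>
     \<and> (\<forall>x\<in>C. is_derivation (anc x))
     \<and> (\<forall>x\<in>C. \<forall>y\<in>C. \<forall>f. anc (x + y) f = anc x f + anc y f)
     \<and> (\<forall>g. \<forall>x\<in>C. \<forall>f. anc (sm g x) f = g * anc x f)
     \<comment> \<open>skew-symmetric R-bilinear bracket on sections\<close>
     \<and> (\<forall>x\<in>C. \<forall>y\<in>C. brk x y \<in> C)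
     \<and> (\<forall>x\<in>C. \<forall>y\<in>C. \<forall>z\<in>C. brk (x + y) z = brk x z + brk y z)
     \<and> (\<forall>c. \<forall>x\<in>C. \<forall>y\<in>C. brk (sm (of_real c) x) y = sm (of_real c) (brk x y))
     \<and> (\<forall>x\<in>C. \<forall>y\<in>C. brk x y = - brk y x)
     \<comment> \<open>axioms (1)--(5)\<close>
     \<and> (\<forall>x\<in>C. \<forall>y\<in>C. \<forall>z\<in>C. brk (brk x y) z + brk (brk y z) x + brk (brk z x) y
            = courantD C pr anc (courantT pr brk x y z))
     \<and> (\<forall>x\<in>C. \<forall>y\<in>C. \<forall>f. anc (brk x y) f = anc x (anc y f) - anc y (anc x f))
     \<and> (\<forall>x\<in>C. \<forall>y\<in>C. \<forall>f. brk x (sm f y)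
            = sm f (brk x y) + sm (anc x f) y - sm (pr x y) (courantD C pr anc f))
     \<and> (\<forall>f g. anc (courantD C pr anc f) g = 0)
     \<and> (\<forall>e\<in>C. \<forall>h1\<in>C. \<forall>h2\<in>C. anc e (pr h1 h2)
            = pr (brk e h1 + courantD C pr anc (pr e h1)) h2 + pr h1 (brk e h2 + courantD C pr anc (pr e h2)))"

text \<open>Sections of A are the type 'a (module action sm, bracket br, anchor rho acting on functions);
  sections of A* are the R-linear functionals on 'a.\<close>

definition dual1 :: "('r::comm_ring_1 \<Rightarrow> 'a::ab_group_add \<Rightarrow> 'a) \<Rightarrow> ('a \<Rightarrow> 'r) set" where
  "dual1 sm = {\<alpha>. lin_functional UNIV sm \<alpha>}"

definition dsm :: "'r::comm_ring_1 \<Rightarrow> ('a \<Rightarrow> 'r) \<Rightarrow> ('a \<Rightarrow> 'r)" where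
  "dsm f \<alpha> = (\<lambda>X. f * \<alpha> X)"

definition lie1 :: "('a \<Rightarrow> 'a \<Rightarrow> 'a) \<Rightarrow> ('a \<Rightarrow> 'r \<Rightarrow> 'r) \<Rightarrow> 'a \<Rightarrow> ('a \<Rightarrow> 'r::comm_ring_1) \<Rightarrow> ('a \<Rightarrow> 'r)" where
  "lie1 br rho X \<beta> = (\<lambda>Y. rho X (\<beta> Y) - \<beta> (br X Y))"

text \<open>Bracket of A*_pi; P is pi-sharp, and pi(alpha,beta) = beta(pi-sharp alpha).\<close>
definition brpi :: "('a \<Rightarrow> 'a \<Rightarrow> 'a) \<Rightarrow> ('a \<Rightarrow> 'r \<Rightarrow> 'r) \<Rightarrow> (('a \<Rightarrow> 'r) \<Rightarrow> 'a) \<Rightarrow> ('a \<Rightarrow> 'r::comm_ring_1) \<Rightarrow> ('a \<Rightarrow> 'r) \<Rightarrow> ('a \<Rightarrow> 'r)" where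
  "brpi br rho P \<alpha> \<beta> = (\<lambda>Y. lie1 br rho (P \<alpha>) \<beta> Y - lie1 br rho (P \<beta>) \<alpha> Y - rho Y (\<beta> (P \<alpha>)))"

definition form :: "('r::comm_ring_1 \<Rightarrow> 'a::ab_group_add \<Rightarrow> 'a) \<Rightarrow> nat \<Rightarrow> ('a list \<Rightarrow> 'r) set" where
  "form sm k = {\<omega>. (\<forall>xs. length xs \<noteq> k \<longrightarrow> \<omega> xs = 0)
     \<and> (\<forall>xs i X Y. length xs = k \<longrightarrow> i < k \<longrightarrow> \<omega> (xs[i := X + Y]) = \<omega> (xs[i := X]) + \<omega> (xs[i := Y]))
     \<and> (\<forall>xs i f X. length xs = k \<longrightarrow> i < k \<longrightarrow> \<omega> (xs[i := sm f X]) = f * \<omega> (xs[i := X]))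
     \<and> (\<forall>xs i j. length xs = k \<longrightarrow> i < j \<longrightarrow> j < k \<longrightarrow> xs ! i = xs ! j \<longrightarrow> \<omega> xs = 0)}"

definition form0 :: "'r::zero \<Rightarrow> ('a list \<Rightarrow> 'r)" where
  "form0 f = (\<lambda>xs. if xs = [] then f else 0)"

definition form1 :: "('a \<Rightarrow> 'r::zero) \<Rightarrow> ('a list \<Rightarrow> 'r)" where
  "form1 \<alpha> = (\<lambda>xs. case xs of [X] \<Rightarrow> \<alpha> X | _ \<Rightarrow> 0)"

definition form2 :: "('a \<Rightarrow> 'a \<Rightarrow> 'r::zero) \<Rightarrow> ('a list \<Rightarrow> 'r)" where
  "form2 S = (\<lambda>xs. case xs of [X, Y] \<Rightarrow> S X Y | _ \<Rightarrow> 0)"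

definition del_at :: "nat \<Rightarrow> 'a list \<Rightarrow> 'a list" where
  "del_at i xs = take i xs @ drop (Suc i) xs"

definition extd :: "('a \<Rightarrow> 'a \<Rightarrow> 'a) \<Rightarrow> ('a \<Rightarrow> 'r \<Rightarrow> 'r) \<Rightarrow> ('a list \<Rightarrow> 'r::comm_ring_1) \<Rightarrow> ('a list \<Rightarrow> 'r)" where
  "extd br rho \<omega> = (\<lambda>xs. if xs = [] then 0 else
      (\<Sum>i<length xs. (-1) ^ i * rho (xs ! i) (\<omega> (del_at i xs)))
    + (\<Sum>i<length xs. \<Sum>j<length xs. if i < j
         then (-1) ^ (i + j) * \<omega> (br (xs ! i) (xs ! j) # del_at i (del_at j xs)) else 0))"

definition ictr :: "'a \<Rightarrow> ('a list \<Rightarrow> 'r) \<Rightarrow> ('a list \<Rightarrow> 'r)" where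
  "ictr X \<omega> = (\<lambda>xs. \<omega> (X # xs))"

definition iN :: "('a \<Rightarrow> 'a) \<Rightarrow> ('a list \<Rightarrow> 'r::comm_monoid_add) \<Rightarrow> ('a list \<Rightarrow> 'r)" where
  "iN N \<omega> = (\<lambda>xs. \<Sum>j<length xs. \<omega> (xs[j := N (xs ! j)]))"

definition dN :: "('a \<Rightarrow> 'a \<Rightarrow> 'a) \<Rightarrow> ('a \<Rightarrow> 'r \<Rightarrow> 'r) \<Rightarrow> ('a \<Rightarrow> 'a) \<Rightarrow> ('a list \<Rightarrow> 'r::comm_ring_1) \<Rightarrow> ('a list \<Rightarrow> 'r)" where
  "dN br rho N \<omega> = (\<lambda>xs. iN N (extd br rho \<omega>) xs - extd br rho (iN N \<omega>) xs)"

definition wedge :: "nat \<Rightarrow> nat \<Rightarrow> ('a list \<Rightarrow> 'r::{comm_ring_1,real_algebra_1}) \<Rightarrow> ('a list \<Rightarrow> 'r) \<Rightarrow> ('a list \<Rightarrow> 'r)" where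
  "wedge p q \<alpha> \<beta> = (\<lambda>xs. if length xs = p + q then
     scaleR (1 / (fact p * fact q))
       (\<Sum>\<sigma> \<in> {\<sigma>. \<sigma> permutes {..<p + q}}. of_int (sign \<sigma>)
          * \<alpha> (map (\<lambda>i. xs ! \<sigma> i) [0..<p]) * \<beta> (map (\<lambda>i. xs ! \<sigma> (p + i)) [0..<q]))
     else 0)"

text \<open>A fixed dual basis of A (exists since A is a vector bundle), used to write pi as a bivector.\<close>
definition dbasis :: "('r::comm_ring_1 \<Rightarrow> 'a::ab_group_add \<Rightarrow> 'a) \<Rightarrow> ('a \<times> ('a \<Rightarrow> 'r)) list" where
  "dbasis sm = (SOME bs. is_dual_basis UNIV sm bs)"

text \<open>Contraction i_pi with the bivector pi = 1/2 sum e_i wedge pi-sharp(phi_i), so that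
  i_pi (alpha wedge beta) = pi(alpha,beta).\<close>
definition ipi :: "('r::{comm_ring_1,real_algebra_1} \<Rightarrow> 'a::ab_group_add \<Rightarrow> 'a) \<Rightarrow> (('a \<Rightarrow> 'r) \<Rightarrow> 'a)
    \<Rightarrow> ('a list \<Rightarrow> 'r) \<Rightarrow> ('a list \<Rightarrow> 'r)" where
  "ipi sm P \<omega> = (\<lambda>xs. scaleR (1/2) (\<Sum>(e, \<phi>)\<leftarrow>dbasis sm. \<omega> (e # P \<phi> # xs)))"

definition delpi :: "('r::{comm_ring_1,real_algebra_1} \<Rightarrow> 'a::ab_group_add \<Rightarrow> 'a) \<Rightarrow> ('a \<Rightarrow> 'a \<Rightarrow> 'a)
    \<Rightarrow> ('a \<Rightarrow> 'r \<Rightarrow> 'r) \<Rightarrow> (('a \<Rightarrow> 'r) \<Rightarrow> 'a) \<Rightarrow> ('a list \<Rightarrow> 'r) \<Rightarrow> ('a list \<Rightarrow> 'r)" where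
  "delpi sm br rho P \<omega> = (\<lambda>xs. ipi sm P (extd br rho \<omega>) xs - extd br rho (ipi sm P \<omega>) xs)"

text \<open>Schouten bracket of the Lie algebroid A*_pi on its multivectors Gamma(wedge^bullet A*) = forms on A
  (the Koszul bracket): [a,b] = (-1)^p (del(a wedge b) - del a wedge b - (-1)^p a wedge del b),
  del = [i_pi, d].\<close>
definition schouten :: "('r::{comm_ring_1,real_algebra_1} \<Rightarrow> 'a::ab_group_add \<Rightarrow> 'a) \<Rightarrow> ('a \<Rightarrow> 'a \<Rightarrow> 'a)
    \<Rightarrow> ('a \<Rightarrow> 'r \<Rightarrow> 'r) \<Rightarrow> (('a \<Rightarrow> 'r) \<Rightarrow> 'a) \<Rightarrow> nat \<Rightarrow> nat \<Rightarrow> ('a list \<Rightarrow> 'r) \<Rightarrow> ('a list \<Rightarrow> 'r) \<Rightarrow> ('a list \<Rightarrow> 'r)" where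
  "schouten sm br rho P p q \<alpha> \<beta> = (\<lambda>xs. (-1) ^ p *
      (delpi sm br rho P (wedge p q \<alpha> \<beta>) xs
       - wedge (p - 1) q (delpi sm br rho P \<alpha>) \<beta> xs
       - (-1) ^ p * wedge p (q - 1) \<alpha> (delpi sm br rho P \<beta>) xs))"

text \<open>A section X + alpha of A + A* is the pair (X, alpha).\<close>

definition esm :: "('r::comm_ring_1 \<Rightarrow> 'a \<Rightarrow> 'a) \<Rightarrow> 'r \<Rightarrow> 'a \<times> ('a \<Rightarrow> 'r) \<Rightarrow> 'a \<times> ('a \<Rightarrow> 'r)" where
  "esm sm f e = (sm f (fst e), dsm f (snd e))"

definition std_pair :: "'a \<times> ('a \<Rightarrow> 'r::comm_ring_1) \<Rightarrow> 'a \<times> ('a \<Rightarrow> 'r) \<Rightarrow> 'r" where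
  "std_pair e1 e2 = snd e1 (fst e2) + snd e2 (fst e1)"

definition std_bracket :: "('a \<Rightarrow> 'a \<Rightarrow> 'a) \<Rightarrow> ('a \<Rightarrow> 'r \<Rightarrow> 'r)
    \<Rightarrow> 'a \<times> ('a \<Rightarrow> 'r::{comm_ring_1,real_algebra_1}) \<Rightarrow> 'a \<times> ('a \<Rightarrow> 'r) \<Rightarrow> 'a \<times> ('a \<Rightarrow> 'r)" where
  "std_bracket br rho e1 e2 = (br (fst e1) (fst e2),
     \<lambda>Z. lie1 br rho (fst e1) (snd e2) Z - lie1 br rho (fst e2) (snd e1) Z
         + scaleR (1/2) (rho Z (snd e1 (fst e2) - snd e2 (fst e1))))"

text \<open>The paired operator with blocks N, pi-sharp = P, sigma-flat = S (S X = i_X sigma), -N*.\<close>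
definition paired_operator :: "('r::comm_ring_1 \<Rightarrow> 'a::ab_group_add \<Rightarrow> 'a) \<Rightarrow> ('a \<Rightarrow> 'a)
    \<Rightarrow> (('a \<Rightarrow> 'r) \<Rightarrow> 'a) \<Rightarrow> ('a \<Rightarrow> 'a \<Rightarrow> 'r) \<Rightarrow> bool" where
  "paired_operator sm N P S \<longleftrightarrow>
     (\<forall>X Y. N (X + Y) = N X + N Y) \<and> (\<forall>f X. N (sm f X) = sm f (N X))
     \<and> (\<forall>\<alpha>\<in>dual1 sm. \<forall>\<beta>\<in>dual1 sm. P (\<alpha> + \<beta>) = P \<alpha> + P \<beta>)
     \<and> (\<forall>f. \<forall>\<alpha>\<in>dual1 sm. P (dsm f \<alpha>) = sm f (P \<alpha>))
     \<and> (\<forall>\<alpha>\<in>dual1 sm. \<forall>\<beta>\<in>dual1 sm. \<beta> (P \<alpha>) = - \<alpha> (P \<beta>))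
     \<and> (\<forall>X. S X \<in> dual1 sm)
     \<and> (\<forall>X Y. S (X + Y) = S X + S Y) \<and> (\<forall>f X. S (sm f X) = dsm f (S X))
     \<and> (\<forall>X Y. S X Y = - S Y X)"

definition pop :: "('a \<Rightarrow> 'a::ab_group_add) \<Rightarrow> (('a \<Rightarrow> 'r) \<Rightarrow> 'a) \<Rightarrow> ('a \<Rightarrow> 'a \<Rightarrow> 'r::ab_group_add)
    \<Rightarrow> 'a \<times> ('a \<Rightarrow> 'r) \<Rightarrow> 'a \<times> ('a \<Rightarrow> 'r)" where
  "pop N P S e = (N (fst e) + P (snd e), \<lambda>Y. S (fst e) Y - snd e (N Y))"

definition nbr :: "('a \<Rightarrow> 'a \<Rightarrow> 'a::ab_group_add) \<Rightarrow> ('a \<Rightarrow> 'r \<Rightarrow> 'r) \<Rightarrow> ('a \<Rightarrow> 'a) \<Rightarrow> (('a \<Rightarrow> 'r) \<Rightarrow> 'a)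
    \<Rightarrow> ('a \<Rightarrow> 'a \<Rightarrow> 'r::{comm_ring_1,real_algebra_1}) \<Rightarrow> 'a \<times> ('a \<Rightarrow> 'r) \<Rightarrow> 'a \<times> ('a \<Rightarrow> 'r) \<Rightarrow> 'a \<times> ('a \<Rightarrow> 'r)" where
  "nbr br rho N P S e1 e2 = std_bracket br rho (pop N P S e1) e2 + std_bracket br rho e1 (pop N P S e2)
      - pop N P S (std_bracket br rho e1 e2)"

definition ntorsion :: "('a \<Rightarrow> 'a \<Rightarrow> 'a::ab_group_add) \<Rightarrow> ('a \<Rightarrow> 'r \<Rightarrow> 'r) \<Rightarrow> ('a \<Rightarrow> 'a) \<Rightarrow> (('a \<Rightarrow> 'r) \<Rightarrow> 'a)
    \<Rightarrow> ('a \<Rightarrow> 'a \<Rightarrow> 'r::{comm_ring_1,real_algebra_1}) \<Rightarrow> 'a \<times> ('a \<Rightarrow> 'r) \<Rightarrow> 'a \<times> ('a \<Rightarrow> 'r) \<Rightarrow> 'a \<times> ('a \<Rightarrow> 'r)" where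
  "ntorsion br rho N P S e1 e2 = std_bracket br rho (pop N P S e1) (pop N P S e2)
      - pop N P S (nbr br rho N P S e1 e2)"

definition npair :: "('a \<Rightarrow> 'a::ab_group_add) \<Rightarrow> (('a \<Rightarrow> 'r) \<Rightarrow> 'a) \<Rightarrow> ('a \<Rightarrow> 'a \<Rightarrow> 'r::comm_ring_1)
    \<Rightarrow> 'a \<times> ('a \<Rightarrow> 'r) \<Rightarrow> 'a \<times> ('a \<Rightarrow> 'r) \<Rightarrow> 'r" where
  "npair N P S e1 e2 = std_pair (pop N P S e1) (pop N P S e2)"

definition nanchor :: "('a \<Rightarrow> 'r \<Rightarrow> 'r) \<Rightarrow> ('a \<Rightarrow> 'a) \<Rightarrow> (('a \<Rightarrow> 'r) \<Rightarrow> 'a) \<Rightarrow> 'a \<times> ('a \<Rightarrow> 'r::plus) \<Rightarrow> 'r \<Rightarrow> 'r" where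
  "nanchor rho N P e f = rho (N (fst e)) f + rho (P (snd e)) f"

definition quasi_lie_bialgebroid_piN :: "('r::{comm_ring_1,real_algebra_1} \<Rightarrow> 'a::ab_group_add \<Rightarrow> 'a)
    \<Rightarrow> ('a \<Rightarrow> 'a \<Rightarrow> 'a) \<Rightarrow> ('a \<Rightarrow> 'r \<Rightarrow> 'r) \<Rightarrow> ('a \<Rightarrow> 'a) \<Rightarrow> (('a \<Rightarrow> 'r) \<Rightarrow> 'a) \<Rightarrow> ('a list \<Rightarrow> 'r) \<Rightarrow> bool" where
  "quasi_lie_bialgebroid_piN sm br rho N P Q \<longleftrightarrow>
     lie_algebroid (dual1 sm) dsm (brpi br rho P) (\<lambda>\<alpha>. rho (P \<alpha>))
     \<and> (\<forall>k. \<forall>\<omega>\<in>form sm k. dN br rho N \<omega> \<in> form sm (Suc k))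
     \<and> (\<forall>p q. \<forall>\<alpha>\<in>form sm p. \<forall>\<beta>\<in>form sm q.
          dN br rho N (wedge p q \<alpha> \<beta>)
          = (\<lambda>xs. wedge (Suc p) q (dN br rho N \<alpha>) \<beta> xs + (-1) ^ p * wedge p (Suc q) \<alpha> (dN br rho N \<beta>) xs))
     \<and> (\<forall>p q. \<forall>\<alpha>\<in>form sm p. \<forall>\<beta>\<in>form sm q.
          dN br rho N (schouten sm br rho P p q \<alpha> \<beta>)
          = (\<lambda>xs. schouten sm br rho P (Suc p) q (dN br rho N \<alpha>) \<beta> xs
                 + (-1) ^ (Suc p) * schouten sm br rho P p (Suc q) \<alpha> (dN br rho N \<beta>) xs))
     \<and> Q \<in> form sm 3
     \<and> dN br rho N Q = (\<lambda>xs. 0)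
     \<and> (\<forall>k. \<forall>\<omega>\<in>form sm k. dN br rho N (dN br rho N \<omega>) = schouten sm br rho P 3 k Q \<omega>)"

text \<open>The element of A (= B* ) with prescribed pairings F(Z), Z in A* (= B).\<close>
definition dual_elem :: "('r::comm_ring_1 \<Rightarrow> 'a::ab_group_add \<Rightarrow> 'a) \<Rightarrow> (('a \<Rightarrow> 'r) \<Rightarrow> 'r) \<Rightarrow> 'a" where
  "dual_elem sm F = (\<Sum>(e, \<phi>)\<leftarrow>dbasis sm. sm (F \<phi>) e)"

text \<open>Double of (B, d_*, Q) with B = A*_pi, B* = A, d_* = d_N, Q = d sigma.  A section of the double,
  X + xi with X in B = A*, xi in B* = A, is the pair (xi, X), i.e. identified with xi + X in A + A*.\<close>

definition dbl_anchor :: "('a \<Rightarrow> 'a \<Rightarrow> 'a) \<Rightarrow> ('a \<Rightarrow> 'r \<Rightarrow> 'r) \<Rightarrow> ('a \<Rightarrow> 'a) \<Rightarrow> (('a \<Rightarrow> 'r) \<Rightarrow> 'a)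
    \<Rightarrow> 'a \<times> ('a \<Rightarrow> 'r::comm_ring_1) \<Rightarrow> 'r \<Rightarrow> 'r" where
  "dbl_anchor br rho N P e f = rho (P (snd e)) f + dN br rho N (form0 f) [fst e]"

definition dbl_pair :: "'a \<times> ('a \<Rightarrow> 'r::comm_ring_1) \<Rightarrow> 'a \<times> ('a \<Rightarrow> 'r) \<Rightarrow> 'r" where
  "dbl_pair e1 e2 = snd e2 (fst e1) + snd e1 (fst e2)"

definition dbl_bracket :: "('r::{comm_ring_1,real_algebra_1} \<Rightarrow> 'a::ab_group_add \<Rightarrow> 'a) \<Rightarrow> ('a \<Rightarrow> 'a \<Rightarrow> 'a)
    \<Rightarrow> ('a \<Rightarrow> 'r \<Rightarrow> 'r) \<Rightarrow> ('a \<Rightarrow> 'a) \<Rightarrow> (('a \<Rightarrow> 'r) \<Rightarrow> 'a) \<Rightarrow> ('a list \<Rightarrow> 'r)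
    \<Rightarrow> 'a \<times> ('a \<Rightarrow> 'r) \<Rightarrow> 'a \<times> ('a \<Rightarrow> 'r) \<Rightarrow> 'a \<times> ('a \<Rightarrow> 'r)" where
  "dbl_bracket sm br rho N P Q e1 e2 =
    (let \<xi> = fst e1; X = snd e1; \<eta> = fst e2; Y = snd e2;
         dS = dN br rho N;
         \<comment> \<open>anchor of B* : rho_{B*}(v) f = <v, d_* f>\<close>
         rhoBs = (\<lambda>v f. dS (form0 f) [v]);
         \<comment> \<open>anchor of B = A*_pi\<close>
         rhoB = (\<lambda>Z f. rho (P Z) f);
         \<comment> \<open>L*_v Z = i_v d_* Z + d_* i_v Z, evaluated at W\<close>
         Lstar = (\<lambda>v Z W. ictr v (dS (form1 Z)) [W] + dS (form0 (Z v)) [W]);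
         \<comment> \<open><[xi,eta]_*, Z>\<close>
         bstar = (\<lambda>Z. rhoBs \<xi> (Z \<eta>) - rhoBs \<eta> (Z \<xi>) - dS (form1 Z) [\<xi>, \<eta>]);
         \<comment> \<open><L_U v, Z> for U in B, v in B*\<close>
         LB = (\<lambda>U v Z. rhoB U (Z v) - brpi br rho P U Z v);
         \<comment> \<open><d_B f, Z> = rho_B(Z) f\<close>
         dB = (\<lambda>f Z. rhoB Z f);
         h = Y \<xi> - X \<eta>
     in (dual_elem sm (\<lambda>Z. bstar Z + LB X \<eta> Z - LB Y \<xi> Z + scaleR (1/2) (dB h Z)),
         \<lambda>W. brpi br rho P X Y W + Lstar \<xi> Y W - Lstar \<eta> X W
             - scaleR (1/2) (dS (form0 h) [W]) + Q [\<xi>, \<eta>, W]))"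

end

theory Submission
  imports Defs "Jordan_Normal_Form.Determinant"
begin

text \<open>
  Since \<open>\<N>\<^sup>2 = -1\<close>, the torsion \<open>\<langle>\<T>(e\<^sub>1, e\<^sub>2), e\<^sub>3\<rangle>\<close> is skew-symmetric in all arguments; every
  component of it has two arguments in \<open>A\<close> or two in \<open>A\<^sup>*\<close>, so the hypotheses kill all of it. Hence
  \<open>\<N>\<close> carries the deformed bracket, anchor and pairing to the standard ones, and the axioms of
  a Courant algebroid are transported from the standard structure.

  The Leibniz identity of the Dorfman bracket, paired with a fourth section, reads
  \<open>\<Sum> \<plusminus> \<rho>(e\<^sub>i) C\<^sub>j\<^sub>k\<^sub>l + \<Sum> \<plusminus> \<langle>e\<^sub>i \<circ> e\<^sub>j, e\<^sub>k \<circ> e\<^sub>l\<rangle> = 0\<close> with \<open>C\<^sub>i\<^sub>j\<^sub>k = \<langle>e\<^sub>i \<circ> e\<^sub>j, e\<^sub>k\<rangle>\<close>.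
  Its components for the deformed bracket are the axioms of the quasi-Lie bialgebroid: four sections
  of \<open>A\<close> give \<open>d\<^sub>N d\<sigma> = 0\<close>, three give \<open>d\<^sub>N\<^sup>2 = [d\<sigma>, -]\<close> on 1-forms, two give the derivation
  property of \<open>d\<^sub>N\<close> on a pair of 1-forms, and one gives the Jacobi identity of \<open>[-, -]\<^sub>\<pi>\<close>.
  Functions and 1-forms generate all forms, and both sides of each identity are derivations, so
  this suffices. The derivation properties come from two facts: \<open>d\<^sub>N = [i\<^sub>N, d]\<close> is itself the Koszul
  differential of the deformed bracket \<open>[NX, Y] + [X, NY] - N[X, Y]\<close>, and the Koszul bracket is
  \<open>[\<alpha>, \<beta>] = \<Sum>\<^sub>i L\<^bsub>e\<^sub>i\<^esub> \<alpha> \<and> i\<^bsub>\<pi>\<phi>\<^sub>i\<^esub> \<beta> \<plusminus> i\<^bsub>e\<^sub>i\<^esub> \<alpha> \<and> L\<^bsub>\<pi>\<phi>\<^sub>i\<^esub> \<beta>\<close> for a dual basis \<open>(e\<^sub>i, \<phi>\<^sub>i)\<close>.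
\<close>

text \<open>The obstacle is sign and degree bookkeeping for forms of arbitrary degree. It is avoided
  by describing a form through its contractions \<open>ictr X\<close>: an identity between operators
  on forms is checked by contracting with one section and inducting on the argument list, with
  Cartan's formula doing the work for differentials. Permutations appear only when \<open>wd\<close>
  is compared with \<open>wedge\<close>. The deformed bracket on A has no Jacobi identity (its
  differential squares to the bracket with Q), so the calculus is built for a bracket that is merely
  skew with a Leibniz rule. On A + A* the Dorfman bracket replaces the skew bracket, because its
  Leibniz identity carries no correction term; the half-gradients separating the two are restored at
  the end. Brackets are tested through scalar pairings, which is lossless by nondegeneracy. Division
  by 2, by 3 and by the degree of a form is possible because functions form a real algebra.\<close>

section \<open>Alternating forms and their exterior product\<close>

definition par :: "('a list \<Rightarrow> 'r::comm_ring_1) \<Rightarrow> 'a list \<Rightarrow> 'r" where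
  "par a = (\<lambda>xs. (-1) ^ length xs * a xs)"

text \<open>Exterior product of inhomogeneous forms, determined by the antiderivation rule for
  contractions; \<open>par\<close> carries the sign \<open>(-1)\<^sup>p\<close>, so that no degrees occur.\<close>
fun wd :: "('a list \<Rightarrow> 'r::comm_ring_1) \<Rightarrow> ('a list \<Rightarrow> 'r) \<Rightarrow> 'a list \<Rightarrow> 'r" where
  "wd a b [] = a [] * b []"
| "wd a b (X # xs) = wd (ictr X a) b xs + wd (par a) (ictr X b) xs"

lemma ictr_apply: "ictr X a xs = a (X # xs)"
  by (simp add: ictr_def)

lemma ictr_linear [simp]:
  "ictr X (a + b) = ictr X a + ictr X b"
  "ictr X (a - b) = ictr X a - ictr X b"
  "ictr X (- a) = - ictr X a"
  "ictr X 0 = 0"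
  "ictr X (dsm f a) = dsm f (ictr X a)"
  by (auto simp: ictr_def dsm_def)

lemma dsm_linear [simp]:
  "dsm f (a + b) = dsm f a + dsm f b"
  "dsm f (a - b) = dsm f a - dsm f b"
  "dsm f (- a) = - dsm f a"
  "dsm f 0 = 0"
  "dsm 0 a = 0"
  "dsm 1 a = a"
  "dsm (- f) a = - dsm f a"
  "dsm f (dsm g a) = dsm (f * g) a"
  by (auto simp: dsm_def algebra_simps)

lemma dsm_apply: "dsm f a x = f * a x"
  by (simp add: dsm_def)

lemma par_linear [simp]:
  "par (a + b) = par a + par b"
  "par (a - b) = par a - par b"
  "par (- a) = - par a"
  "par 0 = 0"
  "par (dsm f a) = dsm f (par a)"
  by (auto simp: par_def dsm_def algebra_simps)

lemma par_par [simp]: "par (par a) = a"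
  by (simp add: par_def mult.assoc [symmetric] power_mult_distrib [symmetric])

lemma ictr_par [simp]: "ictr X (par a) = - par (ictr X a)"
  by (auto simp: par_def ictr_def)

lemma par_Nil [simp]: "par a [] = a []"
  by (simp add: par_def)

lemma ictr_wd: "ictr X (wd a b) = wd (ictr X a) b + wd (par a) (ictr X b)"
  by (rule ext) (simp add: ictr_apply)

lemma list_fun_eqI:
  assumes "a [] = b []" "\<And>X. ictr X a = ictr X b"
  shows "a = b"
proof
  fix xs show "a xs = b xs"
    using assms by (cases xs) (auto simp: ictr_def fun_eq_iff)
qed

lemma wd_add_left: "wd (a + a') b = wd a b + wd a' b"
proof
  fix xs show "wd (a + a') b xs = (wd a b + wd a' b) xs"
    by (induct xs arbitrary: a a' b) (simp_all add: algebra_simps)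
qed

lemma wd_add_right: "wd a (b + b') = wd a b + wd a b'"
proof
  fix xs show "wd a (b + b') xs = (wd a b + wd a b') xs"
    by (induct xs arbitrary: a b b') (simp_all add: algebra_simps)
qed

lemma wd_dsm_left: "wd (dsm f a) b = dsm f (wd a b)"
proof
  fix xs show "wd (dsm f a) b xs = dsm f (wd a b) xs"
    by (induct xs arbitrary: a b) (simp_all add: dsm_apply algebra_simps)
qed

lemma wd_dsm_right: "wd a (dsm f b) = dsm f (wd a b)"
proof
  fix xs show "wd a (dsm f b) xs = dsm f (wd a b) xs"
    by (induct xs arbitrary: a b) (simp_all add: dsm_apply algebra_simps)
qed

lemma wd_minus_left: "wd (- a) b = - wd a b"
  using wd_dsm_left [of "-1" a b] by simp

lemma wd_minus_right: "wd a (- b) = - wd a b"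
  using wd_dsm_right [of a "-1" b] by simp

lemma wd_zero_left: "wd 0 b = 0"
  using wd_dsm_left [of "0" 0 b] by simp

lemma wd_zero_right: "wd a 0 = 0"
  using wd_dsm_right [of a 0 0] by simp

lemma wd_diff_left: "wd (a - a') b = wd a b - wd a' b"
  using wd_add_left [of a "- a'" b] by (simp add: wd_minus_left)

lemma wd_diff_right: "wd a (b - b') = wd a b - wd a b'"
  using wd_add_right [of a b "- b'"] by (simp add: wd_minus_right)

lemmas wd_linear [simp] = wd_add_left wd_add_right wd_dsm_left wd_dsm_right wd_minus_left
  wd_minus_right wd_zero_left wd_zero_right wd_diff_left wd_diff_right

lemma par_wd [simp]: "par (wd a b) = wd (par a) (par b)"
proof
  fix xs show "par (wd a b) xs = wd (par a) (par b) xs"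
  proof (induct xs arbitrary: a b)
    case (Cons X xs)
    have "par (wd a b) (X # xs) = - par (ictr X (wd a b)) xs"
      by (simp add: ictr_apply par_def)
    also have "\<dots> = wd (par a) (par b) (X # xs)"
      using Cons by (simp add: ictr_wd)
    finally show ?case .
  qed simp
qed

lemma wd_assoc: "wd (wd a b) c = wd a (wd b c)"
proof
  fix xs show "wd (wd a b) c xs = wd a (wd b c) xs"
  proof (induct xs arbitrary: a b c)
    case (Cons X xs)
    then show ?case by (simp add: ictr_wd)
  qed simp
qed

section \<open>Homogeneous forms and graded commutativity\<close>

definition homog :: "nat \<Rightarrow> ('a list \<Rightarrow> 'r::zero) \<Rightarrow> bool" where
  "homog k a \<longleftrightarrow> (\<forall>xs. length xs \<noteq> k \<longrightarrow> a xs = 0)"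

lemma homog_ictr: "homog (Suc k) a \<Longrightarrow> homog k (ictr X a)"
  by (auto simp: homog_def ictr_def)

lemma homog_ictr_0: "homog 0 a \<Longrightarrow> ictr X a = 0"
  by (auto simp: homog_def ictr_def fun_eq_iff)

lemma homog_par: "homog k a \<Longrightarrow> par a = dsm ((-1) ^ k) a"
  by (force simp: homog_def par_def dsm_def fun_eq_iff)

lemma homog_parI: "homog k a \<Longrightarrow> homog k (par a)"
  by (auto simp: homog_def par_def)

lemma homog_linear:
  "homog k a \<Longrightarrow> homog k b \<Longrightarrow> homog k (a + b)"
  "homog k a \<Longrightarrow> homog k b \<Longrightarrow> homog k (a - b)"
  "homog k a \<Longrightarrow> homog k (- a)"
  "homog k 0"
  "homog k a \<Longrightarrow> homog k (dsm f a)"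
  by (auto simp: homog_def dsm_def)

lemma homog_form0: "homog 0 (form0 f)"
  by (auto simp: homog_def form0_def)

lemma homog_form1: "homog (Suc 0) (form1 f)"
  by (auto simp: homog_def form1_def split: list.splits)

lemma homog_wd: "homog p a \<Longrightarrow> homog q b \<Longrightarrow> homog (p + q) (wd a b)"
proof -
  have "homog p a \<Longrightarrow> homog q b \<Longrightarrow> length xs \<noteq> p + q \<Longrightarrow> wd a b xs = 0" for xs
  proof (induct xs arbitrary: p q a b)
    case Nil
    then show ?case by (auto simp: homog_def)
  next
    case (Cons X xs)
    have 1: "wd (ictr X a) b xs = 0"
    proof (cases p)
      case 0 then show ?thesis using Cons by (simp add: homog_ictr_0)
    next
      case (Suc p') then show ?thesis
        using Cons.hyps [of p' "ictr X a" q b] Cons.prems by (auto simp: homog_ictr)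
    qed
    have 2: "wd (par a) (ictr X b) xs = 0"
    proof (cases q)
      case 0 then show ?thesis using Cons by (simp add: homog_ictr_0)
    next
      case (Suc q') then show ?thesis
        using Cons.hyps [of p "par a" q' "ictr X b"] Cons.prems by (auto simp: homog_ictr homog_parI)
    qed
    show ?case using 1 2 by simp
  qed
  then show "homog p a \<Longrightarrow> homog q b \<Longrightarrow> homog (p + q) (wd a b)"
    by (auto simp: homog_def)
qed

text \<open>With \<open>a\<close> inhomogeneous, the Koszul sign for moving \<open>c\<close> past it
  depends on the component of \<open>a\<close>; \<open>q\<close> iterates of \<open>par\<close>
  produce the right sign in every degree at once, which keeps the induction free of the degree of
  \<open>a\<close>.\<close>

lemma wd_commute_gen:
  "homog q c \<Longrightarrow> wd c a = wd ((par ^^ q) a) c"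
proof
  fix xs assume "homog q c"
  then show "wd c a xs = wd ((par ^^ q) a) c xs"
  proof (induct xs arbitrary: q c a)
    case Nil
    have "(par ^^ q) a [] = a []" by (induct q) auto
    then show ?case by simp
  next
    case (Cons X xs)
    have ip: "ictr X ((par ^^ q) a) = dsm ((-1) ^ q) ((par ^^ q) (ictr X a))" for q
      by (induct q) auto
    have pp: "par ((par ^^ q) a) = (par ^^ q) (par a)" for q
      by (induct q) auto
    have pl: "(par ^^ q) (dsm f a) = dsm f ((par ^^ q) a)" for q f a
      by (induct q) auto
    have 1: "wd (ictr X c) a xs = wd (par ((par ^^ q) a)) (ictr X c) xs"
    proof (cases q)
      case 0 then show ?thesis using Cons by (simp add: homog_ictr_0)
    next
      case (Suc q') then show ?thesis
        using Cons.hyps [of q' "ictr X c"  a] Cons.prems by (simp add: homog_ictr)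
    qed
    have 2: "wd (par c) (ictr X a) xs = wd (ictr X ((par ^^ q) a)) c xs"
      using Cons.hyps [OF Cons.prems, of "ictr X a"] Cons.prems by (simp add: ip homog_par dsm_apply)
    show ?case using 1 2 by simp
  qed
qed

lemma wd_commute:
  assumes "homog p a" "homog q b"
  shows "wd a b = dsm ((-1) ^ (p * q)) (wd b a)"
proof -
  have "(par ^^ p) b = dsm ((-1) ^ (p * q)) b"
  proof (induct p)
    case (Suc p) then show ?case using assms by (simp add: homog_par power_add mult.commute)
  qed simp
  then show ?thesis using wd_commute_gen [OF assms(1), of b] by simp
qed

lemma wd_one_commute: "wd (form1 \<phi>) a = wd (par a) (form1 \<phi>)"
  using wd_commute_gen [OF homog_form1, of \<phi> a] by simp

lemma form0_Nil [simp]: "form0 f [] = f"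
  by (simp add: form0_def)

lemma ictr_form0 [simp]: "ictr X (form0 f) = 0"
  by (auto simp: ictr_def form0_def)

lemma ictr_form1 [simp]: "ictr X (form1 \<phi>) = form0 (\<phi> X)"
  by (auto simp: ictr_def form0_def form1_def split: list.splits)

lemma par_form0 [simp]: "par (form0 f) = form0 f"
  by (auto simp: par_def form0_def)

lemma par_form1 [simp]: "par (form1 f) = - form1 f"
  by (auto simp: par_def form1_def split: list.splits)

lemma wd_form0_left [simp]: "wd (form0 f) a = dsm f a"
proof
  fix xs show "wd (form0 f) a xs = dsm f a xs"
    by (induct xs arbitrary: a) (simp_all add: dsm_apply ictr_apply)
qed

lemma wd_form0_right [simp]: "wd a (form0 f) = dsm f a"
  using wd_commute_gen [OF homog_form0, of f a] by simp

lemma homog0_eq: "homog 0 a \<Longrightarrow> a = form0 (a [])"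
  by (auto simp: homog_def form0_def)

subsection \<open>Multilinear alternating functions on lists of sections\<close>

text \<open>The conditions on a form include the same conditions on its contractions, a coinductive
  requirement. The number counts how many levels of contraction are inspected, which makes the
  recursion terminate and gives an induction variable for closure properties.\<close>

fun mformn :: "('r::comm_ring_1 \<Rightarrow> 'a::ab_group_add \<Rightarrow> 'a) \<Rightarrow> nat \<Rightarrow> ('a list \<Rightarrow> 'r) \<Rightarrow> bool" where
  "mformn sm 0 a = True"
| "mformn sm (Suc n) a = ((\<forall>X Y. ictr (X + Y) a = ictr X a + ictr Y a)
     \<and> (\<forall>f X. ictr (sm f X) a = dsm f (ictr X a))
     \<and> (\<forall>X. ictr X (ictr X a) = 0) \<and> (\<forall>X. mformn sm n (ictr X a)))"

text \<open>Inhomogeneous forms; the recursion on contractions expresses that they are multilinear and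
  alternating in every degree.\<close>
definition mform :: "('r::comm_ring_1 \<Rightarrow> 'a::ab_group_add \<Rightarrow> 'a) \<Rightarrow> ('a list \<Rightarrow> 'r) \<Rightarrow> bool" where
  "mform sm a \<longleftrightarrow> (\<forall>n. mformn sm n a)"

lemma mform_iff:
  "mform sm a \<longleftrightarrow> (\<forall>X Y. ictr (X + Y) a = ictr X a + ictr Y a)
     \<and> (\<forall>f X. ictr (sm f X) a = dsm f (ictr X a))
     \<and> (\<forall>X. ictr X (ictr X a) = 0) \<and> (\<forall>X. mform sm (ictr X a))"
  (is "_ \<longleftrightarrow> ?R")
proof
  assume m: "mform sm a"
  show ?R using m unfolding mform_def by (metis mformn.simps(2))
next
  assume ?R
  then have "mformn sm n a" for n
    by (cases n) (auto simp: mform_def)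
  then show "mform sm a" by (simp add: mform_def)
qed

lemma mformD:
  assumes "mform sm a"
  shows "ictr (X + Y) a = ictr X a + ictr Y a"
    "ictr (sm f X) a = dsm f (ictr X a)"
    "ictr X (ictr X a) = 0"
    "mform sm (ictr X a)"
  using assms mform_iff [of sm a] by auto

lemma mform_ictr_zero: "mform sm a \<Longrightarrow> ictr 0 a = 0"
  using mformD(1) [of sm a 0 0] by simp

lemma mform_ictr_minus: "mform sm a \<Longrightarrow> ictr (- X) a = - ictr X a"
  using mformD(1) [of sm a X "- X"] mform_ictr_zero [of sm a] by (simp add: eq_neg_iff_add_eq_0 add.commute)

lemma mform_ictr_diff: "mform sm a \<Longrightarrow> ictr (X - Y) a = ictr X a - ictr Y a"
  using mformD(1) [of sm a X "- Y"] mform_ictr_minus [of sm a Y] by simp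

lemma mform_ictr_sum: "mform sm a \<Longrightarrow> ictr (\<Sum>i\<in>I. x i) a = (\<Sum>i\<in>I. ictr (x i) a)"
  by (induct I rule: infinite_finite_induct) (simp_all add: mform_ictr_zero mformD(1))

text \<open>Polarization of the alternating condition at \<open>X + Y\<close>.\<close>

lemma mform_ictr_anti:
  assumes "mform sm a" shows "ictr X (ictr Y a) = - ictr Y (ictr X a)"
proof -
  have "ictr (X + Y) (ictr (X + Y) a) = 0" using assms by (rule mformD(3))
  then have "ictr Y (ictr X a) + ictr X (ictr Y a) = 0"
    using assms by (simp add: mformD(1) mformD(3) mformD(1) [OF mformD(4)])
  then show ?thesis by (metis add.commute eq_neg_iff_add_eq_0)
qed

lemma mformn_linear:
  "mformn sm n a \<Longrightarrow> mformn sm n b \<Longrightarrow> mformn sm n (a + b)"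
  "mformn sm n a \<Longrightarrow> mformn sm n (dsm f a)"
  "mformn sm n 0"
  by (induct n arbitrary: a b) (auto simp: algebra_simps)

lemma mform_zero: "mform sm 0"
  and mform_add: "mform sm a \<Longrightarrow> mform sm b \<Longrightarrow> mform sm (a + b)"
  and mform_dsm: "mform sm a \<Longrightarrow> mform sm (dsm f a)"
  by (simp_all add: mform_def mformn_linear)

lemma mform_minus: "mform sm a \<Longrightarrow> mform sm (- a)"
  using mform_dsm [of sm a "-1"] by simp

lemma mform_diff: "mform sm a \<Longrightarrow> mform sm b \<Longrightarrow> mform sm (a - b)"
  using mform_add [of sm a "- b"] mform_minus by fastforce

lemma mform_sum: "(\<And>i. i \<in> I \<Longrightarrow> mform sm (a i)) \<Longrightarrow> mform sm (\<Sum>i\<in>I. a i)"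
  by (induct I rule: infinite_finite_induct) (simp_all add: mform_zero mform_add)

lemma mform_par:
  assumes "mform sm a" shows "mform sm (par a)"
proof -
  have "mform sm a \<Longrightarrow> mformn sm n (par a)" for n
  proof (induct n arbitrary: a)
    case (Suc n)
    have "mformn sm n (- par (ictr X a))" for X
      using mformn_linear(2) [of sm n "par (ictr X a)" "-1"] Suc by (simp add: mformD)
    then show ?case using Suc.prems by (simp add: mformD)
  qed simp
  then show ?thesis using assms by (simp add: mform_def)
qed

lemma mform_wd:
  assumes "mform sm a" "mform sm b"
  shows "mform sm (wd a b)"
proof -
  have "mform sm a \<Longrightarrow> mform sm b \<Longrightarrow> mformn sm n (wd a b)" for n
  proof (induct n arbitrary: a b)
    case (Suc n)
    then show ?case
      by (simp add: ictr_wd mformD mformn_linear mform_par algebra_simps)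
  qed simp
  then show ?thesis using assms by (simp add: mform_def)
qed

lemma mform_form0 [simp]: "mform sm (form0 f)"
  by (subst mform_iff) (simp add: mform_zero)

lemma form0_linear:
  "form0 (f + g) = form0 f + form0 g" "form0 (f * g) = dsm f (form0 g)" "form0 0 = (0::_\<Rightarrow>'r::comm_ring_1)"
  "form0 (- f') = - form0 (f'::'r)" "form0 (f' - g') = form0 f' - form0 (g'::'r)"
  by (auto simp: form0_def dsm_def)

lemma mform_form1: "lin_functional UNIV sm \<phi> \<Longrightarrow> mform sm (form1 \<phi>)"
  by (subst mform_iff) (simp add: lin_functional_def form0_linear)

lemma mform_homog1: "mform sm a \<Longrightarrow> lin_functional UNIV sm (\<lambda>X. a [X])"
  using mformD(1) [of sm a] mformD(2) [of sm a]
  by (auto simp: lin_functional_def ictr_def dsm_def fun_eq_iff)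

lemma mform_update:
  assumes "mform sm a"
  shows "i < length xs \<Longrightarrow> a (xs[i := X + Y]) = a (xs[i := X]) + a (xs[i := Y])"
    and "i < length xs \<Longrightarrow> a (xs[i := sm f X]) = f * a (xs[i := X])"
    and "i < j \<Longrightarrow> j < length xs \<Longrightarrow> xs ! i = xs ! j \<Longrightarrow> a xs = 0"
proof -
  show "i < length xs \<Longrightarrow> a (xs[i := X + Y]) = a (xs[i := X]) + a (xs[i := Y])"
    using assms
  proof (induct xs arbitrary: i a)
    case (Cons Z xs)
    show ?case
    proof (cases i)
      case 0 then show ?thesis using mformD(1) [OF Cons.prems(2), of X Y] by (simp add: ictr_def fun_eq_iff)
    next
      case (Suc i') then show ?thesis
        using Cons.hyps [of i' "ictr Z a", OF _ mformD(4) [OF Cons.prems(2)]] Cons.prems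
        by (simp add: ictr_def)
    qed
  qed simp
  show "i < length xs \<Longrightarrow> a (xs[i := sm f X]) = f * a (xs[i := X])"
    using assms
  proof (induct xs arbitrary: i a)
    case (Cons Z xs)
    show ?case
    proof (cases i)
      case 0 then show ?thesis using mformD(2) [OF Cons.prems(2), of f X] by (simp add: ictr_def fun_eq_iff dsm_def)
    next
      case (Suc i') then show ?thesis
        using Cons.hyps [of i' "ictr Z a", OF _ mformD(4) [OF Cons.prems(2)]] Cons.prems
        by (simp add: ictr_def)
    qed
  qed simp
  \<comment> \<open>The alternating condition only speaks of two adjacent equal arguments at the
    head. Anticommuting contractions carry \<open>X\<close> past the arguments in between until it
    meets its copy.\<close>
  have front: "a (X # xs) = 0" if "j < length xs" "xs ! j = X" "mform sm a" for a X xs j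
    using that
  proof (induct xs arbitrary: j a)
    case (Cons Z xs)
    show ?case
    proof (cases j)
      case 0 then show ?thesis using mformD(3) [OF Cons.prems(3), of X] Cons.prems
        by (simp add: ictr_def fun_eq_iff)
    next
      case (Suc j')
      then have "ictr Z a (X # xs) = 0"
        using Cons.hyps [of j' "ictr Z a"] Cons.prems by (simp add: mformD)
      then show ?thesis
        using mform_ictr_anti [OF Cons.prems(3), of X Z] by (simp add: ictr_def fun_eq_iff)
    qed
  qed simp
  show "i < j \<Longrightarrow> j < length xs \<Longrightarrow> xs ! i = xs ! j \<Longrightarrow> a xs = 0"
    using assms
  proof (induct xs arbitrary: i j a)
    case (Cons Z xs)
    then obtain j' where j: "j = Suc j'" by (cases j) auto
    show ?case
    proof (cases i)
      case 0 then show ?thesis using front [of j' xs Z a] Cons.prems j by simp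
    next
      case (Suc i') then show ?thesis
        using Cons.hyps [of i' j' "ictr Z a", OF _ _ _ mformD(4) [OF Cons.prems(4)]] Cons.prems j
        by (simp add: ictr_def)
    qed
  qed simp
qed

lemma formD:
  assumes "a \<in> form sm k"
  shows "length xs \<noteq> k \<Longrightarrow> a xs = 0"
    "length xs = k \<Longrightarrow> i < k \<Longrightarrow> a (xs[i := U + V]) = a (xs[i := U]) + a (xs[i := V])"
    "length xs = k \<Longrightarrow> i < k \<Longrightarrow> a (xs[i := sm f U]) = f * a (xs[i := U])"
    "length xs = k \<Longrightarrow> i < j \<Longrightarrow> j < k \<Longrightarrow> xs ! i = xs ! j \<Longrightarrow> a xs = 0"
  using assms unfolding form_def mem_Collect_eq by blast+

lemma ictr_in_form:
  assumes a: "a \<in> form sm (Suc k)" shows "ictr X a \<in> form sm k"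
  unfolding form_def mem_Collect_eq
proof (intro conjI allI impI)
  note a = formD [OF a]
  fix xs :: "'a list" and i j f U V
  show "length xs \<noteq> k \<Longrightarrow> ictr X a xs = 0"
    using a(1) [of "X # xs"] by (simp add: ictr_apply)
  show "length xs = k \<Longrightarrow> i < k \<Longrightarrow> ictr X a (xs[i := U + V]) = ictr X a (xs[i := U]) + ictr X a (xs[i := V])"
    using a(2) [of "X # xs" "Suc i"] by (simp add: ictr_apply)
  show "length xs = k \<Longrightarrow> i < k \<Longrightarrow> ictr X a (xs[i := sm f U]) = f * ictr X a (xs[i := U])"
    using a(3) [of "X # xs" "Suc i"] by (simp add: ictr_apply)
  show "length xs = k \<Longrightarrow> i < j \<Longrightarrow> j < k \<Longrightarrow> xs ! i = xs ! j \<Longrightarrow> ictr X a xs = 0"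
    using a(4) [of "X # xs" "Suc i" "Suc j"] by (simp add: ictr_apply)
qed

text \<open>Bridge between the positionwise notion of a k-form and the one by contractions;
  everything after it works with the latter.\<close>

lemma form_iff: "a \<in> form sm k \<longleftrightarrow> mform sm a \<and> homog k a"
proof
  assume a: "a \<in> form sm k"
  have "a \<in> form sm k \<Longrightarrow> mformn sm n a" for n
  proof (induct n arbitrary: k a)
    case (Suc n)
    show ?case
    proof (cases k)
      case 0
      then have "ictr X a = 0" for X
        using Suc.prems by (auto simp: form_def ictr_def fun_eq_iff)
      then show ?thesis by (simp add: mformn_linear)
    next
      case (Suc k')
      note a = Suc.prems [unfolded Suc]
      note d = formD [OF a]
      have "ictr (X + Y) a xs = ictr X a xs + ictr Y a xs" for X Y xs
        using d(2) [of "X # xs" 0 X Y] d(1) [of "_ # xs"]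
        by (cases "length xs = k'") (auto simp: ictr_apply)
      moreover have "ictr (sm f X) a xs = f * ictr X a xs" for f X xs
        using d(3) [of "X # xs" 0 f X] d(1) [of "_ # xs"]
        by (cases "length xs = k'") (auto simp: ictr_apply)
      moreover have "ictr X (ictr X a) xs = 0" for X xs
        using d(4) [of "X # X # xs" 0 1] d(1) [of "_ # _ # xs"]
        by (cases "Suc (length xs) = k'") (auto simp: ictr_apply)
      moreover have "mformn sm n (ictr X a)" for X
        using Suc.hyps [OF ictr_in_form [OF a]] .
      ultimately show ?thesis by (simp add: fun_eq_iff dsm_apply)
    qed
  qed simp
  then show "mform sm a \<and> homog k a"
    using a by (auto simp: mform_def homog_def form_def)
next
  assume a: "mform sm a \<and> homog k a"
  show "a \<in> form sm k"
    unfolding form_def mem_Collect_eq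
  proof (intro conjI allI impI)
    fix xs :: "'a list" and i j f U V
    show "length xs \<noteq> k \<Longrightarrow> a xs = 0" using a by (simp add: homog_def)
    show "length xs = k \<Longrightarrow> i < k \<Longrightarrow> a (xs[i := U + V]) = a (xs[i := U]) + a (xs[i := V])"
      using a mform_update(1) by blast
    show "length xs = k \<Longrightarrow> i < k \<Longrightarrow> a (xs[i := sm f U]) = f * a (xs[i := U])"
      using a mform_update(2) by blast
    show "length xs = k \<Longrightarrow> i < j \<Longrightarrow> j < k \<Longrightarrow> xs ! i = xs ! j \<Longrightarrow> a xs = 0"
      using a mform_update(3) [of sm a i j xs] by simp
  qed
qed

subsection \<open>Even derivations\<close>

text \<open>One shape for three degree-zero derivations: the Lie derivative along X (with K Y =
  [Y, X], hence the plus sign), the insertion of N (with D = 0), and the Koszul bracket with a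
  1-form.\<close>

definition Dop :: "('r \<Rightarrow> 'r) \<Rightarrow> ('a \<Rightarrow> 'a) \<Rightarrow> ('a list \<Rightarrow> 'r::comm_ring_1) \<Rightarrow> 'a list \<Rightarrow> 'r" where
  "Dop D K a = (\<lambda>xs. D (a xs) + (\<Sum>i<length xs. a (xs[i := K (xs ! i)])))"

lemma ictr_Dop: "ictr Y (Dop D K a) = Dop D K (ictr Y a) + ictr (K Y) a"
proof
  fix xs show "ictr Y (Dop D K a) xs = (Dop D K (ictr Y a) + ictr (K Y) a) xs"
    by (simp add: ictr_apply Dop_def sum.lessThan_Suc_shift del: sum.lessThan_Suc)
qed

lemma derivationD:
  assumes "is_derivation D"
  shows "D (f + g) = D f + D g" "D (scaleR c f) = scaleR c (D f)" "D (f * g) = D f * g + f * D g"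
    "D 0 = 0" "D (- f) = - D f" "D (f - g) = D f - D g" "D 1 = 0" "D ((-1) ^ n * f) = (-1) ^ n * D f"
    "D (\<Sum>i\<in>I. h i) = (\<Sum>i\<in>I. D (h i))"
proof -
  have a: "D (f + g) = D f + D g" and m: "D (f * g) = D f * g + f * D g" for f g
    using assms by (auto simp: is_derivation_def)
  show "D (f + g) = D f + D g" "D (scaleR c f) = scaleR c (D f)" "D (f * g) = D f * g + f * D g"
    using assms by (auto simp: is_derivation_def)
  show z: "D 0 = 0" using a [of 0 0] by simp
  show mi: "D (- f) = - D f" for f
    using a [of f "- f"] z by (simp add: eq_neg_iff_add_eq_0 add.commute)
  show "D (f - g) = D f - D g" using a [of f "- g"] mi by simp
  show "D 1 = 0" using m [of 1 1] by simp
  show "D ((-1) ^ n * f) = (-1) ^ n * D f" by (induct n) (simp_all add: mi)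
  show "D (\<Sum>i\<in>I. h i) = (\<Sum>i\<in>I. D (h i))"
    by (induct I rule: infinite_finite_induct) (simp_all add: a z)
qed

lemma Dop_linear:
  assumes "is_derivation D"
  shows "Dop D K (a + b) = Dop D K a + Dop D K b"
    "Dop D K (- a) = - Dop D K a"
    "Dop D K (a - b) = Dop D K a - Dop D K b"
    "Dop D K 0 = 0"
    "Dop D K (dsm f a) = dsm (D f) a + dsm f (Dop D K a)"
    "Dop D K (par a) = par (Dop D K a)"
  using assms
  apply (auto simp: Dop_def derivationD fun_eq_iff sum.distrib sum_negf dsm_apply
    algebra_simps sum_subtractf sum_distrib_left)
  using assms by (auto simp: par_def Dop_def derivationD(8) sum_distrib_left distrib_left)

lemma Dop_wd:
  assumes D: "is_derivation D"
  shows "Dop D K (wd a b) = wd (Dop D K a) b + wd a (Dop D K b)"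
proof
  fix xs show "Dop D K (wd a b) xs = (wd (Dop D K a) b + wd a (Dop D K b)) xs"
  proof (induct xs arbitrary: a b)
    case Nil
    then show ?case using D by (simp add: Dop_def derivationD)
  next
    case (Cons X xs)
    have "ictr X (Dop D K (wd a b)) xs = ictr X (wd (Dop D K a) b + wd a (Dop D K b)) xs"
      using Cons by (simp add: ictr_Dop ictr_wd Dop_linear [OF D])
    then show ?case by (simp add: ictr_apply)
  qed
qed

text \<open>The condition on \<open>K (sm f X)\<close> says that K fails to be function-linear by
  exactly the term D(f) X, which cancels the derivative of f produced by D; the result is tensorial
  although neither part is.\<close>

lemma mform_Dop:
  assumes D: "is_derivation D" and K: "\<And>X Y. K (X + Y) = K X + K Y"
    "\<And>f X. K (sm f X) + sm (D f) X = sm f (K X)" and a: "mform sm a"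
  shows "mform sm (Dop D K a)"
proof -
  have "mform sm a \<Longrightarrow> mformn sm n (Dop D K a)" for n
  proof (induct n arbitrary: a)
    case (Suc n)
    note m = mformD [OF Suc.prems]
    have "ictr (K (sm f X)) a = dsm f (ictr (K X) a) - dsm (D f) (ictr X a)" for f X
    proof -
      have "ictr (K (sm f X) + sm (D f) X) a = ictr (sm f (K X)) a" by (simp add: K)
      then show ?thesis by (simp only: m) (simp add: algebra_simps)
    qed
    moreover have "ictr X (ictr (K X) a) + ictr (K X) (ictr X a) = 0" for X
      using mform_ictr_anti [OF Suc.prems, of X "K X"] by simp
    moreover have "mformn sm n (ictr X (Dop D K a))" for X
      using mformn_linear(1) [OF Suc.hyps [OF m(4)]] m(4) by (simp add: ictr_Dop mform_def)
    ultimately show ?case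
      by (simp add: ictr_Dop Dop_linear [OF D] K m add.assoc algebra_simps)
  qed simp
  then show ?thesis using a by (simp add: mform_def)
qed

section \<open>Cartan calculus of a skew algebroid\<close>

lemma del_at_Cons [simp]: "del_at 0 (X # xs) = xs" "del_at (Suc i) (X # xs) = X # del_at i xs"
  by (simp_all add: del_at_def)

lemma move_front:
  "mform sm a \<Longrightarrow> j < length xs \<Longrightarrow> a (Z # del_at j xs) = (-1) ^ j * a (xs[j := Z])"
proof (induct xs arbitrary: a j)
  case (Cons X xs)
  show ?case
  proof (cases j)
    case (Suc j')
    have "a (Z # X # del_at j' xs) = - a (X # Z # del_at j' xs)"
      using mform_ictr_anti [OF Cons.prems(1), of X Z] by (simp add: ictr_def fun_eq_iff)
    also have "a (X # Z # del_at j' xs) = (-1) ^ j' * a (X # xs[j' := Z])"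
      using Cons.hyps [OF mformD(4) [OF Cons.prems(1)], of j' X] Cons.prems Suc by (simp add: ictr_def)
    finally show ?thesis using Suc by simp
  qed simp
qed simp

text \<open>A Lie algebroid without the Jacobi identity and without compatibility of bracket and anchor:
  this covers both \<open>A\<close> and the deformed structure on \<open>A\<close> given by \<open>N\<close>.\<close>

locale skew_algebroid =
  fixes sm :: "'r::{comm_ring_1,real_algebra_1} \<Rightarrow> 'a::ab_group_add \<Rightarrow> 'a"
    and br :: "'a \<Rightarrow> 'a \<Rightarrow> 'a" and rho :: "'a \<Rightarrow> 'r \<Rightarrow> 'r"
  assumes module: "r_module UNIV sm"
    and br_add_left: "br (X + Y) Z = br X Z + br Y Z"
    and br_skew: "br X Y = - br Y X"
    and br_sm: "br X (sm f Y) = sm f (br X Y) + sm (rho X f) Y"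
    and rho_der: "is_derivation (rho X)"
    and rho_add: "rho (X + Y) f = rho X f + rho Y f"
    and rho_sm: "rho (sm g X) f = g * rho X f"
begin

lemma sm_linear [simp]:
  "sm f (X + Y) = sm f X + sm f Y" "sm (f + g) X = sm f X + sm g X"
  "sm (f * g) X = sm f (sm g X)" "sm 1 X = X" "sm f 0 = 0" "sm 0 X = 0"
  "sm f (- X) = - sm f X" "sm (- f) X = - sm f X" "sm f (X - Y) = sm f X - sm f Y"
  "sm (f - g) X = sm f X - sm g X"
proof -
  show a: "sm f (X + Y) = sm f X + sm f Y" "sm (f + g) X = sm f X + sm g X"
    "sm (f * g) X = sm f (sm g X)" "sm 1 X = X" for f g X Y
    using module by (auto simp: r_module_def)
  show z: "sm f 0 = 0" "sm 0 X = 0" for f X using a(1) [of f 0 0] a(2) [of 0 0] by simp_all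
  show m: "sm f (- X) = - sm f X" "sm (- f) X = - sm f X" for f X
    using a(1) [of f X "- X"] a(2) [of f "- f" X] z by (metis add.right_inverse minus_unique)+
  show "sm f (X - Y) = sm f X - sm f Y" "sm (f - g) X = sm f X - sm g X"
    using a(1) [of f X "- Y"] a(2) [of f "- g" X] m by simp_all
qed

text \<open>Sections have no 2-torsion, since 1/2 is a function. Skew-symmetry of the bracket
  therefore yields \<open>br X X = 0\<close>.\<close>

lemma half_cancel:
  fixes X :: 'a assumes "X + X = 0" shows "X = 0"
proof -
  have "(of_real (1/2) :: 'r) + of_real (1/2) = 1"
    by (simp flip: of_real_add)
  then have "X = sm (of_real (1/2) + of_real (1/2)) X" by simp
  also have "\<dots> = sm (of_real (1/2)) (X + X)" by (simp only: sm_linear)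
  finally show ?thesis using assms by simp
qed

lemma br_self [simp]: "br X X = 0"
  using br_skew [of X X] by (metis half_cancel add.right_inverse)

lemma br_add_right: "br Z (X + Y) = br Z X + br Z Y"
  using br_add_left [of X Y Z] by (simp add: br_skew [of Z "X + Y"] br_skew [of Z X] br_skew [of Z Y])

lemma br_sm_left: "br (sm f X) Y = sm f (br X Y) - sm (rho Y f) X"
  using br_sm [of Y f X] br_skew [of "sm f X" Y] br_skew [of X Y] by simp

lemmas rhoD = derivationD [OF rho_der]

abbreviation "d \<equiv> extd br rho"

definition Lie :: "'a \<Rightarrow> ('a list \<Rightarrow> 'r) \<Rightarrow> 'a list \<Rightarrow> 'r" where
  "Lie X = Dop (rho X) (\<lambda>Y. br Y X)"

lemmas Lie_linear = Dop_linear [OF rho_der [of X], of "\<lambda>Y. br Y X" for X, folded Lie_def]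
lemmas Lie_wd = Dop_wd [OF rho_der [of X], of "\<lambda>Y. br Y X" for X, folded Lie_def]

lemma mform_Lie: "mform sm a \<Longrightarrow> mform sm (Lie X a)"
  unfolding Lie_def by (rule mform_Dop [OF rho_der]) (simp_all add: br_add_left br_sm_left)

lemma ictr_Lie: "ictr Y (Lie X a) = Lie X (ictr Y a) + ictr (br Y X) a"
  unfolding Lie_def by (rule ictr_Dop)

lemma d_alt: "d a xs = (\<Sum>i<length xs. (-1) ^ i * rho (xs ! i) (a (del_at i xs)))
    + (\<Sum>i<length xs. \<Sum>j<length xs. if i < j
         then (-1) ^ (i + j) * a (br (xs ! i) (xs ! j) # del_at i (del_at j xs)) else 0)"
  by (simp add: extd_def)

lemma d_Nil [simp]: "d a [] = 0"
  by (simp add: extd_def)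

lemma d_Cons: "d a (X # xs) = rho X (a xs)
    - (\<Sum>i<length xs. (-1) ^ i * rho (xs ! i) (a (X # del_at i xs)))
    - (\<Sum>j<length xs. (-1) ^ j * a (br X (xs ! j) # del_at j xs))
    + (\<Sum>i<length xs. \<Sum>j<length xs. if i < j
         then (-1) ^ (i + j) * a (br (xs ! i) (xs ! j) # X # del_at i (del_at j xs)) else 0)"
  unfolding d_alt
  by (simp add: sum.lessThan_Suc_shift sum_negf algebra_simps
      del: sum.lessThan_Suc cong: if_cong)

text \<open>The only place where the alternating sums of the Koszul formula are manipulated to
  derive a structural law: the terms with \<open>X\<close> inside a bracket assemble into the Lie
  derivative after moving that bracket back to its slot, and the rest is the differential of the
  contraction. It does not rest on a Jacobi identity.\<close>

lemma cartan:
  assumes a: "mform sm a"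
  shows "ictr X (d a) = Lie X a - d (ictr X a)"
proof
  fix xs
  have 1: "(\<Sum>j<length xs. (-1) ^ j * a (br X (xs ! j) # del_at j xs))
      = - (\<Sum>j<length xs. a (xs[j := br (xs ! j) X]))"
  proof -
    have "(-1) ^ j * a (br X (xs ! j) # del_at j xs) = - a (xs[j := br (xs ! j) X])"
      if j: "j < length xs" for j
    proof -
      have "a (br X (xs ! j) # del_at j xs) = - a (br (xs ! j) X # del_at j xs)"
        using mform_ictr_minus [OF a, of "br (xs ! j) X"] br_skew [of X "xs ! j"]
        by (simp add: ictr_def fun_eq_iff)
      then show ?thesis using move_front [OF a j]
        by (simp add: mult.assoc [symmetric] power_mult_distrib [symmetric])
    qed
    then show ?thesis by (simp add: sum_negf)
  qed
  have 2: "a (X # Z # ys) = - a (Z # X # ys)" for Z ys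
    using mform_ictr_anti [OF a, of X Z] by (simp add: ictr_def fun_eq_iff)
  have 3: "(\<Sum>i<length xs. \<Sum>j<length xs. if i < j
         then (-1) ^ (i + j) * a (X # br (xs ! i) (xs ! j) # del_at i (del_at j xs)) else 0)
     = - (\<Sum>i<length xs. \<Sum>j<length xs. if i < j
         then (-1) ^ (i + j) * a (br (xs ! i) (xs ! j) # X # del_at i (del_at j xs)) else 0)"
    unfolding sum_negf [symmetric] by (intro sum.cong refl) (simp add: 2)
  show "ictr X (d a) xs = (Lie X a - d (ictr X a)) xs"
    using 1 3 by (simp add: ictr_apply d_Cons d_alt [of "ictr X a"] Dop_def Lie_def cong: if_cong)
qed

lemma d_linear [simp]:
  "d (a + b) = d a + d b" "d (- a) = - d a" "d (a - b) = d a - d b" "d 0 = 0"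
proof -
  show a: "d (a + b) = d a + d b" for a b
  proof
    fix xs
    have 1: "(\<Sum>i<length xs. (-1) ^ i * rho (xs ! i) ((a + b) (del_at i xs)))
      = (\<Sum>i<length xs. (-1) ^ i * rho (xs ! i) (a (del_at i xs)))
        + (\<Sum>i<length xs. (-1) ^ i * rho (xs ! i) (b (del_at i xs)))"
      by (simp add: rhoD distrib_left sum.distrib)
    have 2: "(\<Sum>i<length xs. \<Sum>j<length xs. if i < j
          then (-1) ^ (i + j) * (a + b) (br (xs ! i) (xs ! j) # del_at i (del_at j xs)) else 0)
      = (\<Sum>i<length xs. \<Sum>j<length xs. if i < j
          then (-1) ^ (i + j) * a (br (xs ! i) (xs ! j) # del_at i (del_at j xs)) else 0)
       + (\<Sum>i<length xs. \<Sum>j<length xs. if i < j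
          then (-1) ^ (i + j) * b (br (xs ! i) (xs ! j) # del_at i (del_at j xs)) else 0)"
      unfolding sum.distrib [symmetric] by (intro sum.cong refl) (simp add: distrib_left)
    show "d (a + b) xs = (d a + d b) xs"
      unfolding plus_fun_apply [of "d a" "d b"] d_alt 1 2 by (simp add: algebra_simps)
  qed
  show z: "d 0 = 0" using a [of 0 0] by simp
  show m: "d (- a) = - d a" for a
    using a [of a "- a"] z by (metis add.commute add.right_inverse eq_neg_iff_add_eq_0)
  show "d (a - b) = d a - d b" using a [of a "- b"] m by simp
qed

lemma d_sum: "d (\<Sum>i\<in>I. a i) = (\<Sum>i\<in>I. d (a i))"
  by (induct I rule: infinite_finite_induct)
    (simp_all only: sum.infinite sum.empty sum.insert d_linear not_False_eq_True simp_thms)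

text \<open>Since \<open>d\<close> is not function-linear, only constant signs may be pulled out;
  additivity is enough for these.\<close>

lemma d_sign: "d (dsm ((-1) ^ n) a) = dsm ((-1) ^ n) (d a)"
proof (induct n)
  case (Suc n)
  have "dsm ((-1) ^ Suc n) u = - dsm ((-1) ^ n) u" for u :: "'a list \<Rightarrow> 'r" by simp
  then show ?case using Suc by (simp only: d_linear)
qed simp

lemma d_par: "mform sm a \<Longrightarrow> d (par a) = - par (d a)"
proof
  fix xs assume "mform sm a"
  then show "d (par a) xs = (- par (d a)) xs"
  proof (induct xs arbitrary: a)
    case (Cons X xs)
    have "ictr X (d (par a)) xs = ictr X (- par (d a)) xs"
      using Cons by (simp add: cartan mform_par Lie_linear mformD)
    then show ?case by (simp only: ictr_def)
  qed simp
qed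

lemma homog_d:
  assumes "homog k a" shows "homog (Suc k) (d a)"
proof -
  have "d a xs = 0" if "length xs \<noteq> Suc k" for xs
  proof -
    have "a (del_at i xs) = 0" if "i < length xs" for i
      using assms that \<open>length xs \<noteq> Suc k\<close> by (auto simp: homog_def del_at_def)
    moreover have "a (Z # del_at i (del_at j xs)) = 0" if "i < j" "j < length xs" for i j Z
      using assms that \<open>length xs \<noteq> Suc k\<close> by (auto simp: homog_def del_at_def)
    ultimately show ?thesis
      unfolding d_alt by (simp add: rhoD sum.neutral cong: if_cong)
  qed
  then show ?thesis by (simp add: homog_def)
qed

lemma d_wd:
  assumes "mform sm a" "mform sm b"
  shows "d (wd a b) = wd (d a) b + wd (par a) (d b)"
proof
  fix xs show "d (wd a b) xs = (wd (d a) b + wd (par a) (d b)) xs"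
    using assms
  proof (induct xs arbitrary: a b)
    case (Cons X xs)
    note m = mform_par mformD(4) mform_wd Cons.prems
    have 1: "d (wd (ictr X a) b) xs = (wd (d (ictr X a)) b + wd (par (ictr X a)) (d b)) xs"
      and 2: "d (wd (par a) (ictr X b)) xs = (wd a (d (ictr X b)) - wd (par (d a)) (ictr X b)) xs"
    proof -
      show "d (wd (ictr X a) b) xs = (wd (d (ictr X a)) b + wd (par (ictr X a)) (d b)) xs"
        using Cons.hyps [of "ictr X a" b] m by blast
      have "d (wd (par a) (ictr X b)) xs
          = (wd (d (par a)) (ictr X b) + wd (par (par a)) (d (ictr X b))) xs"
        using Cons.hyps [of "par a" "ictr X b"] m by blast
      also have "wd (d (par a)) (ictr X b) = - wd (par (d a)) (ictr X b)"
        by (simp only: d_par m wd_minus_left)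
      finally show "d (wd (par a) (ictr X b)) xs
          = (wd a (d (ictr X b)) - wd (par (d a)) (ictr X b)) xs" by simp
    qed
    have "ictr X (d (wd a b)) xs
        = Lie X (wd a b) xs - d (wd (ictr X a) b) xs - d (wd (par a) (ictr X b)) xs"
      by (simp add: cartan ictr_wd m)
    also have "\<dots> = ictr X (wd (d a) b + wd (par a) (d b)) xs"
      unfolding 1 2 by (simp add: cartan ictr_wd Lie_wd m)
    finally have "ictr X (d (wd a b)) xs = ictr X (wd (d a) b + wd (par a) (d b)) xs" .
    then show ?case by (simp only: ictr_def)
  qed simp
qed

lemma rho_functional: "lin_functional UNIV sm (\<lambda>Y. rho Y f)"
  by (simp add: lin_functional_def rho_add rho_sm)

lemma d_form0: "d (form0 f) = form1 (\<lambda>Y. rho Y f)"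
proof (rule list_fun_eqI)
  show "ictr X (d (form0 f)) = ictr X (form1 (\<lambda>Y. rho Y f))" for X
    by (simp add: cartan) (auto simp: Lie_def Dop_def form0_def rhoD fun_eq_iff)
qed (simp add: form1_def)

lemma d_dsm: "mform sm a \<Longrightarrow> d (dsm f a) = wd (form1 (\<lambda>Y. rho Y f)) a + dsm f (d a)"
  using d_wd [OF mform_form0, of a f] by (simp add: d_form0)

lemma Lie_sm:
  assumes "mform sm a"
  shows "Lie (sm f X) a = dsm f (Lie X a) + wd (form1 (\<lambda>Y. rho Y f)) (ictr X a)"
proof
  fix xs show "Lie (sm f X) a xs = (dsm f (Lie X a) + wd (form1 (\<lambda>Y. rho Y f)) (ictr X a)) xs"
    using assms
  proof (induct xs arbitrary: a)
    case Nil
    then show ?case by (simp add: Lie_def Dop_def rho_sm dsm_apply form1_def)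
  next
    case (Cons Y xs)
    have "ictr Y (Lie (sm f X) a) xs
        = ictr Y (dsm f (Lie X a) + wd (form1 (\<lambda>Y. rho Y f)) (ictr X a)) xs"
      using Cons.hyps [OF mformD(4) [OF Cons.prems], of Y] mform_ictr_anti [OF Cons.prems, of Y X]
      by (simp add: ictr_Lie ictr_wd br_sm mformD [OF Cons.prems] dsm_apply)
    then show ?case by (simp only: ictr_def)
  qed
qed

lemma Lie_add:
  assumes "mform sm a"
  shows "Lie (X + Y) a = Lie X a + Lie Y a"
proof
  fix xs show "Lie (X + Y) a xs = (Lie X a + Lie Y a) xs"
    using assms
  proof (induct xs arbitrary: a)
    case Nil
    then show ?case by (simp add: Lie_def Dop_def rho_add)
  next
    case (Cons Z xs)
    have "ictr Z (Lie (X + Y) a) xs = ictr Z (Lie X a + Lie Y a) xs"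
      using Cons.hyps [OF mformD(4) [OF Cons.prems], of Z]
      by (simp add: ictr_Lie br_add_right mformD [OF Cons.prems])
    then show ?case by (simp only: ictr_def)
  qed
qed

lemma Lie_zero: "mform sm a \<Longrightarrow> Lie 0 a = 0"
  using Lie_add [of a 0 0] by simp

lemma Lie_sum: "mform sm a \<Longrightarrow> Lie (\<Sum>i\<in>I. X i) a = (\<Sum>i\<in>I. Lie (X i) a)"
  by (induct I rule: infinite_finite_induct) (simp_all add: Lie_zero Lie_add)

text \<open>In Cartan's formula at \<open>sm f X\<close>, both the Lie derivative and the
  differential of the contraction produce df wedge i_X a, and these cancel. A repeated argument
  gives L_X i_X a twice with opposite signs, using \<open>br X X = 0\<close>.\<close>

lemma mform_d:
  assumes "mform sm a" shows "mform sm (d a)"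
proof -
  have "mform sm a \<Longrightarrow> mformn sm n (d a)" for n
  proof (induct n arbitrary: a)
    case (Suc n)
    note m = mformD [OF Suc.prems]
    have "mformn sm n (ictr X (d a))" for X
    proof -
      have "ictr X (d a) = Lie X a + dsm (-1) (d (ictr X a))" by (simp add: cartan Suc.prems)
      moreover have "mformn sm n (Lie X a)" using mform_Lie [OF Suc.prems] by (simp add: mform_def)
      moreover have "mformn sm n (dsm (-1) (d (ictr X a)))" by (intro mformn_linear Suc.hyps m)
      ultimately show ?thesis by (simp only: mformn_linear)
    qed
    then show ?case
      by (simp add: cartan Suc.prems m Lie_add Lie_sm d_dsm ictr_Lie mform_ictr_zero [OF Suc.prems] algebra_simps)
  qed simp
  then show ?thesis using assms by (simp add: mform_def)
qed

lemma d_form1: "lin_functional UNIV sm \<phi> \<Longrightarrow>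
    d (form1 \<phi>) [X, Y] = rho X (\<phi> Y) - rho Y (\<phi> X) - \<phi> (br X Y)"
  by (simp add: d_Cons form1_def)

end

subsection \<open>The deformed structure\<close>

lemma iN_Dop: "iN N = Dop (\<lambda>_. 0) N"
  by (rule ext)+ (simp add: iN_def Dop_def)

lemma zero_derivation: "is_derivation (\<lambda>_. 0)"
  by (simp add: is_derivation_def)

lemmas iN_linear = Dop_linear [OF zero_derivation, folded iN_Dop]
lemmas ictr_iN = ictr_Dop [of _ "\<lambda>_. 0", folded iN_Dop]

locale deformed_algebroid = skew_algebroid sm br rho
  for sm :: "'r::{comm_ring_1,real_algebra_1} \<Rightarrow> 'a::ab_group_add \<Rightarrow> 'a" and br rho +
  fixes N :: "'a \<Rightarrow> 'a"
  assumes N_add: "N (X + Y) = N X + N Y" and N_sm: "N (sm f X) = sm f (N X)"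
begin

lemma N_linear: "N 0 = 0" "N (- X) = - N X" "N (X - Y) = N X - N Y"
proof -
  show z: "N 0 = 0" using N_add [of 0 0] by simp
  show m: "N (- X) = - N X" for X using N_add [of X "- X"] z by (metis add.right_inverse minus_unique)
  show "N (X - Y) = N X - N Y" using N_add [of X "- Y"] m by simp
qed

definition brN :: "'a \<Rightarrow> 'a \<Rightarrow> 'a" where
  "brN X Y = br (N X) Y + br X (N Y) - N (br X Y)"

definition rhoN :: "'a \<Rightarrow> 'r \<Rightarrow> 'r" where
  "rhoN X = rho (N X)"

sublocale def: skew_algebroid sm brN rhoN
proof
  fix X Y Z :: 'a and f g :: 'r
  show "r_module UNIV sm" by (rule module)
  show "brN (X + Y) Z = brN X Z + brN Y Z"
    by (simp add: brN_def N_add br_add_left algebra_simps)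
  show "brN X Y = - brN Y X"
    using br_skew [of "N X" Y] br_skew [of X "N Y"] br_skew [of X Y] by (simp add: brN_def N_linear)
  show "brN X (sm f Y) = sm f (brN X Y) + sm (rhoN X f) Y"
    by (simp add: brN_def rhoN_def br_sm N_sm N_add algebra_simps)
  show "is_derivation (rhoN X)" by (simp add: rhoN_def rho_der)
  show "rhoN (X + Y) f = rhoN X f + rhoN Y f" by (simp add: rhoN_def N_add rho_add)
  show "rhoN (sm g X) f = g * rhoN X f" by (simp add: rhoN_def N_sm rho_sm)
qed

lemma mform_iN: "mform sm a \<Longrightarrow> mform sm (iN N a)"
  unfolding iN_Dop by (rule mform_Dop [OF zero_derivation]) (simp_all add: N_add N_sm)

text \<open>The Lie derivative of the deformed bracket is L_(NX) + [i_N, L_X]. Contraction with Y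
  reduces this to the definition of \<open>brN Y X\<close>, one summand for each operator.\<close>

lemma Lie_iN:
  assumes "mform sm a"
  shows "def.Lie X a = Lie (N X) a + iN N (Lie X a) - Lie X (iN N a)"
proof
  fix xs show "def.Lie X a xs = (Lie (N X) a + iN N (Lie X a) - Lie X (iN N a)) xs"
    using assms
  proof (induct xs arbitrary: a)
    case Nil
    then show ?case by (simp add: Lie_def def.Lie_def Dop_def iN_def rhoD) (simp add: rhoN_def)
  next
    case (Cons Y xs)
    have "brN Y X = br Y (N X) + br (N Y) X - N (br Y X)" by (simp add: brN_def)
    then have "ictr Y (def.Lie X a) xs = ictr Y (Lie (N X) a + iN N (Lie X a) - Lie X (iN N a)) xs"
      using Cons.hyps [OF mformD(4) [OF Cons.prems], of Y]
      by (simp add: def.ictr_Lie ictr_Lie ictr_iN iN_linear Lie_linear mformD [OF Cons.prems]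
          mform_ictr_diff [OF Cons.prems])
    then show ?case by (simp only: ictr_def)
  qed
qed

text \<open>Both operators obey the same Cartan recursion, by \<open>Lie_iN\<close>, and both vanish
  on the empty list. All later statements on d_N are thus statements on the Koszul differential
  \<open>def.d\<close>.\<close>

lemma dN_eq_def:
  assumes "mform sm a" shows "dN br rho N a = def.d a"
proof
  fix xs show "dN br rho N a xs = def.d a xs"
    using assms
  proof (induct xs arbitrary: a)
    case Nil
    then show ?case by (simp add: dN_def iN_def)
  next
    case (Cons X xs)
    have dN: "dN br rho N a = iN N (d a) - d (iN N a)" for a by (rule ext) (simp add: dN_def)
    have "ictr X (dN br rho N a) = def.Lie X a - dN br rho N (ictr X a)"
      by (simp add: dN ictr_iN cartan Cons.prems mform_iN iN_linear Lie_iN mformD(4))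
    then have "ictr X (dN br rho N a) xs = ictr X (def.d a) xs"
      using Cons.hyps [OF mformD(4) [OF Cons.prems], of X] by (simp add: def.cartan Cons.prems)
    then show ?case by (simp only: ictr_def)
  qed
qed

end

section \<open>The Koszul bracket\<close>

lemma of_nat_cancel:
  fixes y :: "'r::{comm_ring_1,real_algebra_1}"
  assumes "of_nat (Suc k) * y = 0" shows "y = 0"
proof -
  have "(of_nat (Suc k) :: 'r) = of_real (of_nat (Suc k))" by (simp only: of_real_of_nat_eq)
  then have "scaleR (of_nat (Suc k)) y = 0" using assms by (simp only: scaleR_conv_of_real)
  then show ?thesis by (simp only: scaleR_eq_0_iff) auto
qed

lemma additive_sum:
  fixes h :: "'b::comm_monoid_add \<Rightarrow> 'c::comm_monoid_add"
  assumes "h 0 = 0" "\<And>x y. h (x + y) = h x + h y"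
  shows "h (\<Sum>i\<in>I. g i) = (\<Sum>i\<in>I. h (g i))"
  using sum_comp_morphism [of h g I] assms by (simp add: o_def)

lemma sum_fun_apply: "(\<Sum>i\<in>I. f i) x = (\<Sum>i\<in>I. f i x)"
  by (induct I rule: infinite_finite_induct) simp_all

lemma wd_sum:
  "wd (\<Sum>i\<in>I. a i) b = (\<Sum>i\<in>I. wd (a i) b)" "wd b (\<Sum>i\<in>I. a i) = (\<Sum>i\<in>I. wd b (a i))"
  by (rule additive_sum [of "\<lambda>a. wd a b"] additive_sum [of "wd b"]; simp)+

lemma par_sum: "par (\<Sum>i\<in>I. a i) = (\<Sum>i\<in>I. par (a i))"
  by (rule additive_sum [of "par"]) simp_all

lemma ictr_sum:
  fixes a :: "'i \<Rightarrow> 'a list \<Rightarrow> 'r::comm_ring_1"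
  shows "ictr X (\<Sum>i\<in>I. a i) = (\<Sum>i\<in>I. ictr X (a i))"
  by (rule additive_sum [of "ictr X"]) simp_all

lemma dsm_sum: "dsm f (\<Sum>i\<in>I. a i) = (\<Sum>i\<in>I. dsm f (a i))"
  by (rule additive_sum [of "dsm f"]) simp_all

lemma dual1_iff: "\<alpha> \<in> dual1 sm \<longleftrightarrow> (\<forall>X Y. \<alpha> (X + Y) = \<alpha> X + \<alpha> Y) \<and> (\<forall>f X. \<alpha> (sm f X) = f * \<alpha> X)"
  by (simp add: dual1_def lin_functional_def)

lemma dual1_linear:
  "\<alpha> \<in> dual1 sm \<Longrightarrow> \<beta> \<in> dual1 sm \<Longrightarrow> \<alpha> + \<beta> \<in> dual1 sm"
  "\<alpha> \<in> dual1 sm \<Longrightarrow> \<beta> \<in> dual1 sm \<Longrightarrow> \<alpha> - \<beta> \<in> dual1 sm"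
  "\<alpha> \<in> dual1 sm \<Longrightarrow> - \<alpha> \<in> dual1 sm"
  "\<alpha> \<in> dual1 sm \<Longrightarrow> dsm f \<alpha> \<in> dual1 sm"
  "0 \<in> dual1 sm"
  by (auto simp: dual1_iff dsm_apply algebra_simps)

lemma dual1_sum: "(\<And>i. i \<in> I \<Longrightarrow> \<alpha> i \<in> dual1 sm) \<Longrightarrow> (\<Sum>i\<in>I. \<alpha> i) \<in> dual1 sm"
  by (induct I rule: infinite_finite_induct) (simp_all add: dual1_linear)

lemma dual1D:
  assumes "\<alpha> \<in> dual1 sm"
  shows "\<alpha> (X + Y) = \<alpha> X + \<alpha> Y" "\<alpha> (sm f X) = f * \<alpha> X" "\<alpha> 0 = 0" "\<alpha> (- X) = - \<alpha> X"
    "\<alpha> (X - Y) = \<alpha> X - \<alpha> Y" "\<alpha> (\<Sum>i\<in>I. x i) = (\<Sum>i\<in>I. \<alpha> (x i))"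
proof -
  show a: "\<alpha> (X + Y) = \<alpha> X + \<alpha> Y" "\<alpha> (sm f X) = f * \<alpha> X" for X Y f
    using assms by (auto simp: dual1_iff)
  show z: "\<alpha> 0 = 0" using a(1) [of 0 0] by simp
  show m: "\<alpha> (- X) = - \<alpha> X" for X
    using a(1) [of X "- X"] z by (metis add.right_inverse minus_unique)
  show "\<alpha> (X - Y) = \<alpha> X - \<alpha> Y" using a(1) [of X "- Y"] m by simp
  show "\<alpha> (\<Sum>i\<in>I. x i) = (\<Sum>i\<in>I. \<alpha> (x i))"
    by (induct I rule: infinite_finite_induct) (simp_all add: a z)
qed

section \<open>Dual bases, the Euler identity and generation of forms in degrees 0 and 1\<close>

locale bivector_algebroid = skew_algebroid sm br rho
  for sm :: "'r::{comm_ring_1,real_algebra_1} \<Rightarrow> 'a::ab_group_add \<Rightarrow> 'a" and br rho +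
  fixes P :: "('a \<Rightarrow> 'r) \<Rightarrow> 'a"
  assumes fg: "fg_projective UNIV sm"
    and P_add: "\<alpha> \<in> dual1 sm \<Longrightarrow> \<beta> \<in> dual1 sm \<Longrightarrow> P (\<alpha> + \<beta>) = P \<alpha> + P \<beta>"
    and P_dsm: "\<alpha> \<in> dual1 sm \<Longrightarrow> P (dsm f \<alpha>) = sm f (P \<alpha>)"
    and P_skew: "\<alpha> \<in> dual1 sm \<Longrightarrow> \<beta> \<in> dual1 sm \<Longrightarrow> \<beta> (P \<alpha>) = - \<alpha> (P \<beta>)"
begin

text \<open>The module is projective but need not be free: \<open>ff i (ee j)\<close> is in general
  not the Kronecker delta, so only the expansion formulas below may be used.\<close>

definition "nb = length (dbasis sm)"
definition "ee i = fst (dbasis sm ! i)"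
definition "ff i = snd (dbasis sm ! i)"

lemma dbasis: "is_dual_basis UNIV sm (dbasis sm)"
  using fg unfolding dbasis_def fg_projective_def by (rule someI_ex)

lemma sum_dbasis: "(\<Sum>(e, \<phi>)\<leftarrow>dbasis sm. g e \<phi>) = (\<Sum>i<nb. g (ee i) (ff i))"
  by (simp add: sum_list_sum_nth nb_def ee_def ff_def case_prod_beta atLeast0LessThan)

lemma ff_dual: "i < nb \<Longrightarrow> ff i \<in> dual1 sm"
  using dbasis unfolding is_dual_basis_def dual1_def nb_def ff_def
  by (metis (no_types, lifting) case_prodD mem_Collect_eq nth_mem prod.collapse)

lemma expand: "X = (\<Sum>i<nb. sm (ff i X) (ee i))"
proof -
  have "X = (\<Sum>(e, \<phi>)\<leftarrow>dbasis sm. sm (\<phi> X) e)"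
    using dbasis unfolding is_dual_basis_def by blast
  then show ?thesis by (simp only: sum_dbasis)
qed

lemma expand_dual:
  assumes "\<alpha> \<in> dual1 sm" shows "\<alpha> = (\<Sum>i<nb. dsm (\<alpha> (ee i)) (ff i))"
proof
  fix X
  have "\<alpha> X = \<alpha> (\<Sum>i<nb. sm (ff i X) (ee i))" by (simp flip: expand)
  then show "\<alpha> X = (\<Sum>i<nb. dsm (\<alpha> (ee i)) (ff i)) X"
    using assms by (simp add: dual1D sum_fun_apply dsm_apply mult.commute)
qed

lemma P_zero: "P 0 = 0"
  using P_add [of 0 0] by (simp add: dual1_linear)

lemma P_minus: "\<alpha> \<in> dual1 sm \<Longrightarrow> P (- \<alpha>) = - P \<alpha>"
  using P_dsm [of \<alpha> "-1"] by simp

lemma P_sum: "(\<And>i. i \<in> I \<Longrightarrow> \<alpha> i \<in> dual1 sm) \<Longrightarrow> P (\<Sum>i\<in>I. \<alpha> i) = (\<Sum>i\<in>I. P (\<alpha> i))"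
  by (induct I rule: infinite_finite_induct) (simp_all add: P_zero P_add dual1_sum)

lemma P_expand:
  assumes "\<alpha> \<in> dual1 sm" shows "P \<alpha> = (\<Sum>i<nb. sm (\<alpha> (ee i)) (P (ff i)))"
proof -
  have "P \<alpha> = P (\<Sum>i<nb. dsm (\<alpha> (ee i)) (ff i))" using expand_dual [OF assms] by simp
  also have "\<dots> = (\<Sum>i<nb. P (dsm (\<alpha> (ee i)) (ff i)))"
    by (intro P_sum dual1_linear ff_dual) simp
  also have "\<dots> = (\<Sum>i<nb. sm (\<alpha> (ee i)) (P (ff i)))"
    by (intro sum.cong refl P_dsm ff_dual) simp
  finally show ?thesis .
qed

text \<open>Contracting the sum with X gives back \<open>ictr X a\<close> once, by expanding X in
  the dual basis, plus the same sum formed for \<open>ictr X a\<close>. Each argument is therefore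
  counted once.\<close>

lemma euler:
  assumes "mform sm a"
  shows "(\<Sum>i<nb. wd (form1 (ff i)) (ictr (ee i) a)) xs = of_nat (length xs) * a xs"
  using assms
proof (induct xs arbitrary: a)
  case (Cons X xs)
  note m = mformD [OF Cons.prems]
  have "wd (form1 (ff i)) (ictr X (ictr (ee i) a)) = - wd (form1 (ff i)) (ictr (ee i) (ictr X a))" for i
    by (subst mform_ictr_anti [OF Cons.prems]) simp
  then have "ictr X (\<Sum>i<nb. wd (form1 (ff i)) (ictr (ee i) a))
      = (\<Sum>i<nb. dsm (ff i X) (ictr (ee i) a)) + (\<Sum>i<nb. wd (form1 (ff i)) (ictr (ee i) (ictr X a)))"
    by (simp add: ictr_sum ictr_wd sum.distrib)
  also have "(\<Sum>i<nb. dsm (ff i X) (ictr (ee i) a)) = ictr X a"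
    using mform_ictr_sum [OF Cons.prems, of "\<lambda>i. sm (ff i X) (ee i)" "{..<nb}"]
    by (simp add: m flip: expand)
  finally have "ictr X (\<Sum>i<nb. wd (form1 (ff i)) (ictr (ee i) a)) xs = (1 + of_nat (length xs)) * ictr X a xs"
    using Cons.hyps [OF m(4)] by (simp add: algebra_simps)
  then show ?case by (simp add: ictr_def)
qed (simp add: sum_fun_apply form1_def)

text \<open>Forms are generated by functions and 1-forms, by the Euler identity.\<close>
lemma derivation_eq_zero:
  assumes add: "\<And>a b. T (a + b) = T a + T b"
    and leibniz: "\<And>\<phi> b. lin_functional UNIV sm \<phi> \<Longrightarrow> mform sm b
      \<Longrightarrow> T (wd (form1 \<phi>) b) = wd (T (form1 \<phi>)) b + dsm c (wd (form1 \<phi>) (T b))"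
    and T0: "\<And>f. T (form0 f) = 0"
    and T1: "\<And>\<phi>. lin_functional UNIV sm \<phi> \<Longrightarrow> T (form1 \<phi>) = 0"
    and a: "mform sm a" "homog k a"
  shows "T a = (0 :: 'a list \<Rightarrow> 'r)"
  using a
proof (induct k arbitrary: a)
  case 0
  then show ?case using homog0_eq [of a] T0 by metis
next
  case (Suc k)
  have z: "T 0 = 0" using add [of 0 0] by simp
  have sum: "T (\<Sum>i\<in>I. g i) = (\<Sum>i\<in>I. T (g i))" for g and I :: "nat set"
    by (rule additive_sum [of T]) (simp_all add: z add)
  \<comment> \<open>\<open>T\<close> is assumed additive only, so integer multiples are the scalars
    that pass through it; the factor in the Euler identity is one.\<close>
  have nat: "T (dsm (of_nat n) a) = dsm (of_nat n) (T a)" for n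
  proof (induct n)
    case 0
    have "T (dsm (of_nat 0) a) = dsm (of_nat 0) (T a)" by (simp add: z)
    then show ?case .
  next
    case (Suc n)
    have s: "dsm (of_nat (Suc n)) b = b + dsm (of_nat n) b" for b :: "'a list \<Rightarrow> 'r"
      by (simp add: dsm_def fun_eq_iff algebra_simps)
    show ?case by (simp only: s add Suc)
  qed
  have "dsm (of_nat (Suc k)) a = (\<Sum>i<nb. wd (form1 (ff i)) (ictr (ee i) a))"
  proof
    fix xs show "dsm (of_nat (Suc k)) a xs = (\<Sum>i<nb. wd (form1 (ff i)) (ictr (ee i) a)) xs"
      using Suc.prems(2) by (cases "length xs = Suc k")
        (simp_all add: euler [OF Suc.prems(1)] dsm_apply homog_def)
  qed
  then have "dsm (of_nat (Suc k)) (T a) = (\<Sum>i<nb. T (wd (form1 (ff i)) (ictr (ee i) a)))"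
    by (simp only: nat [symmetric] sum)
  also have "\<dots> = 0"
  proof (intro sum.neutral ballI)
    fix i assume "i \<in> {..<nb}"
    then have "lin_functional UNIV sm (ff i)" using ff_dual by (simp add: dual1_def)
    moreover have "T (ictr (ee i) a) = 0"
      by (intro Suc.hyps mformD(4) homog_ictr Suc.prems)
    ultimately show "T (wd (form1 (ff i)) (ictr (ee i) a)) = 0"
      by (simp add: leibniz T1 mformD(4) [OF Suc.prems(1)])
  qed
  finally have *: "dsm (of_nat (Suc k)) (T a) = 0" .
  have "T a x = 0" for x
    by (rule of_nat_cancel [of k]) (use fun_cong [OF *, of x] in \<open>simp only: dsm_apply zero_fun_apply\<close>)
  then have "T a = 0" by (simp add: fun_eq_iff)
  then show ?case .
qed

section \<open>Contraction with the bivector\<close>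

abbreviation "ip \<equiv> ipi sm P"

lemma ip_eq: "ip a = dsm (of_real (1/2)) (\<Sum>i<nb. ictr (P (ff i)) (ictr (ee i) a))"
  by (rule ext) (simp add: ipi_def sum_dbasis dsm_apply sum_fun_apply ictr_apply scaleR_conv_of_real)

lemma ip_linear [simp]:
  "ip (a + b) = ip a + ip b" "ip (- a) = - ip a" "ip (a - b) = ip a - ip b" "ip 0 = 0"
  "ip (dsm f a) = dsm f (ip a)"
  by (simp_all add: ip_eq sum.distrib sum_negf sum_subtractf dsm_sum mult.commute)

lemma ip_par [simp]: "ip (par a) = par (ip a)"
  by (simp add: ip_eq par_sum)

lemma mform_ip: "mform sm a \<Longrightarrow> mform sm (ip a)"
  unfolding ip_eq by (intro mform_dsm mform_sum mformD(4))

lemma homog_sum: "(\<And>i. i \<in> I \<Longrightarrow> homog k (a i)) \<Longrightarrow> homog k (\<Sum>i\<in>I. a i)"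
  unfolding homog_def by (simp add: sum_fun_apply)

text \<open>Truncated subtraction is harmless: for \<open>k < 2\<close> the contraction is zero, and
  zero is homogeneous of every degree.\<close>

lemma homog_ip: "homog k a \<Longrightarrow> homog (k - 2) (ip a)"
proof -
  assume a: "homog k a"
  consider "k = 0" | "k = 1" | j where "k = Suc (Suc j)" by (metis One_nat_def not0_implies_Suc)
  then show ?thesis
  proof cases
    case 1 then show ?thesis using a by (simp add: ip_eq homog_ictr_0 homog_linear)
  next
    case 2 then show ?thesis using a homog_ictr_0 [OF homog_ictr [of 0 a]]
      by (simp add: ip_eq homog_linear)
  next
    case 3 then show ?thesis using a unfolding ip_eq
      by (intro homog_linear homog_sum homog_ictr) auto
  qed
qed

lemma ip_low: "homog k a \<Longrightarrow> k < 2 \<Longrightarrow> ip a = 0"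
  using homog_ictr_0 [of a] homog_ictr_0 [OF homog_ictr [of 0 a]]
  by (cases k) (auto simp: ip_eq less_2_cases_iff)

text \<open>Skew-symmetry of the bivector: \<open>\<Sum> P \<phi>\<^sub>i \<otimes> e\<^sub>i = - \<Sum> e\<^sub>i \<otimes> P \<phi>\<^sub>i\<close>.\<close>
lemma bivector_skew:
  assumes a: "mform sm a" and b: "mform sm b"
  shows "(\<Sum>i<nb. wd (par (ictr (P (ff i)) a)) (ictr (ee i) b))
    = - (\<Sum>i<nb. wd (par (ictr (ee i) a)) (ictr (P (ff i)) b))"
proof -
  let ?w = "\<lambda>i j. wd (par (ictr (ee i) a)) (ictr (ee j) b)"
  have e: "ictr (P (ff i)) u = (\<Sum>j<nb. dsm (ff j (P (ff i))) (ictr (ee j) u))" if "mform sm u" for u i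
    by (subst expand [of "P (ff i)"]) (simp add: mform_ictr_sum [OF that] mformD [OF that])
  have "(\<Sum>i<nb. wd (par (ictr (P (ff i)) a)) (ictr (ee i) b))
      = (\<Sum>i<nb. \<Sum>j<nb. dsm (ff j (P (ff i))) (?w j i))"
    by (simp add: e [OF a] par_sum wd_sum)
  also have "\<dots> = (\<Sum>j<nb. \<Sum>i<nb. dsm (ff j (P (ff i))) (?w j i))"
    by (rule sum.swap)
  also have "\<dots> = (\<Sum>j<nb. \<Sum>i<nb. - dsm (ff i (P (ff j))) (?w j i))"
  proof (intro sum.cong refl)
    fix i j assume "j \<in> {..<nb}" "i \<in> {..<nb}"
    then show "dsm (ff j (P (ff i))) (?w j i) = - dsm (ff i (P (ff j))) (?w j i)"
      using P_skew [of "ff i" "ff j"] by (simp add: ff_dual)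
  qed
  also have "\<dots> = - (\<Sum>i<nb. wd (par (ictr (ee i) a)) (ictr (P (ff i)) b))"
    by (simp add: e [OF b] wd_sum sum_negf)
  finally show ?thesis .
qed

lemma half_add: "dsm (of_real (1/2)) a + dsm (of_real (1/2)) a = (a :: 'x \<Rightarrow> 'r)"
proof
  fix x
  have "(of_real (1/2) :: 'r) + of_real (1/2) = 1" by (simp flip: of_real_add)
  then have "(of_real (1/2) + of_real (1/2)) * a x = a x" by simp
  then show "(dsm (of_real (1/2)) a + dsm (of_real (1/2)) a) x = a x"
    by (simp only: dsm_apply plus_fun_apply distrib_right)
qed

text \<open>Contraction with a bivector is a second-order operator, so a cross term arises with one
  leg in each factor. The two ways of distributing the legs agree by \<open>bivector_skew\<close>,
  which uses up the factor 1/2 in \<open>ipi\<close>.\<close>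

lemma ip_wd:
  assumes a: "mform sm a" and b: "mform sm b"
  shows "ip (wd a b) = wd (ip a) b + wd a (ip b)
    + (\<Sum>i<nb. wd (par (ictr (ee i) a)) (ictr (P (ff i)) b))"
proof -
  let ?h = "of_real (1/2) :: 'r"
  let ?S = "\<Sum>i<nb. wd (par (ictr (ee i) a)) (ictr (P (ff i)) b)"
  let ?R = "\<Sum>i<nb. wd (par (ictr (P (ff i)) a)) (ictr (ee i) b)"
  have "ip (wd a b) = wd (ip a) b + wd a (ip b) + dsm ?h ?S - dsm ?h ?R"
    unfolding ip_eq by (simp add: ictr_wd sum.distrib sum_subtractf wd_sum sum_negf algebra_simps del: of_real_divide)
  moreover have "?R = - ?S" by (rule bivector_skew [OF a b])
  ultimately show ?thesis using half_add [of ?S] by (simp add: add.assoc del: of_real_divide)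
qed

section \<open>The Koszul-Brylinski operator and the bracket that it generates\<close>

definition del :: "('a list \<Rightarrow> 'r) \<Rightarrow> 'a list \<Rightarrow> 'r" where
  "del a = ip (d a) - d (ip a)"

lemma delpi_eq: "delpi sm br rho P a = del a"
  by (rule ext) (simp add: delpi_def del_def)

lemma del_linear:
  "del (a + b) = del a + del b" "del (- a) = - del a" "del (a - b) = del a - del b" "del 0 = 0"
  by (simp_all add: del_def)

lemma del_sign: "del (dsm ((-1) ^ n) a) = dsm ((-1) ^ n) (del a)"
  by (simp add: del_def d_sign)

lemma del_par: "mform sm a \<Longrightarrow> del (par a) = - par (del a)"
  by (simp add: del_def d_par mform_ip)

lemma mform_del: "mform sm a \<Longrightarrow> mform sm (del a)"
  by (simp add: del_def mform_diff mform_ip mform_d)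

lemma homog_del:
  assumes "homog k a" shows "homog (k - 1) (del a)"
proof -
  have 1: "homog (k - 1) (ip (d a))" using homog_ip [OF homog_d [OF assms]] by (simp add: numeral_2_eq_2)
  have 2: "homog (k - 1) (d (ip a))"
  proof (cases "k < 2")
    case True then show ?thesis using ip_low [OF assms] by (simp add: homog_linear)
  next
    case False
    then have "Suc (k - 2) = k - 1" by simp
    then show ?thesis using homog_d [OF homog_ip [OF assms]] by simp
  qed
  show ?thesis unfolding del_def by (rule homog_linear(2) [OF 1 2])
qed

text \<open>The cross terms of \<open>ip_wd\<close> for (d a, b) and (par a, d b), minus d of the
  cross term for (a, b), combine by Cartan's formula: each pair i_X d + d i_X becomes a Lie
  derivative along \<open>ee i\<close> or \<open>P (ff i)\<close>.\<close>

lemma del_wd: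
  assumes a: "mform sm a" and b: "mform sm b"
  shows "del (wd a b) = wd (del a) b + wd (par a) (del b)
    + (\<Sum>i<nb. wd (par (Lie (ee i) a)) (ictr (P (ff i)) b) - wd (ictr (ee i) a) (Lie (P (ff i)) b))"
proof -
  note m = a b mform_par mform_d mform_ip mform_wd mformD(4)
  have "wd (par (Lie (ee i) a)) (ictr (P (ff i)) b) - wd (ictr (ee i) a) (Lie (P (ff i)) b)
    = wd (par (ictr (ee i) (d a))) (ictr (P (ff i)) b)
      + wd (par (ictr (ee i) (par a))) (ictr (P (ff i)) (d b))
      - d (wd (par (ictr (ee i) a)) (ictr (P (ff i)) b))" for i
    by (simp add: d_wd m cartan d_par algebra_simps)
  then have s: "(\<Sum>i<nb. wd (par (Lie (ee i) a)) (ictr (P (ff i)) b) - wd (ictr (ee i) a) (Lie (P (ff i)) b))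
    = (\<Sum>i<nb. wd (par (ictr (ee i) (d a))) (ictr (P (ff i)) b))
      + (\<Sum>i<nb. wd (par (ictr (ee i) (par a))) (ictr (P (ff i)) (d b)))
      - d (\<Sum>i<nb. wd (par (ictr (ee i) a)) (ictr (P (ff i)) b))"
    by (simp only: sum.distrib sum_subtractf d_sum)
  have "ip (d (wd a b)) = ip (wd (d a) b) + ip (wd (par a) (d b))"
    by (simp only: d_wd a b ip_linear)
  moreover have "d (ip (wd a b)) = d (wd (ip a) b) + d (wd a (ip b))
      + d (\<Sum>i<nb. wd (par (ictr (ee i) a)) (ictr (P (ff i)) b))"
    by (simp only: ip_wd a b d_linear)
  ultimately show ?thesis
    unfolding s del_def by (simp add: ip_wd [of "d a" b] ip_wd [of "par a" "d b"]
        d_wd [of "ip a" b] d_wd [of a "ip b"] m)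
qed

text \<open>The Schouten bracket with its degree-dependent prefactor absorbed into
  \<open>par a\<close>, so that it makes sense for inhomogeneous forms.\<close>

definition kos :: "('a list \<Rightarrow> 'r) \<Rightarrow> ('a list \<Rightarrow> 'r) \<Rightarrow> 'a list \<Rightarrow> 'r" where
  "kos a b = del (wd (par a) b) - wd (del (par a)) b - wd a (del b)"

lemma kos_linear:
  "kos (a + a') b = kos a b + kos a' b" "kos a (b + b') = kos a b + kos a b'"
  "kos (- a) b = - kos a b" "kos a (- b) = - kos a b"
  "kos (a - a') b = kos a b - kos a' b" "kos a (b - b') = kos a b - kos a b'"
  by (simp_all add: kos_def del_linear)

lemma kos_sign: "kos (dsm ((-1) ^ n) a) b = dsm ((-1) ^ n) (kos a b)"
proof (induct n)
  case (Suc n)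
  have "dsm ((-1) ^ Suc n) a = - dsm ((-1) ^ n) a" for a :: "'a list \<Rightarrow> 'r" by simp
  then show ?case using Suc by (simp only: kos_linear)
qed simp

lemma kos_eq:
  assumes a: "mform sm a" and b: "mform sm b"
  shows "kos a b = (\<Sum>i<nb. wd (Lie (ee i) a) (ictr (P (ff i)) b)
    + wd (par (ictr (ee i) a)) (Lie (P (ff i)) b))"
  unfolding kos_def del_wd [OF mform_par [OF a] b] by (simp add: Lie_linear)

lemma mform_kos: "mform sm a \<Longrightarrow> mform sm b \<Longrightarrow> mform sm (kos a b)"
  by (simp add: kos_def mform_diff mform_wd mform_del mform_par)

lemma par_kos:
  assumes "mform sm a" "mform sm b"
  shows "par (kos a b) = - kos (par a) (par b)"
proof -
  have p: "par (del u) = - del (par u)" if "mform sm u" for u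
    using del_par [OF that] by simp
  show ?thesis
    by (simp add: kos_def p assms mform_par mform_wd)
qed

text \<open>Bracketing with a p-form is a derivation of degree p - 1. Passing the 1-form costs
  (-1)^(p-1), written as a minus sign together with \<open>par a\<close>. The reason is visible in
  \<open>kos_eq\<close>: only contractions and Lie derivatives act on the second argument.\<close>

lemma kos_wd_one:
  assumes a: "mform sm a" and b: "mform sm b" and \<phi>: "lin_functional UNIV sm \<phi>"
  shows "kos a (wd (form1 \<phi>) b) = wd (kos a (form1 \<phi>)) b - wd (form1 \<phi>) (kos (par a) b)"
proof -
  note m = a b mform_form1 [OF \<phi>] mform_par
  have 1: "wd u (wd (form1 \<phi>) v) = wd (form1 \<phi>) (wd (par u) v)" for u v :: "'a list \<Rightarrow> 'r"
    using wd_one_commute [of \<phi> "par u"] by (simp only: wd_assoc [symmetric] par_par)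
  show ?thesis
    by (simp add: kos_eq m mform_wd ictr_wd Lie_wd Lie_linear 1 wd_assoc wd_sum sum.distrib
        sum_negf sum_subtractf algebra_simps)
qed

text \<open>The same derivation rule without sign; it is applied to the 2-form d_N \<phi>.\<close>

lemma kos_wd_two:
  assumes a: "mform sm a" and b: "mform sm b" and \<psi>: "mform sm \<psi>" "homog 2 \<psi>"
  shows "kos a (wd \<psi> b) = wd (kos a \<psi>) b + wd \<psi> (kos a b)"
proof -
  note m = a b \<psi>(1)
  have p: "par \<psi> = \<psi>" using homog_par [OF \<psi>(2)] by simp
  have 1: "wd u (wd \<psi> v) = wd \<psi> (wd u v)" for u v :: "'a list \<Rightarrow> 'r"
    using wd_commute_gen [OF \<psi>(2), of u] by (simp add: wd_assoc [symmetric] numeral_2_eq_2)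
  show ?thesis
    by (simp add: kos_eq m mform_wd ictr_wd Lie_wd 1 wd_assoc wd_sum sum.distrib p)
qed

text \<open>Graded skew-symmetry in degrees shifted by one: the exponent has the parity of (p - 1)(q
  - 1) + 1.\<close>

lemma kos_sym:
  assumes a: "mform sm a" "homog p a" and b: "mform sm b" "homog q b"
  shows "kos a b = dsm ((-1) ^ (p + q + p * q)) (kos b a)"
proof -
  note m = a b
  have c: "wd a b = dsm ((-1) ^ (p * q)) (wd b a)" using a b by (intro wd_commute)
  have 1: "wd (del a) b = dsm ((-1) ^ ((p - 1) * q)) (wd b (del a))"
    using a b by (intro wd_commute homog_del)
  have 2: "wd a (del b) = dsm ((-1) ^ (p * (q - 1))) (wd (del b) a)"
    using a b by (intro wd_commute homog_del)
  \<comment> \<open>For functions the truncated \<open>p - 1\<close> would give the wrong parity in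
    \<open>s1\<close> and \<open>s2\<close>; these terms vanish there, as \<open>del\<close> lowers
    the degree.\<close>
  have z: "p = 0 \<Longrightarrow> del a = 0" "q = 0 \<Longrightarrow> del b = 0"
  proof -
    show "del a = 0" if "p = 0"
      using that a ip_low [of 0 a] ip_low [OF homog_d [of 0 a]] by (simp add: del_def)
    show "del b = 0" if "q = 0"
      using that b ip_low [of 0 b] ip_low [OF homog_d [of 0 b]] by (simp add: del_def)
  qed
  have s1: "dsm ((-1) ^ ((p - 1) * q)) (wd b (del a)) = dsm ((-1) ^ (p * q + q)) (wd b (del a))"
    using z(1) by (cases p) (simp_all add: power_add algebra_simps flip: power_mult_distrib)
  have s2: "dsm ((-1) ^ (p * (q - 1))) (wd (del b) a) = dsm ((-1) ^ (p * q + p)) (wd (del b) a)"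
    using z(2) by (cases q) (simp_all add: power_add algebra_simps flip: power_mult_distrib)
  have sq: "(-1) ^ n * ((-1) ^ n * x) = (x::'r)" for n x
    by (simp add: mult.assoc [symmetric] flip: power_mult_distrib)
  have sq': "(-1) ^ n * (-1) ^ n = (1::'r)" for n
    by (simp flip: power_mult_distrib)
  have L: "kos a b = dsm ((-1) ^ p) (dsm ((-1) ^ (p * q)) (del (wd b a)))
      - dsm ((-1) ^ p) (dsm ((-1) ^ (p * q + q)) (wd b (del a))) - dsm ((-1) ^ (p * q + p)) (wd (del b) a)"
    unfolding kos_def homog_par [OF a(2)] wd_dsm_left del_sign c 1 s1 2 s2 ..
  have R: "kos b a = dsm ((-1) ^ q) (del (wd b a)) - dsm ((-1) ^ q) (wd (del b) a) - wd b (del a)"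
    unfolding kos_def homog_par [OF b(2)] wd_dsm_left del_sign ..
  show ?thesis
    unfolding L R by (simp add: power_add ac_simps sq sq')
qed

lemma kos_form0: "mform sm b \<Longrightarrow> kos (form0 f) b = ictr (P (\<lambda>Y. rho Y f)) b"
proof -
  assume b: "mform sm b"
  have "(\<lambda>Y. rho Y f) \<in> dual1 sm" using rho_functional by (simp add: dual1_def)
  then have "ictr (P (\<lambda>Y. rho Y f)) b = (\<Sum>i<nb. dsm (rho (ee i) f) (ictr (P (ff i)) b))"
    by (simp add: P_expand mform_ictr_sum [OF b] mformD [OF b])
  moreover have "Lie X (form0 f) = form0 (rho X f)" for X
    by (rule list_fun_eqI) (simp_all add: Lie_def ictr_Dop Dop_linear [OF rho_der], simp add: Dop_def)
  ultimately show ?thesis by (simp add: kos_eq b)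
qed

text \<open>In \<open>kos_eq\<close>, L_(e_i) \<phi> splits into d(\<phi>(e_i)) and the contraction
  of d\<phi> by e_i. The first part turns \<phi>(e_i) L_(P \<phi>_i) into the Lie derivative along
  \<phi>(e_i) P \<phi>_i, and these sum to L_(P \<phi>); the second part acts on one argument at a
  time through P(i_X d\<phi>).\<close>

lemma kos_form1:
  assumes b: "mform sm b" and \<phi>: "lin_functional UNIV sm \<phi>"
  shows "kos (form1 \<phi>) b
    = Lie (P \<phi>) b + Dop (\<lambda>_. 0) (\<lambda>X. - P (\<lambda>Y. d (form1 \<phi>) [X, Y])) b"
proof -
  let ?dp = "d (form1 \<phi>)"
  have m1: "mform sm ?dp" by (intro mform_d mform_form1 \<phi>)
  have hdp: "homog 2 ?dp" using homog_d [OF homog_form1, of \<phi>] by (simp add: numeral_2_eq_2)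
  have \<phi>d: "\<phi> \<in> dual1 sm" using \<phi> by (simp add: dual1_def)
  have dd: "(\<lambda>Y. ?dp [X, Y]) \<in> dual1 sm" for X
    using mform_homog1 [OF mformD(4) [OF m1, of X]] by (simp add: dual1_def ictr_def)
  have "kos (form1 \<phi>) b = (\<Sum>i<nb. wd (Lie (ee i) (form1 \<phi>)) (ictr (P (ff i)) b)
      + dsm (\<phi> (ee i)) (Lie (P (ff i)) b))"
    by (simp add: kos_eq b mform_form1 \<phi>)
  also have "\<dots> = (\<Sum>i<nb. Lie (sm (\<phi> (ee i)) (P (ff i))) b
      + wd (ictr (ee i) ?dp) (ictr (P (ff i)) b))"
    by (intro sum.cong refl) (simp add: cartan mform_form1 \<phi> d_form0 Lie_sm b)
  also have "\<dots> = Lie (P \<phi>) b + (\<Sum>i<nb. wd (ictr (ee i) ?dp) (ictr (P (ff i)) b))"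
    by (simp add: P_expand [OF \<phi>d] Lie_sum b sum.distrib)
  also have "(\<Sum>i<nb. wd (ictr (ee i) ?dp) (ictr (P (ff i)) b))
      = Dop (\<lambda>_. 0) (\<lambda>X. - P (\<lambda>Y. ?dp [X, Y])) b"
  proof
    fix xs show "(\<Sum>i<nb. wd (ictr (ee i) ?dp) (ictr (P (ff i)) b)) xs
        = Dop (\<lambda>_. 0) (\<lambda>X. - P (\<lambda>Y. ?dp [X, Y])) b xs"
      using b
    proof (induct xs arbitrary: b)
      case Nil
      have "ictr X ?dp [] = 0" for X using hdp by (simp add: homog_def ictr_def)
      then show ?case by (simp add: sum_fun_apply Dop_def)
    next
      case (Cons Z xs)
      have e: "ictr Z (ictr X ?dp) = form0 (- ?dp [Z, X])" for X
      proof -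
        have "homog 0 (ictr Z (ictr X ?dp))"
          using hdp by (intro homog_ictr) (simp add: numeral_2_eq_2)
        then have "ictr Z (ictr X ?dp) = form0 (ictr Z (ictr X ?dp) [])" by (rule homog0_eq)
        also have "ictr Z (ictr X ?dp) [] = - ?dp [Z, X]"
          by (subst mform_ictr_anti [OF m1]) (simp add: ictr_def)
        finally show ?thesis .
      qed
      have pe: "par (ictr X ?dp) = - ictr X ?dp" for X
        using homog_par [OF homog_ictr [of 1 ?dp X]] hdp by (simp add: numeral_2_eq_2)
      have an: "ictr Z (ictr X b) = - ictr X (ictr Z b)" for X by (rule mform_ictr_anti [OF Cons.prems])
      have "ictr Z (\<Sum>i<nb. wd (ictr (ee i) ?dp) (ictr (P (ff i)) b))
        = (\<Sum>i<nb. dsm (- ?dp [Z, ee i]) (ictr (P (ff i)) b))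
          + (\<Sum>i<nb. wd (ictr (ee i) ?dp) (ictr (P (ff i)) (ictr Z b)))"
        by (simp only: ictr_sum ictr_wd e pe an wd_form0_left sum.distrib wd_linear minus_minus)
      also have "(\<Sum>i<nb. dsm (- ?dp [Z, ee i]) (ictr (P (ff i)) b)) = ictr (- P (\<lambda>Y. ?dp [Z, Y])) b"
        by (simp add: P_expand [OF dd] mform_ictr_minus [OF Cons.prems] mform_ictr_sum [OF Cons.prems]
            mformD [OF Cons.prems] sum_negf)
      finally have "ictr Z (\<Sum>i<nb. wd (ictr (ee i) ?dp) (ictr (P (ff i)) b)) xs
          = ictr Z (Dop (\<lambda>_. 0) (\<lambda>X. - P (\<lambda>Y. ?dp [X, Y])) b) xs"
        using Cons.hyps [OF mformD(4) [OF Cons.prems], of Z] by (simp add: ictr_Dop)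
      then show ?case by (simp only: ictr_def)
    qed
  qed
  finally show ?thesis .
qed

end

subsection \<open>Comparison with the wedge product given by permutations\<close>

lemma mform_insert:
  assumes a: "mform sm a" and i: "i \<le> m"
  shows "a (map (\<lambda>k. if k < i then g k else if k = i then X else g (k - 1)) [0..<Suc m])
    = (-1) ^ i * a (X # map g [0..<m])"
proof -
  let ?L = "map (\<lambda>k. if k < i then g k else if k = i then X else g (k - 1)) [0..<Suc m]"
  have 1: "del_at i ?L = map g [0..<m]"
    using i by (intro nth_equalityI) (auto simp: del_at_def nth_append min_def simp del: upt_Suc)
  have 2: "?L[i := X] = ?L"
    using i by (intro nth_equalityI) (auto simp: nth_list_update simp del: upt_Suc)
  have "a (X # del_at i ?L) = (-1) ^ i * a (?L[i := X])"
    using i by (intro move_front [OF a]) simp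
  then show ?thesis
    unfolding 1 2 by (simp add: mult.assoc [symmetric] flip: power_mult_distrib del: upt_Suc)
qed

text \<open>The wedge product before normalization: without the factorials the recursion on the
  argument list needs no division.\<close>

definition wedge_sum :: "nat \<Rightarrow> nat \<Rightarrow> ('a list \<Rightarrow> 'r::comm_ring_1) \<Rightarrow> ('a list \<Rightarrow> 'r) \<Rightarrow> 'a list \<Rightarrow> 'r" where
  "wedge_sum p q a b xs = (\<Sum>\<sigma> \<in> {\<sigma>. \<sigma> permutes {0..<p + q}}. of_int (sign \<sigma>)
          * a (map (\<lambda>i. xs ! \<sigma> i) [0..<p]) * b (map (\<lambda>i. xs ! \<sigma> (p + i)) [0..<q]))"

text \<open>As in the Laplace expansion: permutations are sorted by the position i that is sent to
  0, and deleting it leaves a permutation of one element less, at the cost of the sign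
  (-1)^i.\<close>

lemma sum_permutes_split:
  fixes f :: "(nat \<Rightarrow> nat) \<Rightarrow> 'r::comm_ring_1"
  shows "(\<Sum>\<sigma> \<in> {\<sigma>. \<sigma> permutes {0..<Suc n}}. of_int (sign \<sigma>) * f \<sigma>)
    = (\<Sum>i<Suc n. \<Sum>\<tau> \<in> {\<tau>. \<tau> permutes {0..<n}}. (-1) ^ i * of_int (sign \<tau>) * f (permutation_insert i 0 \<tau>))"
proof -
  let ?g = "\<lambda>\<sigma>. of_int (sign \<sigma>) * f \<sigma>"
  have "sum ?g {\<sigma>. \<sigma> permutes {0..<Suc n}}
      = sum ?g (\<Union>i\<in>{0..<Suc n}. {\<sigma>. \<sigma> permutes {0..<Suc n} \<and> \<sigma> i = 0})"
    by (subst permutation_split_ran [of 0]) simp_all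
  also have "\<dots> = (\<Sum>i\<in>{0..<Suc n}. sum ?g {\<sigma>. \<sigma> permutes {0..<Suc n} \<and> \<sigma> i = 0})"
  proof (rule sum.UNION_disjoint)
    show "\<forall>i\<in>{0..<Suc n}. finite {\<sigma>. \<sigma> permutes {0..<Suc n} \<and> \<sigma> i = 0}"
      using finite_permutations [of "{0..<Suc n}"] by (auto intro: rev_finite_subset)
    show "\<forall>i\<in>{0..<Suc n}. \<forall>j\<in>{0..<Suc n}. i \<noteq> j \<longrightarrow>
      {\<sigma>. \<sigma> permutes {0..<Suc n} \<and> \<sigma> i = 0} \<inter> {\<sigma>. \<sigma> permutes {0..<Suc n} \<and> \<sigma> j = 0} = {}"
      using permutation_disjoint_dom [of _ "{0..<Suc n}" _ 0] by simp
  qed simp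
  also have "\<dots> = (\<Sum>i\<in>{0..<Suc n}. \<Sum>\<tau> \<in> {\<tau>. \<tau> permutes {0..<n}}.
      (-1) ^ i * of_int (sign \<tau>) * f (permutation_insert i 0 \<tau>))"
  proof (rule sum.cong [OF refl])
    fix i assume "i \<in> {0..<Suc n}"
    then have i: "i < Suc n" by simp
    have "sum ?g {\<sigma>. \<sigma> permutes {0..<Suc n} \<and> \<sigma> i = 0}
      = sum ?g (permutation_insert i 0 ` {\<tau>. \<tau> permutes {0..<n}})"
      using permutation_fix [OF i, of 0] by simp
    also have "\<dots> = (\<Sum>\<tau> \<in> {\<tau>. \<tau> permutes {0..<n}}. ?g (permutation_insert i 0 \<tau>))"
      by (subst sum.reindex [OF permutation_insert_inj_on [OF i]]) simp_all
    also have "\<dots> = (\<Sum>\<tau> \<in> {\<tau>. \<tau> permutes {0..<n}}.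
      (-1) ^ i * of_int (sign \<tau>) * f (permutation_insert i 0 \<tau>))"
      by (intro sum.cong refl) (simp add: signof_permutation_insert i)
    finally show "sum ?g {\<sigma>. \<sigma> permutes {0..<Suc n} \<and> \<sigma> i = 0} = \<dots>" .
  qed
  finally show ?thesis by (simp only: atLeast0LessThan)
qed

lemma sum_lessThan_add:
  fixes f :: "nat \<Rightarrow> 'b::comm_monoid_add"
  shows "(\<Sum>i<p + q. f i) = (\<Sum>i<p. f i) + (\<Sum>j<q. f (p + j))"
  by (induct q) (simp_all add: add.assoc)

text \<open>The head X lands at a position i. If \<open>i < p\<close>, it is an argument of
  \<open>a\<close>; moving it to the front gives a second (-1)^i, so all p such terms are equal. If
  i = p + j, it is an argument of \<open>b\<close>, only (-1)^j is compensated, and (-1)^p remains.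
  This matches the recursion of \<open>wd\<close> up to the counts p and q, which build the
  factorials.\<close>

lemma wedge_sum_Cons:
  fixes a b :: "'a::ab_group_add list \<Rightarrow> 'b::comm_ring_1"
  assumes a: "mform sm a" and b: "mform sm b" and n: "length ys = n" "Suc n = p + q"
  shows "wedge_sum p q a b (X # ys)
    = of_nat p * wedge_sum (p - 1) q (ictr X a) b ys
      + (-1) ^ p * of_nat q * wedge_sum p (q - 1) a (ictr X b) ys"
proof -
  let ?S = "{\<tau>. \<tau> permutes {0..<n}}"
  define A where "A i \<tau> = a (map (\<lambda>k. (X # ys) ! permutation_insert i 0 \<tau> k) [0..<p])" for i \<tau>
  define B where "B i \<tau> = b (map (\<lambda>k. (X # ys) ! permutation_insert i 0 \<tau> (p + k)) [0..<q])" for i \<tau>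
  have s1: "(-1) ^ i * (-1) ^ i = (1::'b)" for i
    by (simp flip: power_mult_distrib)
  have sq: "(-1) ^ i * s * ((-1) ^ i * x * y) = s * x * (y::'b)" for i s x y
  proof -
    have "(-1) ^ i * s * ((-1) ^ i * x * y) = ((-1) ^ i * (-1) ^ i) * (s * x * y)" by (simp only: ac_simps)
    then show ?thesis by (simp add: s1)
  qed
  have sq2: "(-1) ^ (p + i) * s * (x * ((-1) ^ i * y)) = (-1) ^ p * (s * x * (y::'b))" for i s x y
  proof -
    have "(-1) ^ (p + i) * s * (x * ((-1) ^ i * y)) = ((-1) ^ i * (-1) ^ i) * ((-1) ^ p * (s * x * y))"
      by (simp only: ac_simps power_add)
    then show ?thesis by (simp add: s1)
  qed
  have ins: "(X # ys) ! permutation_insert i 0 \<tau> k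
      = (if k < i then ys ! \<tau> k else if k = i then X else ys ! \<tau> (k - 1))" for i \<tau> k
    by (simp add: permutation_insert_expand)
  have 1: "(\<Sum>\<tau>\<in>?S. (-1) ^ i * of_int (sign \<tau>) * (A i \<tau> * B i \<tau>))
      = wedge_sum (p - 1) q (ictr X a) b ys" if i: "i < p" for i
  proof -
    have "A i \<tau> = (-1) ^ i * ictr X a (map (\<lambda>k. ys ! \<tau> k) [0..<p - 1])" for \<tau>
    proof -
      have "a (map (\<lambda>k. if k < i then ys ! \<tau> k else if k = i then X else ys ! \<tau> (k - 1)) [0..<Suc (p - 1)])
        = (-1) ^ i * a (X # map (\<lambda>k. ys ! \<tau> k) [0..<p - 1])"
        using i by (intro mform_insert [OF a]) simp
      then show ?thesis using i by (simp add: A_def ins ictr_apply)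
    qed
    moreover have "B i \<tau> = b (map (\<lambda>k. ys ! \<tau> (p - 1 + k)) [0..<q])" for \<tau>
      using i by (simp add: B_def ins)
    moreover have n': "p - 1 + q = n" using i n by simp
    ultimately show ?thesis
      unfolding wedge_sum_def n' by (intro sum.cong refl) (simp add: sq)
  qed
  have 2: "(\<Sum>\<tau>\<in>?S. (-1) ^ (p + j) * of_int (sign \<tau>) * (A (p + j) \<tau> * B (p + j) \<tau>))
      = (-1) ^ p * wedge_sum p (q - 1) a (ictr X b) ys" if j: "j < q" for j
  proof -
    have "B (p + j) \<tau> = (-1) ^ j * ictr X b (map (\<lambda>k. ys ! \<tau> (p + k)) [0..<q - 1])" for \<tau>
    proof -
      have "b (map (\<lambda>k. if k < j then ys ! \<tau> (p + k) else if k = j then X else ys ! \<tau> (p + (k - 1)))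
          [0..<Suc (q - 1)]) = (-1) ^ j * b (X # map (\<lambda>k. ys ! \<tau> (p + k)) [0..<q - 1])"
        using j by (intro mform_insert [OF b, of j "q - 1" "\<lambda>k. ys ! \<tau> (p + k)"]) simp
      moreover have "map (\<lambda>k. if k < j then ys ! \<tau> (p + k) else if k = j then X else ys ! \<tau> (p + (k - 1)))
          [0..<Suc (q - 1)] = map (\<lambda>k. (X # ys) ! permutation_insert (p + j) 0 \<tau> (p + k)) [0..<q]"
        using j by (auto simp: ins simp del: upt_Suc)
      ultimately show ?thesis by (simp add: B_def ictr_apply)
    qed
    moreover have "A (p + j) \<tau> = a (map (\<lambda>k. ys ! \<tau> k) [0..<p])" for \<tau>
      unfolding A_def ins by (rule arg_cong [of _ _ a], rule map_cong) auto
    moreover have n': "p + (q - 1) = n" using j n by simp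
    ultimately show ?thesis
      unfolding wedge_sum_def sum_distrib_left n'
      by (intro sum.cong refl) (simp add: sq2)
  qed
  have "wedge_sum p q a b (X # ys)
      = (\<Sum>\<sigma> \<in> {\<sigma>. \<sigma> permutes {0..<Suc n}}. of_int (sign \<sigma>)
        * (a (map (\<lambda>i. (X # ys) ! \<sigma> i) [0..<p]) * b (map (\<lambda>i. (X # ys) ! \<sigma> (p + i)) [0..<q])))"
    unfolding wedge_sum_def n(2) by (simp only: mult.assoc)
  also have "\<dots> = (\<Sum>i<Suc n. \<Sum>\<tau>\<in>?S. (-1) ^ i * of_int (sign \<tau>) * (A i \<tau> * B i \<tau>))"
    unfolding A_def B_def by (rule sum_permutes_split)
  also have "\<dots> = (\<Sum>i<p. \<Sum>\<tau>\<in>?S. (-1) ^ i * of_int (sign \<tau>) * (A i \<tau> * B i \<tau>))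
     + (\<Sum>j<q. \<Sum>\<tau>\<in>?S. (-1) ^ (p + j) * of_int (sign \<tau>) * (A (p + j) \<tau> * B (p + j) \<tau>))"
    unfolding n(2) by (rule sum_lessThan_add)
  also have "\<dots> = of_nat p * wedge_sum (p - 1) q (ictr X a) b ys
      + (-1) ^ p * of_nat q * wedge_sum p (q - 1) a (ictr X b) ys"
    using 1 2 by (simp add: mult.left_commute mult.assoc)
  finally show ?thesis .
qed

lemma wedge_sum_eq_wd:
  assumes "mform sm a" "homog p a" "mform sm b" "homog q b" "length xs = p + q"
  shows "wedge_sum p q a b xs = fact p * fact q * wd a b xs"
  using assms
proof (induct xs arbitrary: a b p q)
  case Nil
  then show ?case by (simp add: wedge_sum_def)
next
  case (Cons X ys)
  note m = Cons.prems(1,3)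
  have 1: "of_nat p * wedge_sum (p - 1) q (ictr X a) b ys = fact p * fact q * wd (ictr X a) b ys"
  proof (cases p)
    case 0 then show ?thesis using Cons.prems(2) by (simp add: homog_ictr_0)
  next
    case (Suc p')
    then have "wedge_sum p' q (ictr X a) b ys = fact p' * fact q * wd (ictr X a) b ys"
      using Cons.prems by (intro Cons.hyps mformD(4) homog_ictr) auto
    then show ?thesis using Suc by (simp add: algebra_simps)
  qed
  have 2: "of_nat q * wedge_sum p (q - 1) a (ictr X b) ys = fact p * fact q * wd a (ictr X b) ys"
  proof (cases q)
    case 0 then show ?thesis using Cons.prems(4) by (simp add: homog_ictr_0)
  next
    case (Suc q')
    then have "wedge_sum p q' a (ictr X b) ys = fact p * fact q' * wd a (ictr X b) ys"
      using Cons.prems by (intro Cons.hyps mformD(4) homog_ictr) auto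
    then show ?thesis using Suc by (simp add: algebra_simps)
  qed
  have "wedge_sum p q a b (X # ys) = of_nat p * wedge_sum (p - 1) q (ictr X a) b ys
      + (-1) ^ p * (of_nat q * wedge_sum p (q - 1) a (ictr X b) ys)"
    using wedge_sum_Cons [OF m, of ys "length ys" p q X] Cons.prems(5) by (simp add: mult.assoc)
  then show ?case
    unfolding 1 2 by (simp add: homog_par [OF Cons.prems(2)] dsm_apply algebra_simps)
qed

lemma wedge_eq_wd:
  fixes a b :: "'a::ab_group_add list \<Rightarrow> 'r::{comm_ring_1,real_algebra_1}"
  assumes a: "mform sm a" "homog p a" and b: "mform sm b" "homog q b"
  shows "wedge p q a b = wd a b"
proof
  fix xs
  show "wedge p q a b xs = wd a b xs"
  proof (cases "length xs = p + q")
    case True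
    let ?f = "fact p * fact q :: real"
    have "wedge p q a b xs = scaleR (1 / ?f) (wedge_sum p q a b xs)"
      using True by (simp add: wedge_def wedge_sum_def atLeast0LessThan)
    also have "\<dots> = scaleR (1 / ?f) (of_real ?f * wd a b xs)"
      using wedge_sum_eq_wd [OF a b True] by simp
    also have "\<dots> = wd a b xs"
      by (simp add: scaleR_conv_of_real mult.assoc [symmetric] flip: of_real_mult)
    finally show ?thesis .
  next
    case False
    then show ?thesis using homog_wd [OF a(2) b(2)] by (auto simp: wedge_def homog_def)
  qed
qed

context bivector_algebroid
begin

lemma schouten_eq_kos:
  assumes a: "mform sm a" "homog p a" and b: "mform sm b" "homog q b"
  shows "schouten sm br rho P p q a b = kos a b"
proof
  fix xs
  have sq: "(-1) ^ p * ((-1) ^ p * x) = (x::'r)" for x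
    by (simp add: mult.assoc [symmetric] flip: power_mult_distrib)
  have "schouten sm br rho P p q a b xs
      = (-1) ^ p * (del (wd a b) xs - wd (del a) b xs - (-1) ^ p * wd a (del b) xs)"
    unfolding schouten_def delpi_eq [abs_def]
    using wedge_eq_wd [OF a b] wedge_eq_wd [OF mform_del [OF a(1)] homog_del [OF a(2)] b]
      wedge_eq_wd [OF a mform_del [OF b(1)] homog_del [OF b(2)]] by simp
  also have "\<dots> = kos a b xs"
    unfolding kos_def homog_par [OF a(2)] wd_dsm_left del_sign
    by (simp add: dsm_apply sq algebra_simps)
  finally show "schouten sm br rho P p q a b xs = kos a b xs" .
qed

end

section \<open>The deformed Dorfman bracket\<close>

locale complex_paired = deformed_algebroid sm br rho N + bivector_algebroid sm br rho P
  for sm :: "'r::{comm_ring_1,real_algebra_1} \<Rightarrow> 'a::ab_group_add \<Rightarrow> 'a" and br rho N P +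
  fixes S :: "'a \<Rightarrow> 'a \<Rightarrow> 'r"
  assumes jacobi: "br X (br Y Z) + br Y (br Z X) + br Z (br X Y) = 0"
    and rho_br: "rho (br X Y) f = rho X (rho Y f) - rho Y (rho X f)"
    and S_dual: "S X \<in> dual1 sm"
    and S_add: "S (X + Y) = S X + S Y"
    and S_sm: "S (sm f X) = dsm f (S X)"
    and S_skew: "S X Y = - S Y X"
    and sq: "e \<in> UNIV \<times> dual1 sm \<Longrightarrow> pop N P S (pop N P S e) = - e"
    and T_dual: "\<alpha> \<in> dual1 sm \<Longrightarrow> \<beta> \<in> dual1 sm \<Longrightarrow> ntorsion br rho N P S (0, \<alpha>) (0, \<beta>) = 0"
    and T_A: "ntorsion br rho N P S (X, 0) (Y, 0) = 0"
begin

section \<open>The Dorfman bracket of A + A* and its trilinear form\<close>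

lemmas dualD = dual1D [where sm = sm]

abbreviation "E \<equiv> (UNIV :: 'a set) \<times> dual1 sm"
abbreviation "pr \<equiv> (std_pair :: 'a \<times> ('a \<Rightarrow> 'r) \<Rightarrow> _)"
abbreviation "op \<equiv> pop N P S"

text \<open>The Dorfman bracket of the first two sections paired with the third. In this scalar
  form, invariance of the pairing (\<open>cub_metric\<close>) and the symmetric part
  (\<open>cub_sym\<close>) are rules for exchanging arguments.\<close>

definition cub :: "'a \<times> ('a \<Rightarrow> 'r) \<Rightarrow> 'a \<times> ('a \<Rightarrow> 'r) \<Rightarrow> 'a \<times> ('a \<Rightarrow> 'r) \<Rightarrow> 'r" where
  "cub e1 e2 e3 = snd e3 (br (fst e1) (fst e2)) + rho (fst e1) (snd e2 (fst e3))
    - snd e2 (br (fst e1) (fst e3)) - rho (fst e2) (snd e1 (fst e3))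
    + rho (fst e3) (snd e1 (fst e2)) + snd e1 (br (fst e2) (fst e3))"

definition dor :: "'a \<times> ('a \<Rightarrow> 'r) \<Rightarrow> 'a \<times> ('a \<Rightarrow> 'r) \<Rightarrow> 'a \<times> ('a \<Rightarrow> 'r)" where
  "dor e1 e2 = (br (fst e1) (fst e2), \<lambda>Z. rho (fst e1) (snd e2 Z)
    - snd e2 (br (fst e1) Z) - rho (fst e2) (snd e1 Z)
    + rho Z (snd e1 (fst e2)) + snd e1 (br (fst e2) Z))"

lemma mem_E: "(X, \<alpha>) \<in> E \<longleftrightarrow> \<alpha> \<in> dual1 sm" by simp

lemma E_snd: "e \<in> E \<Longrightarrow> snd e \<in> dual1 sm" by auto

lemma pr_dor: "pr (dor e1 e2) e3 = cub e1 e2 e3"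
  by (simp add: std_pair_def dor_def cub_def)

lemma dor_E: "e1 \<in> E \<Longrightarrow> e2 \<in> E \<Longrightarrow> dor e1 e2 \<in> E"
  by (auto simp: dor_def dual1_iff br_add_right br_sm rho_add rho_sm rhoD algebra_simps)

lemma pr_sym: "pr e1 e2 = pr e2 e1"
  by (simp add: std_pair_def)

lemma pr_linear:
  "e \<in> E \<Longrightarrow> e' \<in> E \<Longrightarrow> u \<in> E \<Longrightarrow> pr (e + e') u = pr e u + pr e' u"
  "e \<in> E \<Longrightarrow> e' \<in> E \<Longrightarrow> u \<in> E \<Longrightarrow> pr u (e + e') = pr u e + pr u e'"
  "e \<in> E \<Longrightarrow> u \<in> E \<Longrightarrow> pr (esm sm f e) u = f * pr e u"
  "e \<in> E \<Longrightarrow> u \<in> E \<Longrightarrow> pr u (esm sm f e) = f * pr u e"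
  "e \<in> E \<Longrightarrow> u \<in> E \<Longrightarrow> pr (- e) u = - pr e u"
  "e \<in> E \<Longrightarrow> u \<in> E \<Longrightarrow> pr u (- e) = - pr u e"
  "e \<in> E \<Longrightarrow> e' \<in> E \<Longrightarrow> u \<in> E \<Longrightarrow> pr (e - e') u = pr e u - pr e' u"
  "e \<in> E \<Longrightarrow> e' \<in> E \<Longrightarrow> u \<in> E \<Longrightarrow> pr u (e - e') = pr u e - pr u e'"
  by (auto simp: std_pair_def esm_def dsm_apply dualD algebra_simps)

lemma E_linear:
  "e \<in> E \<Longrightarrow> e' \<in> E \<Longrightarrow> e + e' \<in> E" "e \<in> E \<Longrightarrow> esm sm f e \<in> E" "e \<in> E \<Longrightarrow> - e \<in> E" "0 \<in> E"
  "e \<in> E \<Longrightarrow> e' \<in> E \<Longrightarrow> e - e' \<in> E"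
  by (auto simp: esm_def dual1_linear zero_prod_def)

lemma pr_nondegenerate:
  assumes "e \<in> E" "\<And>u. u \<in> E \<Longrightarrow> pr e u = 0" shows "e = 0"
proof -
  obtain X \<alpha> where e: "e = (X, \<alpha>)" by (cases e)
  have "\<alpha> Y = 0" for Y using assms(2) [of "(Y, 0)"] by (simp add: e std_pair_def dual1_linear)
  moreover have "ff i X = 0" if "i < nb" for i
    using assms(2) [of "(0, ff i)"] assms(1) ff_dual [OF that] by (simp add: e std_pair_def dualD)
  then have "(\<Sum>i<nb. sm (ff i X) (ee i)) = 0" by (intro sum.neutral ballI) simp
  then have "X = 0" using expand [of X] by simp
  ultimately show ?thesis by (simp add: e zero_prod_def fun_eq_iff)
qed

lemma pr_eqI:
  assumes "e \<in> E" "e' \<in> E" "\<And>u. u \<in> E \<Longrightarrow> pr e u = pr e' u" shows "e = e'"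
  using pr_nondegenerate [of "e - e'"] assms by (simp add: E_linear pr_linear)

lemma br_minus: "br X (- Y) = - br X Y"
  using br_sm [of X "-1" Y] by (simp add: rhoD)

lemma cub_add:
  assumes "a \<in> E" "a' \<in> E" "b \<in> E" "c \<in> E"
  shows "cub (a + a') b c = cub a b c + cub a' b c" "cub b (a + a') c = cub b a c + cub b a' c"
    "cub b c (a + a') = cub b c a + cub b c a'"
  using assms by (auto simp: cub_def dualD br_add_left br_add_right rho_add rhoD algebra_simps)

lemma cub_esm_right:
  assumes "a \<in> E" "b \<in> E" "c \<in> E"
  shows "cub a (esm sm f b) c = f * cub a b c + rho (fst a) f * pr b c"
    "cub a b (esm sm f c) = f * cub a b c"
  using assms by (auto simp: cub_def std_pair_def esm_def dsm_apply dualD br_sm br_sm_left rho_sm rhoD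
    algebra_simps)

lemma cub_metric:
  assumes "a \<in> E" "b \<in> E" "c \<in> E"
  shows "cub a b c + cub a c b = rho (fst a) (pr b c)"
proof -
  have "snd a (br (fst c) (fst b)) = - snd a (br (fst b) (fst c))"
    using assms by (subst br_skew) (auto simp: dualD)
  then show ?thesis by (simp add: cub_def std_pair_def rhoD)
qed

lemma cub_sym:
  assumes "a \<in> E" "b \<in> E" "c \<in> E"
  shows "cub a b c + cub b a c = rho (fst c) (pr a b)"
proof -
  have "snd c (br (fst b) (fst a)) = - snd c (br (fst a) (fst b))"
    using assms by (subst br_skew) (auto simp: dualD)
  then show ?thesis by (simp add: cub_def std_pair_def rhoD)
qed

lemma cub_master:
  assumes "e1 \<in> E" "e2 \<in> E" "e3 \<in> E" "e4 \<in> E"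
  shows "rho (fst e1) (cub e2 e3 e4) - rho (fst e2) (cub e1 e3 e4) + rho (fst e3) (cub e1 e2 e4)
    - rho (fst e4) (cub e1 e2 e3) - pr (dor e2 e3) (dor e1 e4) + pr (dor e1 e3) (dor e2 e4)
    - pr (dor e1 e2) (dor e3 e4) = 0"
proof -
  obtain X1 a1 X2 a2 X3 a3 X4 a4 where e: "e1 = (X1, a1)" "e2 = (X2, a2)" "e3 = (X3, a3)" "e4 = (X4, a4)"
    by (metis surj_pair)
  then have a: "a1 \<in> dual1 sm" "a2 \<in> dual1 sm" "a3 \<in> dual1 sm" "a4 \<in> dual1 sm" using assms by auto
  \<comment> \<open>Each covector meets double brackets of the three other vectors only, so four
    instances of Jacobi, one per covector, suffice; the second derivatives cancel by
    \<open>rho_br\<close>.\<close>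
  have J: "\<alpha> (br X (br Y Z)) = \<alpha> (br Y (br X Z)) - \<alpha> (br Z (br X Y))" if "\<alpha> \<in> dual1 sm" for \<alpha> X Y Z
  proof -
    have "br Y (br Z X) = - br Y (br X Z)"
      by (subst br_skew [of Z X]) (simp add: br_minus)
    then have "br X (br Y Z) - br Y (br X Z) + br Z (br X Y) = 0"
      using jacobi [of X Y Z] by simp
    then have "br X (br Y Z) = 0 + br Y (br X Z) - br Z (br X Y)"
      by (metis add_diff_cancel_right' diff_add_cancel diff_add_eq)
    then show ?thesis by (simp add: dualD that)
  qed
  show ?thesis
    unfolding e cub_def dor_def std_pair_def fst_conv snd_conv
    by (simp only: rhoD rho_br)
      (simp add: J [OF a(1), of X2 X3 X4] J [OF a(2), of X1 X3 X4] J [OF a(3), of X1 X2 X4]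
        J [OF a(4), of X1 X2 X3] algebra_simps)
qed

subsection \<open>The paired operator\<close>

lemma op_E: "e \<in> E \<Longrightarrow> op e \<in> E"
  using S_dual by (auto simp: pop_def dual1_iff N_add N_sm algebra_simps)

lemma op_linear:
  "e \<in> E \<Longrightarrow> e' \<in> E \<Longrightarrow> op (e + e') = op e + op e'"
  "e \<in> E \<Longrightarrow> op (esm sm f e) = esm sm f (op e)"
  "e \<in> E \<Longrightarrow> op (- e) = - op e"
proof -
  show "e \<in> E \<Longrightarrow> e' \<in> E \<Longrightarrow> op (e + e') = op e + op e'"
    "e \<in> E \<Longrightarrow> op (esm sm f e) = esm sm f (op e)"
    by (auto simp: pop_def N_add S_add P_add N_sm S_sm P_dsm esm_def dsm_apply fun_eq_iff algebra_simps)
  have "S (- X) = - S X" for X using S_sm [of "-1" X] by simp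
  then show "e \<in> E \<Longrightarrow> op (- e) = - op e"
    by (auto simp: pop_def N_linear P_minus fun_eq_iff)
qed

lemma op_skew: "e \<in> E \<Longrightarrow> e' \<in> E \<Longrightarrow> pr (op e) e' = - pr e (op e')"
proof -
  assume "e \<in> E" "e' \<in> E"
  then obtain X a Y b where e: "e = (X, a)" "e' = (Y, b)" "a \<in> dual1 sm" "b \<in> dual1 sm" by auto
  show ?thesis
    using P_skew [OF e(3,4)] S_skew [of X Y] by (simp add: e std_pair_def pop_def dualD)
qed

lemma op_isometry: "e \<in> E \<Longrightarrow> e' \<in> E \<Longrightarrow> pr (op e) (op e') = pr e e'"
  using op_skew [of e "op e'"] op_E [of e'] sq [of e'] pr_linear(6) [of e' e] by simp

lemma pr_std_bracket:
  assumes "a \<in> E" "b \<in> E"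
  shows "pr (std_bracket br rho a b) c = cub a b c - scaleR (1/2) (rho (fst c) (pr a b))"
proof -
  have "scaleR (1/2) x + scaleR (1/2) x = (x::'r)" for x
    by (simp flip: scaleR_add_left)
  then have h: "x = scaleR (1/2) x + scaleR (1/2) x" for x :: 'r by metis
  have "rho (fst c) (snd a (fst b)) = scaleR (1/2) (rho (fst c) (snd a (fst b)))
      + scaleR (1/2) (rho (fst c) (snd a (fst b)))" by (rule h)
  then show ?thesis
    by (simp add: std_pair_def std_bracket_def cub_def lie1_def rhoD scaleR_add_right scaleR_diff_right)
qed

lemma std_bracket_E:
  assumes "a \<in> E" "b \<in> E" shows "std_bracket br rho a b \<in> E"
  using assms by (auto simp: std_bracket_def lie1_def dual1_iff br_add_right br_sm rho_add rho_sm rhoD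
    algebra_simps scaleR_add_right scaleR_diff_right)

text \<open>The half-gradients of the first two brackets cancel, because <op a, b> + <a, op b> = 0.
  The third survives with \<open>op\<close> moved over to \<open>c\<close>.\<close>

lemma pr_nbr:
  assumes "a \<in> E" "b \<in> E" "c \<in> E"
  shows "pr (nbr br rho N P S a b) c = cub (op a) b c + cub a (op b) c + cub a b (op c)
    - scaleR (1/2) (rho (fst (op c)) (pr a b))"
proof -
  note m = assms op_E std_bracket_E E_linear
  have "pr (op a) b + pr a (op b) = 0" using op_skew assms by simp
  then have z: "rho (fst c) (pr (op a) b) + rho (fst c) (pr a (op b)) = 0"
    by (simp flip: rhoD(1) add: rhoD(4))
  have "scaleR (1/2) (rho (fst c) (pr (op a) b)) + scaleR (1/2) (rho (fst c) (pr a (op b))) = 0"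
    by (simp flip: scaleR_add_right add: z)
  then show ?thesis
    unfolding nbr_def
    by (simp add: m pr_linear op_skew pr_std_bracket algebra_simps)
qed

lemma nbr_E: "a \<in> E \<Longrightarrow> b \<in> E \<Longrightarrow> nbr br rho N P S a b \<in> E"
  unfolding nbr_def by (intro E_linear std_bracket_E op_E)

section \<open>The torsion as a trilinear form\<close>

definition tor :: "'a \<times> ('a \<Rightarrow> 'r) \<Rightarrow> 'a \<times> ('a \<Rightarrow> 'r) \<Rightarrow> 'a \<times> ('a \<Rightarrow> 'r) \<Rightarrow> 'r" where
  "tor a b c = cub (op a) (op b) c + cub (op a) b (op c) + cub a (op b) (op c) - cub a b c"

lemma cub_minus: "a \<in> E \<Longrightarrow> b \<in> E \<Longrightarrow> c \<in> E \<Longrightarrow> cub a b (- c) = - cub a b c"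
  using cub_esm_right(2) [of a b c "-1"] by (simp add: esm_def uminus_prod_def prod_eq_iff)

text \<open>The torsion does not see the difference between the skew and the Dorfman bracket: its
  two half-gradients involve <op a, op b> = <a, b>, and \<open>op\<close> squared being -1 gives
  them opposite signs. The same square produces the last term of \<open>tor\<close>.\<close>

lemma pr_ntorsion:
  assumes "a \<in> E" "b \<in> E" "c \<in> E"
  shows "pr (ntorsion br rho N P S a b) c = tor a b c"
proof -
  note m = assms op_E std_bracket_E E_linear nbr_E
  have "rho (fst (- c)) f = - rho (fst c) f" for f
    using rho_sm [of "-1" "fst c" f] by simp
  then show ?thesis
    unfolding ntorsion_def tor_def
    by (simp add: m pr_linear op_skew pr_std_bracket op_isometry pr_nbr sq cub_minus)
qed

lemma tor_add:
  assumes "a \<in> E" "a' \<in> E" "b \<in> E" "c \<in> E"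
  shows "tor (a + a') b c = tor a b c + tor a' b c" "tor b (a + a') c = tor b a c + tor b a' c"
    "tor b c (a + a') = tor b c a + tor b c a'"
  using assms by (simp_all add: tor_def cub_add op_linear op_E)

text \<open>Symmetrizing in the last two arguments leaves only derivatives of pairings, by
  invariance; these vanish as \<open>op\<close> is both skew and an isometry.\<close>

lemma tor_skew_right:
  assumes "a \<in> E" "b \<in> E" "c \<in> E" shows "tor a b c = - tor a c b"
proof -
  note m = assms op_E
  have "tor a b c + tor a c b = (cub (op a) (op b) c + cub (op a) c (op b))
    + (cub (op a) b (op c) + cub (op a) (op c) b)
    + (cub a (op b) (op c) + cub a (op c) (op b)) - (cub a b c + cub a c b)"
    by (simp add: tor_def)
  also have "\<dots> = rho (fst (op a)) (pr (op b) c + pr b (op c))"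
    by (simp add: cub_metric m op_isometry rhoD)
  also have "\<dots> = 0" by (simp add: op_skew assms rhoD)
  finally show ?thesis by (simp add: eq_neg_iff_add_eq_0)
qed

lemma tor_skew_left:
  assumes "a \<in> E" "b \<in> E" "c \<in> E" shows "tor a b c = - tor b a c"
proof -
  note m = assms op_E
  have "tor a b c + tor b a c = (cub (op a) (op b) c + cub (op b) (op a) c)
    + (cub (op a) b (op c) + cub b (op a) (op c))
    + (cub a (op b) (op c) + cub (op b) a (op c)) - (cub a b c + cub b a c)"
    by (simp add: tor_def)
  also have "\<dots> = rho (fst (op c)) (pr (op a) b + pr a (op b))"
    by (simp add: cub_sym m op_isometry rhoD)
  also have "\<dots> = 0" by (simp add: op_skew assms rhoD)
  finally show ?thesis by (simp add: eq_neg_iff_add_eq_0)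
qed

text \<open>The torsion is a 3-form: each mixed component has two arguments in \<open>A\<close> or two in the dual.\<close>
lemma tor_zero:
  assumes "a \<in> E" "b \<in> E" "c \<in> E" shows "tor a b c = 0"
proof -
  have A: "tor (X, 0) (Y, 0) e = 0" if "e \<in> E" for X Y e
    using pr_ntorsion [of "(X, 0)" "(Y, 0)" e] that by (simp add: T_A dual1_linear)
      (simp add: std_pair_def zero_prod_def dualD [OF E_snd])
  have D: "tor (0, \<alpha>) (0, \<beta>) e = 0" if "e \<in> E" "\<alpha> \<in> dual1 sm" "\<beta> \<in> dual1 sm" for \<alpha> \<beta> e
    using pr_ntorsion [of "(0, \<alpha>)" "(0, \<beta>)" e] that by (simp add: T_dual)
      (simp add: std_pair_def zero_prod_def dualD [OF E_snd])
  have split: "e = (fst e, 0) + (0, snd e)" for e :: "'a \<times> ('a \<Rightarrow> 'r)" by (simp add: prod_eq_iff)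
  have mA: "(X, 0) \<in> E" for X by (simp add: dual1_linear)
  have mD: "e \<in> E \<Longrightarrow> (0, snd e) \<in> E" for e by auto
  have A': "tor (X, 0) e (Y, 0) = 0" if "e \<in> E" for X Y e
    using tor_skew_right [of "(X, 0)" e "(Y, 0)"] A [OF that] that mA by simp
  have D': "tor (0, \<alpha>) e (0, \<beta>) = 0" if "e \<in> E" "\<alpha> \<in> dual1 sm" "\<beta> \<in> dual1 sm" for \<alpha> \<beta> e
    using tor_skew_right [of "(0, \<alpha>)" e "(0, \<beta>)"] D [OF that] that by simp
  have A'': "tor e (X, 0) (Y, 0) = 0" if "e \<in> E" for X Y e
    using tor_skew_left [of e "(X, 0)" "(Y, 0)"] A' [OF that] that mA by simp
  have D'': "tor e (0, \<alpha>) (0, \<beta>) = 0" if "e \<in> E" "\<alpha> \<in> dual1 sm" "\<beta> \<in> dual1 sm" for \<alpha> \<beta> e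
    using tor_skew_left [of e "(0, \<alpha>)" "(0, \<beta>)"] D' [OF that] that by simp
  note m = mA mD assms E_snd
  have "tor a b c = tor ((fst a, 0) + (0, snd a)) ((fst b, 0) + (0, snd b)) ((fst c, 0) + (0, snd c))"
    by (simp flip: split)
  also have "\<dots> = 0"
    by (simp only: tor_add E_linear m A A' A'' D D' D'' add_0)
  finally show ?thesis .
qed

text \<open>The deformed bracket is the transport of the Dorfman bracket along \<open>op\<close>.\<close>
definition cubN :: "'a \<times> ('a \<Rightarrow> 'r) \<Rightarrow> 'a \<times> ('a \<Rightarrow> 'r) \<Rightarrow> 'a \<times> ('a \<Rightarrow> 'r) \<Rightarrow> 'r" where
  "cubN a b c = cub (op a) (op b) (op c)"

text \<open>\<open>- op\<close> is the inverse of \<open>op\<close>, so \<open>op\<close> maps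
  \<open>star\<close> to the standard Dorfman bracket.\<close>

definition star :: "'a \<times> ('a \<Rightarrow> 'r) \<Rightarrow> 'a \<times> ('a \<Rightarrow> 'r) \<Rightarrow> 'a \<times> ('a \<Rightarrow> 'r)" where
  "star a b = - op (dor (op a) (op b))"

abbreviation "anc \<equiv> nanchor rho N P"

lemma anc_eq: "anc e = rho (fst (op e))"
  by (rule ext) (simp add: nanchor_def pop_def rho_add)

lemma star_E: "a \<in> E \<Longrightarrow> b \<in> E \<Longrightarrow> star a b \<in> E"
  unfolding star_def by (intro E_linear op_E dor_E)

lemma pr_star: "a \<in> E \<Longrightarrow> b \<in> E \<Longrightarrow> c \<in> E \<Longrightarrow> pr (star a b) c = cubN a b c"
  by (simp add: star_def cubN_def pr_linear op_skew op_E dor_E E_linear pr_dor)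

text \<open>Vanishing torsion at (a, b, op c), where applying \<open>op\<close> twice turns c into
  -c. This identifies the transported bracket with the deformed one.\<close>

lemma cubN_eq:
  assumes "a \<in> E" "b \<in> E" "c \<in> E"
  shows "cubN a b c = cub (op a) b c + cub a (op b) c + cub a b (op c)"
  using tor_zero [of a b "op c"] assms
  by (simp add: tor_def cubN_def sq op_E cub_minus algebra_simps)

lemma pr_nbr_cubN:
  assumes "a \<in> E" "b \<in> E" "c \<in> E"
  shows "pr (nbr br rho N P S a b) c = cubN a b c - scaleR (1/2) (anc c (pr a b))"
  by (simp add: pr_nbr assms cubN_eq anc_eq)

lemma cubN_master:
  assumes "e1 \<in> E" "e2 \<in> E" "e3 \<in> E" "e4 \<in> E"
  shows "anc e1 (cubN e2 e3 e4) - anc e2 (cubN e1 e3 e4) + anc e3 (cubN e1 e2 e4)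
    - anc e4 (cubN e1 e2 e3) - pr (star e2 e3) (star e1 e4) + pr (star e1 e3) (star e2 e4)
    - pr (star e1 e2) (star e3 e4) = 0"
proof -
  have "pr (star a b) (star c u) = pr (dor (op a) (op b)) (dor (op c) (op u))"
    if "a \<in> E" "b \<in> E" "c \<in> E" "u \<in> E" for a b c u
    using that by (simp add: star_def pr_linear op_isometry op_E dor_E E_linear)
  then show ?thesis
    using cub_master [of "op e1" "op e2" "op e3" "op e4"] assms
    by (simp add: anc_eq cubN_def op_E)
qed

lemma cubN_metric: "a \<in> E \<Longrightarrow> b \<in> E \<Longrightarrow> c \<in> E \<Longrightarrow> cubN a b c + cubN a c b = anc a (pr b c)"
  by (simp add: cubN_def cub_metric op_E op_isometry anc_eq)

lemma cubN_sym: "a \<in> E \<Longrightarrow> b \<in> E \<Longrightarrow> c \<in> E \<Longrightarrow> cubN a b c + cubN b a c = anc c (pr a b)"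
  by (simp add: cubN_def cub_sym op_E op_isometry anc_eq)

lemma cubN_add:
  assumes "a \<in> E" "a' \<in> E" "b \<in> E" "c \<in> E"
  shows "cubN (a + a') b c = cubN a b c + cubN a' b c" "cubN b (a + a') c = cubN b a c + cubN b a' c"
    "cubN b c (a + a') = cubN b c a + cubN b c a'"
  using assms by (simp_all add: cubN_def cub_add op_E op_linear)

lemma cubN_esm:
  assumes "a \<in> E" "b \<in> E" "c \<in> E"
  shows "cubN a (esm sm f b) c = f * cubN a b c + anc a f * pr b c"
    "cubN a b (esm sm f c) = f * cubN a b c"
  using assms by (simp_all add: cubN_def cub_esm_right op_E op_linear op_isometry anc_eq)

lemma anc_star: "a \<in> E \<Longrightarrow> b \<in> E \<Longrightarrow> anc (star a b) f = anc a (anc b f) - anc b (anc a f)"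
proof -
  assume a: "a \<in> E" "b \<in> E"
  have "op (star a b) = dor (op a) (op b)"
    using a by (simp add: star_def op_linear op_E dor_E sq)
  then show ?thesis by (simp add: anc_eq dor_def rho_br)
qed

lemma anc_der: "is_derivation (anc e)"
  by (simp add: anc_eq rho_der)

lemmas ancD = derivationD [OF anc_der]

end

section \<open>The quasi-Lie bialgebroid\<close>

lemma mform_swap:
  assumes "mform sm a"
  shows "a (X # Y # zs) = - a (Y # X # zs)" "a (W # X # Y # zs) = - a (W # Y # X # zs)"
proof -
  have 1: "a (X # Y # zs) = - a (Y # X # zs)" if "mform sm a" for a X Y zs
    using mform_ictr_anti [OF that, of Y X] by (simp add: ictr_def fun_eq_iff)
  show "a (X # Y # zs) = - a (Y # X # zs)" by (rule 1 [OF assms])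
  show "a (W # X # Y # zs) = - a (W # Y # X # zs)"
    using 1 [OF mformD(4) [OF assms, of W], of X Y zs] by (simp add: ictr_def)
qed

lemma Dop_add_Dop:
  assumes "mform sm b"
  shows "Dop D K b + Dop (\<lambda>_. 0) K' b = Dop D (\<lambda>X. K X + K' X) b"
  by (rule ext) (simp add: Dop_def mform_update(1) [OF assms] sum.distrib add.assoc)

lemma homog_eqI:
  assumes "homog k a" "homog k b" "\<And>xs. length xs = k \<Longrightarrow> a xs = b xs" shows "a = b"
proof
  fix xs show "a xs = b xs" using assms by (cases "length xs = k") (auto simp: homog_def)
qed

context complex_paired
begin

abbreviation "brP \<equiv> brpi br rho P"
abbreviation "dn \<equiv> def.d"

lemma zero_dual [simp]: "0 \<in> dual1 sm" by (rule dual1_linear)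

definition Q :: "'a list \<Rightarrow> 'r" where "Q = d (form2 S)"

lemma form2_S: "mform sm (form2 S)" "homog 2 (form2 S)"
proof -
  have i: "ictr X (form2 S) = form1 (S X)" for X
    by (auto simp: ictr_def form2_def form1_def fun_eq_iff split: list.splits)
  have "S X X = 0" for X
  proof -
    have "of_nat (Suc 1) * S X X = 0" using S_skew [of X X] by (simp add: distrib_right)
    then show ?thesis by (rule of_nat_cancel)
  qed
  moreover have "form1 (f + g) = form1 f + form1 g" "form1 (dsm h f) = dsm h (form1 f)"
    for f g :: "'a \<Rightarrow> 'r" and h
    by (auto simp: form1_def dsm_def fun_eq_iff split: list.splits)
  moreover have "mform sm (form1 (S X))" for X
    using S_dual by (intro mform_form1) (simp add: dual1_def)
  ultimately show "mform sm (form2 S)"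
    by (subst mform_iff) (simp add: i S_add S_sm form0_linear)
  show "homog 2 (form2 S)"
    by (auto simp: homog_def form2_def split: list.splits)
qed

lemma mform_Q: "mform sm Q"
  unfolding Q_def by (intro mform_d form2_S)

lemma homog_Q: "homog 3 Q"
  using homog_d [OF form2_S(2)] by (simp add: Q_def)

lemma Q_apply: "Q [X, Y, Z] = rho X (S Y Z) - rho Y (S X Z) + rho Z (S X Y)
    - S (br X Y) Z + S (br X Z) Y - S (br Y Z) X"
  by (simp add: Q_def d_Cons form2_def)

lemma Q_zero: "Q [X, Y, 0] = 0"
  using mform_ictr_zero [OF mformD(4) [OF mformD(4) [OF mform_Q]], of Y X]
  by (simp add: ictr_def fun_eq_iff)

lemma S_linear: "S 0 = 0" "S X 0 = 0"
  using S_sm [of 0 0] dualD(3) [OF S_dual] by simp_all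

lemma brP_apply: "brP \<alpha> \<beta> Y = rho (P \<alpha>) (\<beta> Y) - \<beta> (br (P \<alpha>) Y) - rho (P \<beta>) (\<alpha> Y) + \<alpha> (br (P \<beta>) Y)
    - rho Y (\<beta> (P \<alpha>))"
  by (simp add: brpi_def lie1_def)

lemma op_A: "op (X, 0) = (N X, S X)" by (simp add: pop_def P_zero)
lemma op_D: "op (0, \<alpha>) = (P \<alpha>, \<lambda>Y. - \<alpha> (N Y))" by (simp add: pop_def N_linear S_linear)

lemma mem_A: "(X, 0) \<in> E" by (simp add: dual1_linear)
lemma mem_D: "\<alpha> \<in> dual1 sm \<Longrightarrow> (0, \<alpha>) \<in> E" by simp

lemma br_zero: "br 0 X = 0" "br X 0 = 0" "rho 0 f = 0"
  using br_add_left [of 0 0 X] br_add_right [of X 0 0] rho_add [of 0 0 f] by simp_all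

text \<open>Every term of \<open>cub\<close> contains two vector parts, while among (op \<alpha>,
  \<beta>, \<gamma>) only one is nonzero. Hence A* is closed under the deformed bracket.\<close>

lemma cubN_DDD:
  "\<alpha> \<in> dual1 sm \<Longrightarrow> \<beta> \<in> dual1 sm \<Longrightarrow> \<gamma> \<in> dual1 sm \<Longrightarrow> cubN (0, \<alpha>) (0, \<beta>) (0, \<gamma>) = 0"
  by (simp add: cubN_eq op_D cub_def N_linear S_linear br_zero dualD rhoD)

lemma cubN_DDA:
  "\<alpha> \<in> dual1 sm \<Longrightarrow> \<beta> \<in> dual1 sm \<Longrightarrow> cubN (0, \<alpha>) (0, \<beta>) (X, 0) = brP \<alpha> \<beta> X"
  using P_skew [of \<alpha> \<beta>]
  by (simp add: cubN_eq mem_A mem_D op_D op_A cub_def N_linear S_linear br_zero dualD rhoD brP_apply)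

lemma cubN_AAD: "\<alpha> \<in> dual1 sm \<Longrightarrow> cubN (X, 0) (Y, 0) (0, \<alpha>) = \<alpha> (brN X Y)"
  by (simp add: cubN_eq mem_A mem_D op_D op_A cub_def N_linear S_linear br_zero dualD dualD [OF S_dual] rhoD brN_def)

text \<open>\<open>N\<close> drops out, since it creates no covector part; the six terms with
  \<open>S\<close> are the Koszul formula for d\<sigma>.\<close>

lemma cubN_AAA: "cubN (X, 0) (Y, 0) (Z, 0) = Q [X, Y, Z]"
  using S_skew [of "br X Y" Z] S_skew [of "br X Z" Y] S_skew [of "br Y Z" X] S_skew [of X Z] S_skew [of X Y]
  by (simp add: cubN_eq mem_A op_A cub_def N_linear S_linear br_zero rhoD Q_apply)

lemma anc_A: "anc (X, 0) = rhoN X" and anc_D: "anc (0, \<alpha>) = rho (P \<alpha>)"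
  by (rule ext, simp add: nanchor_def N_linear P_zero br_zero rhoN_def)+

text \<open>Symmetry and invariance move the 1-form to the last slot, where the value is \<alpha> of
  \<open>brN X Y\<close>; the derivatives left behind complete it to the Koszul formula for d_N
  \<alpha>.\<close>

lemma cubN_DAA:
  assumes "\<alpha> \<in> dual1 sm"
  shows "cubN (0, \<alpha>) (X, 0) (Y, 0) = - dn (form1 \<alpha>) [X, Y]"
proof -
  have lin: "lin_functional UNIV sm \<alpha>" using assms by (simp add: dual1_def)
  have "cubN (0, \<alpha>) (X, 0) (Y, 0) + cubN (X, 0) (0, \<alpha>) (Y, 0) = rhoN Y (\<alpha> X)"
    using cubN_sym [OF mem_D [OF assms] mem_A mem_A, of X Y] by (simp add: std_pair_def anc_A)
  then have 1: "cubN (0, \<alpha>) (X, 0) (Y, 0) = rhoN Y (\<alpha> X) - cubN (X, 0) (0, \<alpha>) (Y, 0)"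
    by (simp only: eq_diff_eq)
  have "cubN (X, 0) (0, \<alpha>) (Y, 0) + cubN (X, 0) (Y, 0) (0, \<alpha>) = rhoN X (\<alpha> Y)"
    using cubN_metric [OF mem_A mem_D [OF assms] mem_A, of X Y] by (simp add: std_pair_def anc_A)
  then have 2: "cubN (X, 0) (0, \<alpha>) (Y, 0) = rhoN X (\<alpha> Y) - \<alpha> (brN X Y)"
    by (simp only: eq_diff_eq cubN_AAD [OF assms])
  show ?thesis
    unfolding 1 2 def.d_form1 [OF lin] by simp
qed

text \<open>The \<open>A\<close>-component of the deformed Dorfman bracket of a 1-form with a section of \<open>A\<close>.\<close>
definition cov :: "('a \<Rightarrow> 'r) \<Rightarrow> 'a \<Rightarrow> 'a" where
  "cov \<alpha> X = br (P \<alpha>) X + P (\<lambda>Y. d (form1 \<alpha>) [X, Y])"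

lemma ictr_d_dual:
  assumes "\<alpha> \<in> dual1 sm" shows "(\<lambda>Y. d (form1 \<alpha>) [X, Y]) \<in> dual1 sm"
proof -
  have "mform sm (d (form1 \<alpha>))" using assms by (intro mform_d mform_form1) (simp add: dual1_def)
  then show ?thesis using mform_homog1 [OF mformD(4), of sm "d (form1 \<alpha>)" X]
    by (simp add: dual1_def ictr_def)
qed

text \<open>Identifies \<open>cov \<alpha>\<close> as the Lie derivative along \<alpha> in the Lie
  algebroid A*_\<pi>, acting on its dual A.\<close>

lemma pair_cov:
  assumes a: "\<alpha> \<in> dual1 sm" and b: "\<beta> \<in> dual1 sm"
  shows "\<beta> (cov \<alpha> X) = rho (P \<alpha>) (\<beta> X) - brP \<alpha> \<beta> X"
proof -
  have "\<beta> (P (\<lambda>Y. d (form1 \<alpha>) [X, Y])) = - d (form1 \<alpha>) [X, P \<beta>]"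
    by (rule P_skew [OF ictr_d_dual [OF a] b])
  moreover have "d (form1 \<alpha>) [X, P \<beta>] = rho X (\<alpha> (P \<beta>)) - rho (P \<beta>) (\<alpha> X) - \<alpha> (br X (P \<beta>))"
    using a by (intro d_form1) (simp add: dual1_def)
  moreover have "\<alpha> (br X (P \<beta>)) = - \<alpha> (br (P \<beta>) X)"
    using a by (subst br_skew) (simp add: dualD)
  moreover have "rho X (\<beta> (P \<alpha>)) = - rho X (\<alpha> (P \<beta>))"
    using P_skew [OF a b] by (simp add: rhoD)
  ultimately show ?thesis using b by (simp add: cov_def dualD brP_apply)
qed

lemma brP_dual:
  assumes a: "\<alpha> \<in> dual1 sm" and b: "\<beta> \<in> dual1 sm" shows "brP \<alpha> \<beta> \<in> dual1 sm"
  unfolding dual1_iff [of "brP \<alpha> \<beta>"]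
  using P_skew [OF a b] by (simp add: brP_apply br_add_right br_sm rho_add rho_sm rhoD
      dualD [OF a] dualD [OF b] algebra_simps)

lemma star_DD: "\<alpha> \<in> dual1 sm \<Longrightarrow> \<beta> \<in> dual1 sm \<Longrightarrow> star (0, \<alpha>) (0, \<beta>) = (0, brP \<alpha> \<beta>)"
proof -
  assume a: "\<alpha> \<in> dual1 sm" "\<beta> \<in> dual1 sm"
  show ?thesis
  proof (rule pr_eqI)
    fix u assume "u \<in> E"
    then obtain X \<gamma> where u: "u = (X, 0) + (0, \<gamma>)" "\<gamma> \<in> dual1 sm" by (auto simp: plus_prod_def)
    show "pr (star (0, \<alpha>) (0, \<beta>)) u = pr (0, brP \<alpha> \<beta>) u"
      unfolding u(1) using a u(2) brP_dual [OF a]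
      by (simp only: pr_star mem_A mem_D E_linear cubN_add cubN_DDD cubN_DDA)
        (simp add: std_pair_def dualD)
  qed (use a brP_dual in \<open>auto simp: star_E mem_D\<close>)
qed

lemma star_AA: "star (X, 0) (Y, 0) = (brN X Y, \<lambda>Z. Q [X, Y, Z])"
proof (rule pr_eqI)
  have q: "(\<lambda>Z. Q [X, Y, Z]) \<in> dual1 sm"
    using mform_homog1 [OF mformD(4) [OF mformD(4) [OF mform_Q]], of Y X] by (simp add: dual1_def ictr_def)
  then show "(brN X Y, \<lambda>Z. Q [X, Y, Z]) \<in> E" by simp
  fix u assume "u \<in> E"
  then obtain Z \<gamma> where u: "u = (Z, 0) + (0, \<gamma>)" "\<gamma> \<in> dual1 sm" by (auto simp: plus_prod_def)
  show "pr (star (X, 0) (Y, 0)) u = pr (brN X Y, \<lambda>Z. Q [X, Y, Z]) u"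
    unfolding u(1) using u(2)
    by (simp only: pr_star mem_A mem_D E_linear cubN_add cubN_AAD cubN_AAA)
      (simp add: std_pair_def)
qed (intro star_E mem_A)

lemma star_DA:
  assumes a: "\<alpha> \<in> dual1 sm"
  shows "star (0, \<alpha>) (X, 0) = (cov \<alpha> X, \<lambda>Y. - dn (form1 \<alpha>) [X, Y])"
proof (rule pr_eqI)
  have m: "mform sm (dn (form1 \<alpha>))" using a by (intro def.mform_d mform_form1) (simp add: dual1_def)
  have q: "(\<lambda>Y. - dn (form1 \<alpha>) [X, Y]) \<in> dual1 sm"
    using mform_homog1 [OF mformD(4) [OF mform_minus [OF m]], of X] by (simp add: dual1_def ictr_def)
  then show "(cov \<alpha> X, \<lambda>Y. - dn (form1 \<alpha>) [X, Y]) \<in> E" by simp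
  fix u assume "u \<in> E"
  then obtain Z \<gamma> where u: "u = (Z, 0) + (0, \<gamma>)" "\<gamma> \<in> dual1 sm" by (auto simp: plus_prod_def)
  have "cubN (0, \<alpha>) (X, 0) (0, \<gamma>) = \<gamma> (cov \<alpha> X)"
    using cubN_metric [OF mem_D [OF a] mem_A mem_D [OF u(2)], of X] cubN_DDA [OF a u(2), of X]
      pair_cov [OF a u(2), of X] by (simp add: std_pair_def anc_D algebra_simps) (metis add_left_cancel)
  then show "pr (star (0, \<alpha>) (X, 0)) u = pr (cov \<alpha> X, \<lambda>Y. - dn (form1 \<alpha>) [X, Y]) u"
    unfolding u(1) using u(2) a
    by (simp only: pr_star mem_A mem_D E_linear cubN_add cubN_DAA)
      (simp add: std_pair_def)
qed (use a in \<open>auto intro!: star_E mem_A\<close>)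

text \<open>The off-diagonal block from A* to A of the equation op^2 = -1.\<close>

lemma NP: "\<alpha> \<in> dual1 sm \<Longrightarrow> N (P \<alpha>) = P (\<lambda>Y. \<alpha> (N Y))"
proof -
  assume a: "\<alpha> \<in> dual1 sm"
  have n: "(\<lambda>Y. \<alpha> (N Y)) \<in> dual1 sm" using a by (auto simp: dual1_iff N_add N_sm)
  have "fst (op (op (0, \<alpha>))) = 0" using sq [OF mem_D [OF a]] by simp
  then have "N (P \<alpha>) + P (- (\<lambda>Y. \<alpha> (N Y))) = 0"
    by (simp add: op_D) (simp add: pop_def fun_Compl_def)
  then show ?thesis by (simp add: P_minus [OF n])
qed

section \<open>Gradients of functions for the deformed structure\<close>

abbreviation "df f \<equiv> (\<lambda>Y. rho Y f)"
abbreviation "dNf f \<equiv> (\<lambda>Y. rhoN Y f)"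

lemma df_dual: "df f \<in> dual1 sm" "dNf f \<in> dual1 sm"
  using rho_functional def.rho_functional by (simp_all add: dual1_def)

lemma P_dNf: "P (dNf f) = N (P (df f))"
  using NP [OF df_dual(1), of f] by (simp add: rhoN_def)

text \<open>The standard gradient (0, df) transported by the inverse of \<open>op\<close>; its
  pairing with a section is the deformed anchor of that section applied to f.\<close>

definition grad :: "'r \<Rightarrow> 'a \<times> ('a \<Rightarrow> 'r)" where
  "grad f = (- P (df f), dNf f)"

lemma grad_E: "grad f \<in> E" by (simp add: grad_def df_dual)

lemma op_grad: "op (grad f) = (0, df f)"
proof -
  have "grad f = - op (0, df f)"
    by (simp add: grad_def op_D rhoN_def fun_eq_iff)
  then show ?thesis using op_linear(3) [OF op_E [OF mem_D [OF df_dual(1)]], of f] sq [OF mem_D [OF df_dual(1)], of f]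
    by simp
qed

lemma pr_grad: "e \<in> E \<Longrightarrow> pr (grad f) e = anc e f"
  using P_skew [OF E_snd df_dual(1), of e f]
  by (auto simp: std_pair_def grad_def nanchor_def rhoN_def dualD)

text \<open>After transport the first argument is an exact 1-form, and the Dorfman bracket with a
  closed 1-form on the left is zero.\<close>

lemma cubN_grad: "b \<in> E \<Longrightarrow> c \<in> E \<Longrightarrow> cubN (grad f) b c = 0"
  by (simp add: cubN_def op_grad cub_def br_zero rho_br rhoD dualD [OF E_snd [OF op_E]])

lemma anc_grad: "anc (grad f) g = 0"
  by (simp add: anc_eq op_grad br_zero)

subsection \<open>The Koszul bracket on generators\<close>

lemma lin_iff: "lin_functional UNIV sm \<phi> \<longleftrightarrow> \<phi> \<in> dual1 sm" by (simp add: dual1_def)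

text \<open>Merges the two derivations of \<open>kos_form1\<close>: a 1-form acts on all forms by
  the Lie derivative of A*_\<pi>, dual to \<open>cov\<close>.\<close>

lemma kos_one: "mform sm b \<Longrightarrow> \<phi> \<in> dual1 sm \<Longrightarrow>
    kos (form1 \<phi>) b = Dop (rho (P \<phi>)) (\<lambda>X. - cov \<phi> X) b"
proof -
  assume b: "mform sm b" and \<phi>: "\<phi> \<in> dual1 sm"
  have "br X (P \<phi>) + - P (\<lambda>Y. d (form1 \<phi>) [X, Y]) = - cov \<phi> X" for X
    using br_skew [of X "P \<phi>"] by (simp add: cov_def)
  then show ?thesis
    using kos_form1 [OF b, of \<phi>] \<phi>
    by (simp only: Lie_def Dop_add_Dop [OF b] lin_iff simp_thms)
qed

lemma mform_one: "\<phi> \<in> dual1 sm \<Longrightarrow> mform sm (form1 \<phi>)"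
  by (rule mform_form1) (simp add: dual1_def)

lemma mform_neg:
  assumes "mform sm a"
  shows "a (- X # zs) = - a (X # zs)" "a (W # - X # zs) = - a (W # X # zs)"
    "a (W # V # - X # zs) = - a (W # V # X # zs)"
  using mform_ictr_minus [OF assms, of X] mform_ictr_minus [OF mformD(4) [OF assms], of X W]
    mform_ictr_minus [OF mformD(4) [OF mformD(4) [OF assms]], of X V W]
  by (simp_all add: ictr_def fun_eq_iff)

lemma kos_one_apply:
  assumes "\<phi> \<in> dual1 sm" "mform sm b"
  shows "kos (form1 \<phi>) b [X] = rho (P \<phi>) (b [X]) - b [cov \<phi> X]"
    "kos (form1 \<phi>) b [X, Y] = rho (P \<phi>) (b [X, Y]) - b [cov \<phi> X, Y] - b [X, cov \<phi> Y]"
    "kos (form1 \<phi>) b [X, Y, Z] = rho (P \<phi>) (b [X, Y, Z]) - b [cov \<phi> X, Y, Z] - b [X, cov \<phi> Y, Z]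
      - b [X, Y, cov \<phi> Z]"
  by (simp_all add: kos_one [OF assms(2,1)] Dop_def mform_neg [OF assms(2)] lessThan_Suc numeral_3_eq_3)

lemma homog_kos: "homog p a \<Longrightarrow> homog q b \<Longrightarrow> homog (p + q - 1) (kos a b)"
proof -
  assume a: "homog p a" and b: "homog q b"
  have z: "p = 0 \<Longrightarrow> del (par a) = 0" "q = 0 \<Longrightarrow> del b = 0"
    using ip_low [of 0 "par a"] ip_low [OF homog_d [of 0 "par a"]] homog_parI [OF a]
      ip_low [of 0 b] ip_low [OF homog_d [of 0 b]] b by (simp_all add: del_def)
  have "homog (p + q - 1) (wd (del (par a)) b)"
  proof (cases p)
    case 0 then show ?thesis by (simp add: z homog_linear)
  next
    case (Suc p') then show ?thesis
      using homog_wd [OF homog_del [OF homog_parI [OF a]] b] by simp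
  qed
  moreover have "homog (p + q - 1) (wd a (del b))"
  proof (cases q)
    case 0 then show ?thesis by (simp add: z homog_linear)
  next
    case (Suc q') then show ?thesis using homog_wd [OF a homog_del [OF b]] by simp
  qed
  moreover have "homog (p + q - 1) (del (wd (par a) b))"
    by (intro homog_del homog_wd homog_parI a b)
  ultimately show ?thesis unfolding kos_def by (intro homog_linear)
qed

lemma kos_one_one:
  assumes "\<phi> \<in> dual1 sm" "\<psi> \<in> dual1 sm"
  shows "kos (form1 \<phi>) (form1 \<psi>) = form1 (brP \<phi> \<psi>)"
proof (rule homog_eqI)
  show "homog (Suc 0) (kos (form1 \<phi>) (form1 \<psi>))"
    using homog_kos [OF homog_form1 homog_form1, of \<phi> \<psi>] by simp
  show "kos (form1 \<phi>) (form1 \<psi>) xs = form1 (brP \<phi> \<psi>) xs" if len: "length xs = Suc 0" for xs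
  proof -
    obtain X where "xs = [X]" using len by (auto simp: length_Suc_conv)
    then show ?thesis
      using kos_one_apply(1) [OF assms(1) mform_one [OF assms(2)], of X] pair_cov [OF assms, of X]
      by (simp add: form1_def)
  qed
qed (rule homog_form1)

lemma kos_one_zero: "\<phi> \<in> dual1 sm \<Longrightarrow> kos (form1 \<phi>) (form0 g) = form0 (rho (P \<phi>) g)"
  by (rule ext) (simp add: kos_one, simp add: form0_def Dop_def rhoD)

subsection \<open>Identities from the Leibniz rule of the deformed bracket\<close>

lemma dn_apply2: "\<phi> \<in> dual1 sm \<Longrightarrow> dn (form1 \<phi>) [X, Y] = rhoN X (\<phi> Y) - rhoN Y (\<phi> X) - \<phi> (brN X Y)"
  by (rule def.d_form1) (simp add: dual1_def)

lemma dn_apply3: "dn b [X, Y, Z] = rhoN X (b [Y, Z]) - rhoN Y (b [X, Z]) + rhoN Z (b [X, Y])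
    - b [brN X Y, Z] + b [brN X Z, Y] - b [brN Y Z, X]"
  by (simp add: def.d_Cons)

lemma dn_apply4: "dn b [X, Y, Z, W] = rhoN X (b [Y, Z, W]) - rhoN Y (b [X, Z, W]) + rhoN Z (b [X, Y, W])
    - rhoN W (b [X, Y, Z])
    - b [brN X Y, Z, W] + b [brN X Z, Y, W] - b [brN X W, Y, Z]
    - b [brN Y Z, X, W] + b [brN Y W, X, Z] - b [brN Z W, X, Y]"
  by (simp add: def.d_Cons algebra_simps)

lemma dn_Q: "dn Q = 0"
proof (rule homog_eqI)
  show "homog 4 (dn Q)" using def.homog_d [OF homog_Q] by simp
  show "homog 4 (0 :: 'a list \<Rightarrow> 'r)" by (rule homog_linear)
  fix xs :: "'a list" assume "length xs = 4"
  then obtain X Y Z W where xs: "xs = [X, Y, Z, W]"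
    by (auto simp: length_Suc_conv numeral_eq_Suc)
  \<comment> \<open>Cyclic rotation is even. It brings \<open>brN\<close> from the last slot, where
    pairing two brackets puts it, to the first slot, where the Koszul formula has it.\<close>
  have r: "Q [A, B, C] = Q [C, A, B]" for A B C
    using mform_swap(1) [OF mform_Q, of A C "[B]"] mform_swap(2) [OF mform_Q, of A B C "[]"] by simp
  have "dn Q [X, Y, Z, W] = 0"
    using cubN_master [of "(X, 0)" "(Y, 0)" "(Z, 0)" "(W, 0)"]
    unfolding star_AA cubN_AAA anc_A
    by (simp add: mem_A std_pair_def dn_apply4 r [of _ _ "brN _ _"] algebra_simps)
  then show "dn Q xs = 0 xs" by (simp add: xs)
qed

text \<open>The anchor preserves brackets of two sections of A. Their deformed bracket also has the
  A*-part Q(X, Y, -), so \<open>rhoN\<close> alone fails to preserve \<open>brN\<close> by the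
  anchor of that part, which is the contraction of Q by P(df).\<close>

lemma dn_dn_form0: "dn (dn (form0 f)) = kos Q (form0 f)"
proof -
  have "kos Q (form0 f) = - kos (form0 f) Q"
    using kos_sym [OF mform_Q homog_Q mform_form0 homog_form0, of f] by simp
  also have "\<dots> = - ictr (P (df f)) Q" by (simp add: kos_form0 mform_Q)
  finally have k: "kos Q (form0 f) = - ictr (P (df f)) Q" .
  show ?thesis
    unfolding k
  proof (rule homog_eqI)
    show "homog 2 (dn (dn (form0 f)))"
      using def.homog_d [OF def.homog_d [OF homog_form0]] by (simp add: numeral_2_eq_2)
    show "homog 2 (- ictr (P (df f)) Q)"
      using homog_ictr [of 2 Q] homog_Q by (intro homog_linear) (simp add: numeral_eq_Suc)
    fix xs :: "'a list" assume "length xs = 2"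
    then obtain X Y where xs: "xs = [X, Y]" by (auto simp: length_Suc_conv numeral_eq_Suc)
    have q: "(\<lambda>Z. Q [X, Y, Z]) \<in> dual1 sm" using star_E [OF mem_A mem_A, of X Y] by (simp add: star_AA)
    have "anc (brN X Y, \<lambda>Z. Q [X, Y, Z]) f = rhoN X (rhoN Y f) - rhoN Y (rhoN X f)"
      using anc_star [OF mem_A mem_A, of X Y f] by (simp add: star_AA anc_A)
    then have "rhoN (brN X Y) f + rho (P (\<lambda>Z. Q [X, Y, Z])) f = rhoN X (rhoN Y f) - rhoN Y (rhoN X f)"
      by (simp add: nanchor_def rhoN_def)
    moreover have "rho (P (\<lambda>Z. Q [X, Y, Z])) f = - Q [X, Y, P (df f)]"
      by (rule P_skew [OF q df_dual(1)])
    moreover have "Q [X, Y, P (df f)] = Q [P (df f), X, Y]"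
      using mform_swap(1) [OF mform_Q, of X "P (df f)" "[Y]"] mform_swap(2) [OF mform_Q, of X Y "P (df f)" "[]"]
      by simp
    ultimately show "dn (dn (form0 f)) xs = (- ictr (P (df f)) Q) xs"
      by (simp add: xs def.d_form0 dn_apply2 [OF df_dual(2)] ictr_def algebra_simps)
  qed
qed

lemma dn_dn_form1:
  assumes a: "\<phi> \<in> dual1 sm" shows "dn (dn (form1 \<phi>)) = kos Q (form1 \<phi>)"
proof -
  note m = mform_one [OF a]
  have "kos Q (form1 \<phi>) = - kos (form1 \<phi>) Q"
    using kos_sym [OF mform_Q homog_Q m homog_form1] by simp
  show ?thesis
    unfolding \<open>kos Q (form1 \<phi>) = - kos (form1 \<phi>) Q\<close>
  proof (rule homog_eqI)
    show "homog 3 (dn (dn (form1 \<phi>)))"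
      using def.homog_d [OF def.homog_d [OF homog_form1]] by (simp add: numeral_3_eq_3)
    show "homog 3 (- kos (form1 \<phi>) Q)"
      using homog_kos [OF homog_form1 homog_Q, of \<phi>] by (intro homog_linear) simp
    fix xs :: "'a list" assume "length xs = 3"
    then obtain X Y Z where xs: "xs = [X, Y, Z]" by (auto simp: length_Suc_conv numeral_eq_Suc)
    have md: "mform sm (dn (form1 \<phi>))" by (intro def.mform_d m)
    have r: "Q [A, B, C] = Q [C, A, B]" for A B C
      using mform_swap(1) [OF mform_Q, of A C "[B]"] mform_swap(2) [OF mform_Q, of A B C "[]"] by simp
    have r1: "Q [X, cov \<phi> Y, Z] = - Q [X, Z, cov \<phi> Y]" "Q [cov \<phi> X, Y, Z] = Q [Y, Z, cov \<phi> X]"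
      using r mform_swap(2) [OF mform_Q] by metis+
    have s: "dn (form1 \<phi>) [brN A B, C] = - dn (form1 \<phi>) [C, brN A B]" for A B C
      by (rule mform_swap(1) [OF md])
    have "dn (dn (form1 \<phi>)) [X, Y, Z] = - kos (form1 \<phi>) Q [X, Y, Z]"
      using cubN_master [of "(0, \<phi>)" "(X, 0)" "(Y, 0)" "(Z, 0)"] a
      unfolding star_AA star_DA [OF a] cubN_AAA cubN_DAA [OF a] anc_A anc_D
      by (simp add: mem_A std_pair_def dn_apply3 kos_one_apply(3) [OF a mform_Q] r1 s def.rhoD algebra_simps)
    then show "dn (dn (form1 \<phi>)) xs = (- kos (form1 \<phi>) Q) xs" by (simp add: xs)
  qed
qed

lemma dn_dn:
  assumes "mform sm \<omega>" "homog k \<omega>" shows "dn (dn \<omega>) = kos Q \<omega>"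
proof -
  have "dn (dn \<omega>) - kos Q \<omega> = 0"
  \<comment> \<open>The square of an antiderivation and the bracket with the 3-form Q are both
    derivations of even degree 2, hence the sign 1.\<close>
  proof (rule derivation_eq_zero [where c = 1 and k = k and T = "\<lambda>\<omega>. dn (dn \<omega>) - kos Q \<omega>"])
    fix \<phi> b assume \<phi>: "lin_functional UNIV sm \<phi>" and b: "mform sm b"
    note m = mform_form1 [OF \<phi>] b
    have p: "par (dn (form1 \<phi>)) = dn (form1 \<phi>)"
      using homog_par [OF def.homog_d [OF homog_form1], of \<phi>] by simp
    have q: "par Q = - Q" using homog_par [OF homog_Q] by simp
    show "dn (dn (wd (form1 \<phi>) b)) - kos Q (wd (form1 \<phi>) b)
      = wd (dn (dn (form1 \<phi>)) - kos Q (form1 \<phi>)) b + dsm 1 (wd (form1 \<phi>) (dn (dn b) - kos Q b))"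
      by (simp add: def.d_wd m def.mform_d kos_wd_one mform_Q \<phi> p q kos_linear)
  qed (simp_all add: kos_linear assms dn_dn_form0 dn_dn_form1 lin_iff)
  then show ?thesis by simp
qed

section \<open>The failure of d_N to be a derivation of the Koszul bracket\<close>

definition defect :: "('a list \<Rightarrow> 'r) \<Rightarrow> ('a list \<Rightarrow> 'r) \<Rightarrow> 'a list \<Rightarrow> 'r" where
  "defect a b = dn (kos a b) - kos (dn a) b + kos (par a) (dn b)"

lemma defect_wd:
  assumes a: "mform sm a" and b: "mform sm b" and \<phi>: "lin_functional UNIV sm \<phi>"
  shows "defect a (wd (form1 \<phi>) b) = wd (defect a (form1 \<phi>)) b + wd (form1 \<phi>) (defect (par a) b)"
proof -
  note m = a b mform_form1 [OF \<phi>] mform_par def.mform_d mform_kos mform_wd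
  have h: "homog 2 (dn (form1 \<phi>))"
    using def.homog_d [OF homog_form1, of \<phi>] by (simp add: numeral_2_eq_2)
  show ?thesis
    unfolding defect_def
    by (simp add: kos_wd_one kos_wd_two [OF _ _ _ h] \<phi> m def.d_wd par_kos def.d_par kos_linear
        kos_linear algebra_simps)
qed

lemma defect_par: "homog k a \<Longrightarrow> defect (par a) b = dsm ((-1) ^ k) (defect a b)"
proof -
  assume a: "homog k a"
  have sq': "(-1) ^ n * (-1) ^ n = (1::'r)" for n
    by (simp flip: power_mult_distrib)
  show ?thesis
    unfolding defect_def homog_par [OF a] by (simp add: kos_sign def.d_sign)
      (simp add: homog_par [OF a] kos_sign sq')
qed

lemma defect_sym:
  assumes a: "mform sm a" "homog p a" and b: "mform sm b" "homog q b"
  shows "defect a b = dsm ((-1) ^ (p + q + p * q)) (defect b a)"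
proof -
  have 1: "kos a b = dsm ((-1) ^ (p + q + p * q)) (kos b a)" by (rule kos_sym [OF a b])
  have 2: "kos (dn a) b = dsm ((-1) ^ (Suc p + q + Suc p * q)) (kos b (dn a))"
    by (rule kos_sym [OF def.mform_d [OF a(1)] def.homog_d [OF a(2)] b])
  have 3: "kos a (dn b) = dsm ((-1) ^ (p + Suc q + p * Suc q)) (kos (dn b) a)"
    by (rule kos_sym [OF a def.mform_d [OF b(1)] def.homog_d [OF b(2)]])
  have sq': "(-1) ^ n * (-1) ^ n = (1::'r)" for n
    by (simp flip: power_mult_distrib)
  have sq: "(-1) ^ n * ((-1) ^ n * x) = (x::'r)" for n x
    by (simp add: mult.assoc [symmetric] sq')
  show ?thesis
    unfolding defect_def homog_par [OF a(2)] homog_par [OF b(2)] kos_sign 1 2 3 def.d_sign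
    by (simp add: power_add ac_simps sq sq')
qed

lemma defect_add: "defect a (b + b') = defect a b + defect a b'"
  by (simp add: defect_def kos_linear)

text \<open>The bracket of two functions is zero, and the two remaining terms agree because N P
  equals P composed with the transpose of N.\<close>

lemma defect_form0_form0: "defect (form0 f) (form0 g) = 0"
  by (simp add: defect_def kos_form0 def.d_form0 kos_one_zero df_dual P_dNf mform_one)
    (simp add: rhoN_def)

text \<open>Obtained from \<open>cubN_grad\<close>: the vanishing bracket of \<open>grad f\<close>
  with \<phi>, tested on X, is split into the contributions of the A-part -P(df) and the A*-part d_N
  f.\<close>

lemma defect_form0_form1:
  assumes a: "\<phi> \<in> dual1 sm" shows "defect (form0 f) (form1 \<phi>) = 0"
proof (rule homog_eqI)
  note m = mform_one [OF a]
  let ?p = "P (df f)"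
  have eq: "defect (form0 f) (form1 \<phi>)
      = form1 (dNf (\<phi> ?p)) - form1 (brP (dNf f) \<phi>) + ictr ?p (dn (form1 \<phi>))"
    by (simp add: defect_def kos_form0 m def.d_form0 kos_one_one a df_dual def.mform_d)
  show "homog (Suc 0) (defect (form0 f) (form1 \<phi>))"
    unfolding eq by (intro homog_linear homog_form1 homog_ictr def.homog_d)
  show "homog (Suc 0) (0 :: 'a list \<Rightarrow> 'r)" by (rule homog_linear)
  fix xs :: "'a list" assume "length xs = Suc 0"
  then obtain X where xs: "xs = [X]" by (auto simp: length_Suc_conv)
  have g: "grad f = (- ?p, 0) + (0, dNf f)" by (simp add: grad_def plus_prod_def)
  have r: "rhoN (- ?p) h = - rhoN ?p h" for h
    using def.rho_sm [of "-1" ?p h] by simp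
  have b: "brN (- ?p) X = - brN ?p X"
    using def.br_sm_left [of "-1" ?p X] by (simp add: def.rhoD)
  have "cubN (- ?p, 0) (0, \<phi>) (X, 0) + cubN (- ?p, 0) (X, 0) (0, \<phi>) = rhoN (- ?p) (\<phi> X)"
    using cubN_metric [OF mem_A mem_D [OF a] mem_A, of "- ?p" X]
    by (simp add: std_pair_def anc_A)
  then have "cubN (- ?p, 0) (0, \<phi>) (X, 0) = rhoN (- ?p) (\<phi> X) - \<phi> (brN (- ?p) X)"
    by (simp only: eq_diff_eq cubN_AAD [OF a])
  then have 1: "cubN (- ?p, 0) (0, \<phi>) (X, 0) = \<phi> (brN ?p X) - rhoN ?p (\<phi> X)"
    by (simp only: r b dualD [OF a]) simp
  have "cubN (0, dNf f) (0, \<phi>) (X, 0) + cubN (- ?p, 0) (0, \<phi>) (X, 0) = 0"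
    using cubN_grad [of "(0, \<phi>)" "(X, 0)" f] a df_dual(2) unfolding g
    by (simp only: cubN_add mem_A mem_D add.commute)
  then have "brP (dNf f) \<phi> X = rhoN ?p (\<phi> X) - \<phi> (brN ?p X)"
    unfolding 1 cubN_DDA [OF df_dual(2) a] by (simp add: algebra_simps eq_diff_eq)
  then show "defect (form0 f) (form1 \<phi>) xs = 0 xs"
    by (simp add: xs eq ictr_def dn_apply2 [OF a]) (simp add: form1_def)
qed

lemma defect_form1_form1:
  assumes a: "\<phi> \<in> dual1 sm" and b: "\<psi> \<in> dual1 sm" shows "defect (form1 \<phi>) (form1 \<psi>) = 0"
proof (rule homog_eqI)
  note m = mform_one [OF a] mform_one [OF b]
  have md: "mform sm (dn (form1 \<phi>))" "mform sm (dn (form1 \<psi>))" by (intro def.mform_d m)+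
  have hd: "homog 2 (dn (form1 \<phi>))" "homog 2 (dn (form1 \<psi>))"
    using def.homog_d [OF homog_form1, of \<phi>] def.homog_d [OF homog_form1, of \<psi>] by (simp_all add: numeral_2_eq_2)
  have "kos (dn (form1 \<phi>)) (form1 \<psi>) = - kos (form1 \<psi>) (dn (form1 \<phi>))"
    using kos_sym [OF md(1) hd(1) m(2) homog_form1] by simp
  then have eq: "defect (form1 \<phi>) (form1 \<psi>) = dn (form1 (brP \<phi> \<psi>)) + kos (form1 \<psi>) (dn (form1 \<phi>))
      - kos (form1 \<phi>) (dn (form1 \<psi>))"
    by (simp add: defect_def kos_one_one a b kos_linear)
  show "homog 2 (defect (form1 \<phi>) (form1 \<psi>))"
    unfolding eq using homog_kos [OF homog_form1 hd(1), of \<psi>] homog_kos [OF homog_form1 hd(2), of \<phi>]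
      def.homog_d [OF homog_form1, of "brP \<phi> \<psi>"]
    by (intro homog_linear) (simp_all add: numeral_2_eq_2)
  show "homog 2 (0 :: 'a list \<Rightarrow> 'r)" by (rule homog_linear)
  fix xs :: "'a list" assume "length xs = 2"
  then obtain X Y where xs: "xs = [X, Y]" by (auto simp: length_Suc_conv numeral_eq_Suc)
  have s: "dn (form1 \<gamma>) [cov A B, C] = - dn (form1 \<gamma>) [C, cov A B]" if "\<gamma> \<in> dual1 sm" for A B C \<gamma>
    by (rule mform_swap(1) [OF def.mform_d [OF mform_one [OF that]]])
  show "defect (form1 \<phi>) (form1 \<psi>) xs = 0 xs"
    using cubN_master [of "(0, \<phi>)" "(0, \<psi>)" "(X, 0)" "(Y, 0)"] a b
    unfolding star_AA star_DA [OF a] star_DA [OF b] star_DD [OF a b] cubN_DAA [OF a] cubN_DAA [OF b]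
      cubN_DDA [OF a b] anc_A anc_D
    by (simp add: xs eq mem_A std_pair_def kos_one_apply(2) [OF a md(2)] kos_one_apply(2) [OF b md(1)]
        dn_apply2 [OF brP_dual [OF a b]] s rhoD Q_zero algebra_simps)
qed

text \<open>Induction over generators works in the second argument only; \<open>defect_sym\<close>
  exchanges the arguments. So functions against all forms come first, then all forms against
  functions, then the same for 1-forms, and at last the general case.\<close>

lemma defect_zero:
  assumes "mform sm a" "homog p a" "mform sm b" "homog q b"
  shows "defect a b = 0"
proof -
  have step: "defect a b = 0" if a: "mform sm a" "homog k a"
      and 0: "\<And>f. defect a (form0 f) = 0" and 1: "\<And>\<phi>. lin_functional UNIV sm \<phi> \<Longrightarrow> defect a (form1 \<phi>) = 0"
      and b: "mform sm b" "homog l b" for a b k l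
    by (rule derivation_eq_zero [where c = "(-1) ^ k" and T = "defect a", OF defect_add _ 0 1 b])
      (simp_all add: defect_wd a(1) defect_par [OF a(2)])
  have f0: "defect (form0 f) b = 0" if "mform sm b" "homog l b" for f b l
    by (rule step [OF mform_form0 homog_form0 defect_form0_form0 _ that])
      (simp add: defect_form0_form1 lin_iff)
  have z0: "defect a (form0 f) = 0" if "mform sm a" "homog k a" for a k f
    using defect_sym [OF that mform_form0 homog_form0, of f] f0 [OF that] by simp
  have f1: "defect (form1 \<phi>) b = 0" if "lin_functional UNIV sm \<phi>" "mform sm b" "homog l b" for \<phi> b l
    using that by (intro step [OF mform_form1 homog_form1 z0 [OF mform_form1 homog_form1] _ that(2,3)])
      (simp_all add: defect_form1_form1 lin_iff)
  have z1: "defect a (form1 \<phi>) = 0" if "lin_functional UNIV sm \<phi>" "mform sm a" "homog k a" for a k \<phi>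
    using defect_sym [OF that(2,3) mform_form1 [OF that(1)] homog_form1] f1 [OF that] by simp
  show ?thesis
    by (rule step [OF assms(1,2) z0 [OF assms(1,2)] z1 [OF _ assms(1,2)] assms(3,4)])
qed

end

subsection \<open>The Lie algebroid on the dual\<close>

lemma scaleR_half:
  fixes x y :: "'b::real_vector"
  shows "scaleR (1/2) x + scaleR (1/2) x = x"
    "y - scaleR (1/2) (x + y) = scaleR (1/2) (y - x)"
    "y - x - scaleR (1/2) (y - x) = scaleR (1/2) (y - x)"
proof -
  show h: "scaleR (1/2) x + scaleR (1/2) x = x" for x :: 'b
    by (simp flip: scaleR_add_left)
  have e: "x = scaleR (1/2) x + scaleR (1/2) x" for x :: 'b by (rule h [symmetric])
  show "y - scaleR (1/2) (x + y) = scaleR (1/2) (y - x)"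
    by (subst e [of y]) (simp add: scaleR_add_right scaleR_diff_right)
  show "y - x - scaleR (1/2) (y - x) = scaleR (1/2) (y - x)"
    by (subst e [of "y - x"]) (simp only: add_diff_cancel)
qed

context complex_paired
begin

lemma rho_const: "rho X (of_real c) = 0"
  using rhoD(2) [of X c 1] by (simp add: rhoD(7) flip: scaleR_conv_of_real) (simp add: of_real_def)

text \<open>Paired with \<open>u\<close>, each nested bracket becomes, by invariance and symmetry, a
  derivative of \<open>cubN\<close> minus a pairing of two brackets; the total is
  \<open>cubN_master\<close>.\<close>

lemma star_leibniz:
  assumes "a \<in> E" "b \<in> E" "c \<in> E"
  shows "star a (star b c) = star (star a b) c + star b (star a c)"
proof (rule pr_eqI)
  note m = assms star_E
  fix u assume u: "u \<in> E"
  note m = m u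
  have 1: "cubN x (star y z) u = anc x (cubN y z u) - pr (star y z) (star x u)"
    if "x \<in> E" "y \<in> E" "z \<in> E" for x y z
  proof -
    have "cubN x (star y z) u + pr (star x u) (star y z) = anc x (cubN y z u)"
      using cubN_metric [of x "star y z" u] by (simp only: pr_star star_E that u)
    then show ?thesis by (simp only: eq_diff_eq pr_sym [of "star y z" "star x u"])
  qed
  have "cubN (star a b) c u = anc u (cubN a b c) - cubN c (star a b) u"
    using cubN_sym [of "star a b" c u] m by (simp add: pr_star star_E eq_diff_eq)
  then have 2: "cubN (star a b) c u
      = anc u (cubN a b c) - (anc c (cubN a b u) - pr (star a b) (star c u))"
    using 1 [of c a b] m by simp
  show "pr (star a (star b c)) u = pr (star (star a b) c + star b (star a c)) u"
  proof -
    let ?M = "anc a (cubN b c u) - anc b (cubN a c u) + anc c (cubN a b u) - anc u (cubN a b c)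
      - pr (star b c) (star a u) + pr (star a c) (star b u) - pr (star a b) (star c u)"
    have "cubN a (star b c) u = ?M + (cubN (star a b) c u + cubN b (star a c) u)"
      unfolding 1 [OF assms(1,2,3)] 1 [OF assms(2,1,3)] 2 by simp
    also have "?M = 0" by (rule cubN_master [OF assms u])
    finally show ?thesis by (simp only: add_0 pr_star pr_linear star_E m)
  qed
qed (use assms in \<open>simp_all add: star_E E_linear del: mem_Times_iff mem_Sigma_iff\<close>)

lemma brP_skew: "\<alpha> \<in> dual1 sm \<Longrightarrow> \<beta> \<in> dual1 sm \<Longrightarrow> brP \<alpha> \<beta> = - brP \<beta> \<alpha>"
  using P_skew [of \<alpha> \<beta>] by (simp add: fun_eq_iff brP_apply rhoD)

lemma brP_dsm:
  assumes a: "\<alpha> \<in> dual1 sm" and b: "\<beta> \<in> dual1 sm"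
  shows "brP \<alpha> (dsm f \<beta>) = dsm f (brP \<alpha> \<beta>) + dsm (rho (P \<alpha>) f) \<beta>"
  using P_skew [OF a b] by (simp add: fun_eq_iff brP_apply P_dsm [OF b] dsm_apply rhoD rho_sm br_sm_left
      dualD [OF a] dualD [OF b] algebra_simps)

lemma brP_add_right:
  "\<alpha> \<in> dual1 sm \<Longrightarrow> \<beta> \<in> dual1 sm \<Longrightarrow> \<gamma> \<in> dual1 sm \<Longrightarrow> brP \<alpha> (\<beta> + \<gamma>) = brP \<alpha> \<beta> + brP \<alpha> \<gamma>"
  by (simp add: fun_eq_iff brP_apply P_add rhoD rho_add br_add_left dualD algebra_simps)

lemma brP_jacobi:
  assumes "\<alpha> \<in> dual1 sm" "\<beta> \<in> dual1 sm" "\<gamma> \<in> dual1 sm"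
  shows "brP \<alpha> (brP \<beta> \<gamma>) + brP \<beta> (brP \<gamma> \<alpha>) + brP \<gamma> (brP \<alpha> \<beta>) = 0"
proof -
  have "brP \<alpha> (brP \<beta> \<gamma>) = brP (brP \<alpha> \<beta>) \<gamma> + brP \<beta> (brP \<alpha> \<gamma>)"
    using star_leibniz [of "(0, \<alpha>)" "(0, \<beta>)" "(0, \<gamma>)"] assms
    by (simp add: star_DD brP_dual plus_prod_def)
  moreover have "brP (brP \<alpha> \<beta>) \<gamma> = - brP \<gamma> (brP \<alpha> \<beta>)"
    using assms by (intro brP_skew brP_dual)
  moreover have "brP \<beta> (brP \<alpha> \<gamma>) = - brP \<beta> (brP \<gamma> \<alpha>)"
  proof -
    have "brP \<beta> (brP \<alpha> \<gamma>) = brP \<beta> (dsm (-1) (brP \<gamma> \<alpha>))" using brP_skew [of \<alpha> \<gamma>] assms by simp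
    then show ?thesis using assms by (simp only: brP_dsm brP_dual) (simp add: rhoD)
  qed
  ultimately show ?thesis by simp
qed

lemma dual_module: "r_module (dual1 sm) dsm"
  by (auto simp: r_module_def dual1_linear) (auto simp: fun_eq_iff dsm_apply algebra_simps)

lemma dual_projective: "fg_projective (dual1 sm) dsm"
proof -
  let ?bs = "map (\<lambda>(e, \<phi>). (\<phi>, \<lambda>\<alpha>. \<alpha> e)) (dbasis sm)"
  have "\<phi> \<in> dual1 sm" if "(e, \<phi>) \<in> set (dbasis sm)" for e \<phi>
    using dbasis that by (auto simp: is_dual_basis_def dual1_def)
  moreover have "(\<Sum>(x, g)\<leftarrow>?bs. dsm (g \<alpha>) x) = \<alpha>" if "\<alpha> \<in> dual1 sm" for \<alpha>
  proof -
    have "(\<Sum>(x, g)\<leftarrow>?bs. dsm (g \<alpha>) x) = (\<Sum>(e, \<phi>)\<leftarrow>dbasis sm. dsm (\<alpha> e) \<phi>)"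
      by (simp add: case_prod_unfold comp_def)
    then show ?thesis using expand_dual [OF that] by (simp add: sum_dbasis)
  qed
  ultimately have "is_dual_basis (dual1 sm) dsm ?bs"
    unfolding is_dual_basis_def by (auto simp: lin_functional_def dsm_apply)
  then show ?thesis by (auto simp: fg_projective_def)
qed

lemma lie_algebroid_dual: "lie_algebroid (dual1 sm) dsm brP (\<lambda>\<alpha>. rho (P \<alpha>))"
  unfolding lie_algebroid_def
proof (intro conjI ballI allI)
  fix \<alpha> \<beta> \<gamma> f g c assume a: "\<alpha> \<in> dual1 sm"
  show "is_derivation (rho (P \<alpha>))" by (rule rho_der)
  show "rho (P (dsm g \<alpha>)) f = g * rho (P \<alpha>) f" using a by (simp add: P_dsm rho_sm)
  assume b: "\<beta> \<in> dual1 sm"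
  show "brP \<alpha> \<beta> \<in> dual1 sm" by (rule brP_dual [OF a b])
  show "brP \<alpha> \<beta> = - brP \<beta> \<alpha>" by (rule brP_skew [OF a b])
  show "rho (P (\<alpha> + \<beta>)) f = rho (P \<alpha>) f + rho (P \<beta>) f" using a b by (simp add: P_add rho_add)
  show "rho (P (brP \<alpha> \<beta>)) f = rho (P \<alpha>) (rho (P \<beta>) f) - rho (P \<beta>) (rho (P \<alpha>) f)"
    using anc_star [OF mem_D [OF a] mem_D [OF b], of f] a b by (simp add: star_DD anc_D)
  show "brP \<alpha> (dsm f \<beta>) = dsm f (brP \<alpha> \<beta>) + dsm (rho (P \<alpha>) f) \<beta>" by (rule brP_dsm [OF a b])
  show "brP (dsm (of_real c) \<alpha>) \<beta> = dsm (of_real c) (brP \<alpha> \<beta>)"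
    using brP_skew [OF dual1_linear(4) [OF a, of "of_real c"] b] brP_skew [OF a b] a b
    by (simp add: brP_dsm rho_const)
  assume c: "\<gamma> \<in> dual1 sm"
  show "brP (\<alpha> + \<beta>) \<gamma> = brP \<alpha> \<gamma> + brP \<beta> \<gamma>"
    using brP_skew [OF dual1_linear(1) [OF a b] c] brP_skew [OF a c] brP_skew [OF b c]
    by (simp add: brP_add_right a b c)
  show "brP \<alpha> (brP \<beta> \<gamma>) + brP \<beta> (brP \<gamma> \<alpha>) + brP \<gamma> (brP \<alpha> \<beta>) = 0"
    by (rule brP_jacobi [OF a b c])
qed (rule dual_module dual_projective)+

lemma quasi_lie_bialgebroid: "quasi_lie_bialgebroid_piN sm br rho N P Q"
proof -
  have dN: "dN br rho N a = dn a" if "mform sm a" for a by (rule dN_eq_def [OF that])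
  have Q3: "Q \<in> form sm 3" by (simp add: form_iff mform_Q homog_Q)
  have dn_form: "dN br rho N \<omega> \<in> form sm (Suc k)" if "\<omega> \<in> form sm k" for k \<omega>
    using that by (simp add: form_iff dN def.mform_d def.homog_d)
  have wedge: "wedge p q a b = wd a b" if "a \<in> form sm p" "b \<in> form sm q" for p q a b
    using that by (intro wedge_eq_wd [where sm = sm]) (simp_all add: form_iff)
  have sch: "schouten sm br rho P p q a b = kos a b" if "a \<in> form sm p" "b \<in> form sm q" for p q a b
    using that by (intro schouten_eq_kos) (simp_all add: form_iff)
  show ?thesis
    unfolding quasi_lie_bialgebroid_piN_def
  proof (intro conjI allI ballI)
    show "lie_algebroid (dual1 sm) dsm brP (\<lambda>\<alpha>. rho (P \<alpha>))" by (rule lie_algebroid_dual)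
    show "Q \<in> form sm 3" by (rule Q3)
    show "dN br rho N Q = (\<lambda>xs. 0)" by (simp add: dN mform_Q dn_Q zero_fun_def)
    fix k \<omega> assume w: "\<omega> \<in> form sm k"
    show "dN br rho N \<omega> \<in> form sm (Suc k)" by (rule dn_form [OF w])
    have "mform sm \<omega>" "homog k \<omega>" using w by (simp_all add: form_iff)
    then show "dN br rho N (dN br rho N \<omega>) = schouten sm br rho P 3 k Q \<omega>"
      by (simp add: dN def.mform_d dn_dn [of \<omega> k] sch [OF Q3 w])
  next
    fix p q a b assume a: "a \<in> form sm p" and b: "b \<in> form sm q"
    note f = a b dn_form [OF a] dn_form [OF b]
    have m: "mform sm a" "homog p a" "mform sm b" "homog q b" using a b by (simp_all add: form_iff)
    show "dN br rho N (wedge p q a b) = (\<lambda>xs. wedge (Suc p) q (dN br rho N a) b xs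
        + (-1) ^ p * wedge p (Suc q) a (dN br rho N b) xs)"
      by (simp only: wedge f) (simp add: dN m mform_wd def.d_wd homog_par [OF m(2)] fun_eq_iff dsm_apply)
    have "dn (kos a b) = kos (dn a) b - dsm ((-1) ^ p) (kos a (dn b))"
    proof -
      let ?s = "dsm ((-1) ^ p) (kos a (dn b))"
      have "dn (kos a b) = (dn (kos a b) - kos (dn a) b + ?s) + kos (dn a) b - ?s" by simp
      also have "dn (kos a b) - kos (dn a) b + ?s = 0"
        using defect_zero [OF m] by (simp only: defect_def homog_par [OF m(2)] kos_sign)
      finally show ?thesis by (simp only: add_0)
    qed
    then show "dN br rho N (schouten sm br rho P p q a b) = (\<lambda>xs. schouten sm br rho P (Suc p) q (dN br rho N a) b xs
        + (-1) ^ Suc p * schouten sm br rho P p (Suc q) a (dN br rho N b) xs)"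
      by (simp only: sch f) (simp add: dN m mform_kos fun_eq_iff dsm_apply)
  qed
qed

subsection \<open>The Courant algebroid\<close>

text \<open>The operator D of the skew-bracket convention, hence the factor 1/2; nondegeneracy makes
  it the element selected in \<open>courantD\<close>.\<close>

definition hgrad :: "'r \<Rightarrow> 'a \<times> ('a \<Rightarrow> 'r)" where
  "hgrad f = grad (scaleR (1/2) f)"

lemma hgrad_E: "hgrad f \<in> E" by (simp add: hgrad_def grad_E del: mem_Sigma_iff)

lemma pr_hgrad: "e \<in> E \<Longrightarrow> pr (hgrad f) e = scaleR (1/2) (anc e f)"
  by (simp add: hgrad_def pr_grad ancD(2) del: mem_Sigma_iff)

lemma npair_eq: "a \<in> E \<Longrightarrow> b \<in> E \<Longrightarrow> npair N P S a b = pr a b"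
  by (simp add: npair_def op_isometry del: mem_Sigma_iff)

lemma courantD_eq: "courantD E (npair N P S) anc f = hgrad f"
  unfolding courantD_def
proof (rule some_equality)
  show "hgrad f \<in> E \<and> (\<forall>e\<in>E. npair N P S (hgrad f) e = scaleR (1/2) (anc e f))"
    using hgrad_E by (simp add: npair_eq pr_hgrad del: mem_Sigma_iff)
  fix v assume v: "v \<in> E \<and> (\<forall>e\<in>E. npair N P S v e = scaleR (1/2) (anc e f))"
  show "v = hgrad f"
  proof (rule pr_eqI)
    show "pr v u = pr (hgrad f) u" if "u \<in> E" for u
      using v that npair_eq pr_hgrad by metis
  qed (use v hgrad_E in blast)+
qed

lemma nbr_star: "a \<in> E \<Longrightarrow> b \<in> E \<Longrightarrow> nbr br rho N P S a b = star a b - hgrad (pr a b)"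
  by (rule pr_eqI)
    (simp_all add: nbr_E star_E hgrad_E E_linear pr_linear pr_nbr_cubN pr_star pr_hgrad
      del: mem_Sigma_iff mem_Times_iff)

lemma star_sym: "a \<in> E \<Longrightarrow> b \<in> E \<Longrightarrow> star a b = grad (pr a b) - star b a"
proof (rule pr_eqI)
  assume m: "a \<in> E" "b \<in> E"
  fix u assume "u \<in> E"
  then show "pr (star a b) u = pr (grad (pr a b) - star b a) u"
    using cubN_sym [OF m, of u] m
    by (simp add: pr_star pr_linear grad_E star_E pr_grad eq_diff_eq del: mem_Sigma_iff mem_Times_iff)
qed (simp_all add: star_E E_linear grad_E del: mem_Sigma_iff mem_Times_iff)

lemma cubN_diff: "a \<in> E \<Longrightarrow> a' \<in> E \<Longrightarrow> b \<in> E \<Longrightarrow> c \<in> E \<Longrightarrow> cubN (a - a') b c = cubN a b c - cubN a' b c"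
  "a \<in> E \<Longrightarrow> a' \<in> E \<Longrightarrow> b \<in> E \<Longrightarrow> c \<in> E \<Longrightarrow> cubN b (a - a') c = cubN b a c - cubN b a' c"
  using cubN_add(1) [of "a - a'" a' b c] cubN_add(2) [of "a - a'" a' b c]
  by (simp_all add: E_linear eq_diff_eq del: mem_Sigma_iff mem_Times_iff)

text \<open>Arithmetic of the Jacobi anomaly. \<open>A\<close> stands for the cyclic sum of double
  Dorfman brackets paired with u, \<open>V\<close> and \<open>R\<close> for the derivatives along u
  of the cyclic sums of \<open>cubN x y z\<close> and of \<open>anc z (pr x y)\<close>.\<close>

lemma scaleR_third:
  fixes A V R :: "'b::real_vector"
  assumes "A + A + A = V + V - R"
  shows "A - scaleR (1/2) (V - scaleR (1/2) R) = scaleR (1/2) (scaleR (1/3) (V - scaleR (1/2) R))"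
proof -
  have "A = scaleR (1/3) (A + A + A)" by (simp add: scaleR_add_right flip: scaleR_add_left)
  also have "\<dots> = scaleR (2/3) V - scaleR (1/3) R"
    unfolding assms by (simp add: scaleR_add_right scaleR_diff_right flip: scaleR_add_left)
  finally have A: "A = scaleR (2/3) V - scaleR (1/3) R" .
  have "scaleR (2/3) V = scaleR (1/2) V + scaleR (1/6) V" "scaleR (1/3) R = scaleR (1/4) R + scaleR (1/12) R"
    by (simp_all flip: scaleR_add_left)
  then show ?thesis unfolding A by (simp add: scaleR_diff_right)
qed

lemma courant_jacobi:
  assumes "x \<in> E" "y \<in> E" "z \<in> E"
  defines "B \<equiv> nbr br rho N P S"
  shows "B (B x y) z + B (B y z) x + B (B z x) y
    = hgrad (courantT (npair N P S) B x y z)"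
proof (rule pr_eqI)
  note m = assms(1-3) star_E nbr_E [folded B_def] hgrad_E grad_E E_linear
  note d = mem_Sigma_iff mem_Times_iff
  show "B (B x y) z + B (B y z) x + B (B z x) y \<in> E" by (intro m)
  show "hgrad (courantT (npair N P S) B x y z) \<in> E" by (rule hgrad_E)
  fix u assume u: "u \<in> E"
  note m = m u
  define L where "L a b c = cubN a (star b c) u" for a b c
  have pB: "pr (B a b) v = cubN a b v - scaleR (1/2) (anc v (pr a b))" if "a \<in> E" "b \<in> E" "v \<in> E" for a b v
    unfolding B_def using that by (rule pr_nbr_cubN)
  \<comment> \<open>The inner half-gradient disappears, because brackets with a gradient on the left
    vanish; only the outer one contributes below.\<close>
  have cB: "cubN (B a b) c u = cubN (star a b) c u" if "a \<in> E" "b \<in> E" "c \<in> E" for a b c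
    using that u by (simp add: B_def nbr_star cubN_diff star_E hgrad_E hgrad_def cubN_grad grad_E del: d)
  have swap: "L a b c = anc u (anc a (pr b c)) - L a c b" if "a \<in> E" "b \<in> E" "c \<in> E" for a b c
  proof -
    have "cubN a (grad g) u = anc u (anc a g)" for g
      using cubN_sym [of a "grad g" u] cubN_grad [of a u g] that u pr_grad [of a g]
      by (simp add: grad_E pr_sym [of a] del: d)
    then show ?thesis
      unfolding L_def by (subst star_sym) (use that u in \<open>simp_all add: cubN_diff grad_E star_E del: d\<close>)
  qed
  have leib: "cubN (star a b) c u = L a b c + L b c a - anc u (anc b (pr a c))"
    if "a \<in> E" "b \<in> E" "c \<in> E" for a b c
  proof -
    have "pr (star a (star b c)) u = pr (star (star a b) c + star b (star a c)) u"
      using star_leibniz [of a b c] that by simp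
    then have "L a b c = cubN (star a b) c u + L b a c"
      unfolding L_def using that u by (simp add: pr_linear pr_star star_E del: d)
    then show ?thesis using swap [of b a c] that by (simp add: eq_diff_eq algebra_simps)
  qed
  have Ls: "L a b c = anc u (cubN b c a) - cubN (star b c) a u" if "a \<in> E" "b \<in> E" "c \<in> E" for a b c
    unfolding L_def using cubN_sym [of a "star b c" u] that u pr_star [of b c a]
    by (simp add: star_E pr_sym [of a] eq_diff_eq del: d)
  let ?A = "cubN (star x y) z u + cubN (star y z) x u + cubN (star z x) y u"
  let ?s = "cubN x y z + cubN y z x + cubN z x y"
  let ?r = "anc z (pr x y) + anc x (pr y z) + anc y (pr z x)"
  \<comment> \<open>The cyclic sum of \<open>L\<close> is eliminated between two equations. The
    Leibniz rule expresses \<open>?A\<close> by twice that sum, and the symmetric part of the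
    bracket expresses the sum by \<open>?A\<close>; together they give 3 A = 2 V - R, the source of
    the 1/3 in \<open>courantT\<close>.\<close>
  have "?A = (L x y z + L y z x + L z x y) + (L x y z + L y z x + L z x y) - anc u ?r"
    unfolding leib [OF assms(1-3)] leib [OF assms(2,3,1)] leib [OF assms(3,1,2)]
      pr_sym [of x z] pr_sym [of y x] pr_sym [of z y] ancD by (simp add: algebra_simps)
  moreover have "L x y z + L y z x + L z x y = anc u ?s - ?A"
    unfolding Ls [OF assms(1-3)] Ls [OF assms(2,3,1)] Ls [OF assms(3,1,2)] ancD
    by (simp add: algebra_simps)
  ultimately have "?A = (anc u ?s - ?A) + (anc u ?s - ?A) - anc u ?r" by simp
  then have "?A + ?A + ?A = anc u ?s + anc u ?s - anc u ?r" by (simp add: algebra_simps)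
  note third = scaleR_third [OF this]
  have T: "courantT (npair N P S) B x y z = scaleR (1/3) (?s - scaleR (1/2) ?r)"
    unfolding courantT_def
    by (simp add: npair_eq pB m scaleR_add_right scaleR_diff_right pr_sym [of z x] del: d)
  have "pr (B (B x y) z + B (B y z) x + B (B z x) y) u
      = ?A - scaleR (1/2) (anc u (?s - scaleR (1/2) ?r))"
    by (simp add: pr_linear pB cB m ancD scaleR_add_right scaleR_diff_right del: d)
  also have "\<dots> = scaleR (1/2) (scaleR (1/3) (anc u ?s - scaleR (1/2) (anc u ?r)))"
    using third by (simp only: ancD)
  also have "\<dots> = pr (hgrad (courantT (npair N P S) B x y z)) u"
    unfolding T pr_hgrad [OF u] by (simp only: ancD)
  finally show "pr (B (B x y) z + B (B y z) x + B (B z x) y) u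
      = pr (hgrad (courantT (npair N P S) B x y z)) u" .
qed

lemma pr_represents:
  assumes "lin_functional E (esm sm) \<Phi>"
  shows "\<exists>x\<in>E. \<forall>y\<in>E. \<Phi> y = pr x y"
proof -
  have add: "\<Phi> (a + b) = \<Phi> a + \<Phi> b" if "a \<in> E" "b \<in> E" for a b
    using assms that unfolding lin_functional_def by blast
  have mult: "\<Phi> (esm sm f a) = f * \<Phi> a" if "a \<in> E" for f a
    using assms that unfolding lin_functional_def by blast
  let ?\<alpha> = "\<lambda>Y. \<Phi> (Y, 0)"
  \<comment> \<open>The vector part is read off from the values on the dual basis covectors: this is
    reflexivity of a finitely generated projective module.\<close>
  let ?X = "\<Sum>i<nb. sm (\<Phi> (0, ff i)) (ee i)"
  have \<alpha>: "?\<alpha> \<in> dual1 sm"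
    using add [OF mem_A mem_A] mult [OF mem_A] by (simp add: dual1_iff plus_prod_def esm_def)
  have z: "\<Phi> (0, 0) = 0" using mult [OF mem_A, of 0 0] by (simp add: esm_def)
  have sum: "\<Phi> (0, \<Sum>i\<in>I. g i) = (\<Sum>i\<in>I. \<Phi> (0, g i))"
    if "finite I" "\<And>i. i \<in> I \<Longrightarrow> g i \<in> dual1 sm" for I :: "nat set" and g
    using that
  proof (induct I rule: finite_induct)
    case (insert i I)
    then have "\<Phi> (0, \<Sum>i\<in>insert i I. g i) = (\<Sum>i\<in>insert i I. \<Phi> (0, g i))"
      using add [of "(0, g i)" "(0, \<Sum>i\<in>I. g i)"] by (simp add: dual1_sum plus_prod_def)
    then show ?case .
  qed (use z in simp)
  have D: "\<Phi> (0, \<beta>) = \<beta> ?X" if b: "\<beta> \<in> dual1 sm" for \<beta>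
  proof -
    have "\<Phi> (0, \<beta>) = \<Phi> (0, \<Sum>i<nb. dsm (\<beta> (ee i)) (ff i))" by (simp flip: expand_dual [OF b])
    also have "\<dots> = (\<Sum>i<nb. \<Phi> (esm sm (\<beta> (ee i)) (0, ff i)))"
      by (subst sum) (auto simp: ff_dual dual1_linear esm_def)
    also have "\<dots> = (\<Sum>i<nb. \<beta> (ee i) * \<Phi> (0, ff i))"
      by (intro sum.cong refl mult) (simp add: ff_dual)
    finally show ?thesis by (simp add: dualD [OF b] mult.commute)
  qed
  have rep: "\<Phi> y = pr (?X, ?\<alpha>) y" if yE: "y \<in> E" for y
  proof -
    obtain Y \<beta> where y: "y = (Y, 0) + (0, \<beta>)" and b: "\<beta> \<in> dual1 sm"
      using yE by (auto simp: plus_prod_def)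
    show ?thesis unfolding y using add [OF mem_A mem_D [OF b], of Y] D [OF b]
      by (simp add: std_pair_def)
  qed
  have "(?X, ?\<alpha>) \<in> E" using \<alpha> by (simp only: mem_E)
  then show ?thesis using rep by blast
qed

lemma E_module: "r_module E (esm sm)"
  by (auto simp: r_module_def E_linear esm_def dual1_linear plus_prod_def uminus_prod_def zero_prod_def)
    (auto simp: fun_eq_iff dsm_apply algebra_simps)

lemma E_projective: "fg_projective E (esm sm)"
proof -
  let ?b1 = "map (\<lambda>(e, \<phi>). ((e, 0 :: 'a \<Rightarrow> 'r), \<lambda>v :: 'a \<times> ('a \<Rightarrow> 'r). \<phi> (fst v))) (dbasis sm)"
  let ?b2 = "map (\<lambda>(e, \<phi>). ((0 :: 'a, \<phi>), \<lambda>v :: 'a \<times> ('a \<Rightarrow> 'r). snd v e)) (dbasis sm)"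
  have d: "\<phi> \<in> dual1 sm" if "(e, \<phi>) \<in> set (dbasis sm)" for e \<phi>
    using dbasis that by (auto simp: is_dual_basis_def dual1_def)
  have "(\<Sum>(x, g)\<leftarrow>?b1 @ ?b2. esm sm (g v) x) = v" if vE: "v \<in> E" for v
  proof -
    obtain X \<alpha> where v: "v = (X, \<alpha>)" "\<alpha> \<in> dual1 sm" using vE by auto
    have "(\<Sum>(x, g)\<leftarrow>?b1 @ ?b2. esm sm (g v) x)
        = (\<Sum>(e, \<phi>)\<leftarrow>dbasis sm. (sm (\<phi> X) e, 0)) + (\<Sum>(e, \<phi>)\<leftarrow>dbasis sm. (0, dsm (\<alpha> e) \<phi>))"
      by (simp add: case_prod_unfold comp_def esm_def v)
    also have "\<dots> = (\<Sum>i<nb. (sm (ff i X) (ee i), 0)) + (\<Sum>i<nb. (0, dsm (\<alpha> (ee i)) (ff i)))"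
      by (simp only: sum_dbasis)
    also have "\<dots> = (X, \<alpha>)"
      using expand [of X] expand_dual [OF v(2)] by (simp add: prod_eq_iff fst_sum snd_sum)
    finally show ?thesis by (simp add: v)
  qed
  moreover have "\<forall>(x, g)\<in>set (?b1 @ ?b2). x \<in> E \<and> lin_functional E (esm sm) g"
    using d by (auto simp: lin_functional_def esm_def dsm_apply dualD)
  ultimately have "is_dual_basis E (esm sm) (?b1 @ ?b2)"
    unfolding is_dual_basis_def by (metis (no_types, lifting))
  then show ?thesis unfolding fg_projective_def by blast
qed

lemma courant_algebroid: "courant_algebroid E (esm sm) (npair N P S) anc (nbr br rho N P S)"
  unfolding courant_algebroid_def courantD_eq
proof (intro conjI ballI allI impI)
  note mm = nbr_E hgrad_E E_linear
  note dd = mem_Sigma_iff mem_Times_iff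
  show "r_module E (esm sm)" by (rule E_module)
  show "fg_projective E (esm sm)" by (rule E_projective)
  show "\<exists>x\<in>E. \<forall>y\<in>E. \<Phi> y = npair N P S x y" if "lin_functional E (esm sm) \<Phi>" for \<Phi>
    using pr_represents [OF that] npair_eq by metis
  show "anc (hgrad f) g = 0" for f g by (simp add: hgrad_def anc_grad)
  fix x assume x: "x \<in> E"
  show "is_derivation (anc x)" by (rule anc_der)
  show "anc (esm sm g x) f = g * anc x f" for g f
    using x by (simp add: anc_eq op_linear rho_sm del: dd) (simp add: esm_def rho_sm)
  show "x = 0" if "\<forall>y\<in>E. npair N P S x y = 0"
    using that npair_eq [OF x] by (intro pr_nondegenerate [OF x]) metis
  fix y assume y: "y \<in> E"
  show "npair N P S x y = npair N P S y x" using x y by (simp add: npair_eq pr_sym del: dd)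
  show "npair N P S (esm sm f x) y = f * npair N P S x y" for f
    using x y by (simp add: npair_eq E_linear pr_linear del: dd)
  show "anc (x + y) f = anc x f + anc y f" for f
    using x y by (simp add: anc_eq op_linear rho_add del: dd)
  show "nbr br rho N P S x y \<in> E" by (rule nbr_E [OF x y])
  have skew: "nbr br rho N P S x y = - nbr br rho N P S y x" if "x \<in> E" "y \<in> E" for x y
  proof (rule pr_eqI)
    fix u assume "u \<in> E"
    then show "pr (nbr br rho N P S x y) u = pr (- nbr br rho N P S y x) u"
      using cubN_sym [OF that, of u] that scaleR_half(1) [of "anc u (pr x y)"]
      by (simp add: pr_nbr_cubN pr_linear nbr_E pr_sym [of y x] del: dd)
        (metis add_diff_eq diff_add_eq diff_diff_eq2 eq_diff_eq)
  qed (simp_all add: that nbr_E E_linear del: dd)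
  show "nbr br rho N P S x y = - nbr br rho N P S y x" by (rule skew [OF x y])
  show "anc (nbr br rho N P S x y) f = anc x (anc y f) - anc y (anc x f)" for f
  proof -
    have "anc (star x y - hgrad g) f = anc (star x y) f" for g
    proof -
      have "anc (star x y) f = anc (star x y - hgrad g) f + anc (hgrad g) f"
        using op_linear(1) [of "star x y - hgrad g" "hgrad g"] x y
        by (simp add: anc_eq star_E E_linear hgrad_E del: dd) (simp flip: rho_add)
      then show ?thesis by (simp add: hgrad_def anc_grad)
    qed
    then show ?thesis using x y by (simp add: nbr_star anc_star del: dd)
  qed
  have leib: "nbr br rho N P S x (esm sm f y) = esm sm f (nbr br rho N P S x y) + esm sm (anc x f) y
      - esm sm (npair N P S x y) (hgrad f)" if "x \<in> E" "y \<in> E" for f x y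
  proof (rule pr_eqI)
    fix u assume u: "u \<in> E"
    show "pr (nbr br rho N P S x (esm sm f y)) u = pr (esm sm f (nbr br rho N P S x y) + esm sm (anc x f) y
      - esm sm (npair N P S x y) (hgrad f)) u"
      using that u
      by (simp add: pr_linear nbr_E hgrad_E E_linear pr_nbr_cubN cubN_esm npair_eq pr_hgrad del: dd)
        (simp add: ancD scaleR_add_right algebra_simps)
  qed (use that in \<open>simp_all add: nbr_E hgrad_E E_linear del: dd\<close>)
  show "nbr br rho N P S x (esm sm f y) = esm sm f (nbr br rho N P S x y) + esm sm (anc x f) y
      - esm sm (npair N P S x y) (hgrad f)" for f by (rule leib [OF x y])
  \<comment> \<open>Skew-symmetry moves the constant to the second argument, where the Leibniz rule
    applies; the anchor and the gradient annihilate constants.\<close>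
  show "nbr br rho N P S (esm sm (of_real c) x) y = esm sm (of_real c) (nbr br rho N P S x y)" for c
  proof -
    have "anc e (of_real c) = 0" for e by (simp add: anc_eq rho_const)
    then have k: "esm sm g (hgrad (of_real c)) = 0" "esm sm (anc e (of_real c)) v = 0" if "v \<in> E" for g e v
      using pr_nondegenerate [of "esm sm g (hgrad (of_real c))"] that
      by (simp_all add: pr_linear hgrad_E E_linear pr_hgrad del: dd) (simp add: esm_def zero_prod_def)
    have "nbr br rho N P S (esm sm (of_real c) x) y = - esm sm (of_real c) (nbr br rho N P S y x)"
      using skew [of "esm sm (of_real c) x" y] leib [OF y x, of "of_real c"] x y k
      by (simp add: E_linear del: dd)
    also have "\<dots> = esm sm (of_real c) (nbr br rho N P S x y)"
      unfolding skew [OF x y] by (simp add: esm_def prod_eq_iff)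
    finally show ?thesis .
  qed
  fix z assume z: "z \<in> E"
  show "npair N P S (x + y) z = npair N P S x z + npair N P S y z"
    using x y z by (simp add: npair_eq E_linear pr_linear del: dd)
  show "nbr br rho N P S (x + y) z = nbr br rho N P S x z + nbr br rho N P S y z"
  proof (rule pr_eqI)
    fix u assume "u \<in> E"
    then show "pr (nbr br rho N P S (x + y) z) u = pr (nbr br rho N P S x z + nbr br rho N P S y z) u"
      using x y z by (simp add: pr_linear nbr_E E_linear pr_nbr_cubN cubN_add ancD scaleR_add_right del: dd)
  qed (use x y z in \<open>simp_all add: nbr_E E_linear del: dd\<close>)
  show "nbr br rho N P S (nbr br rho N P S x y) z + nbr br rho N P S (nbr br rho N P S y z) x
      + nbr br rho N P S (nbr br rho N P S z x) y
      = hgrad (courantT (npair N P S) (nbr br rho N P S) x y z)"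
    by (rule courant_jacobi [OF x y z])
  show "anc x (npair N P S y z) = npair N P S (nbr br rho N P S x y + hgrad (npair N P S x y)) z
      + npair N P S y (nbr br rho N P S x z + hgrad (npair N P S x z))"
    using x y z cubN_metric [OF x y z]
    by (simp add: npair_eq E_linear nbr_E hgrad_E pr_linear pr_sym [of y] pr_nbr_cubN pr_hgrad del: dd)
qed

subsection \<open>Comparison with the double\<close>

lemma cubN_DAD:
  assumes a: "\<alpha> \<in> dual1 sm" and c: "\<gamma> \<in> dual1 sm"
  shows "cubN (0, \<alpha>) (X, 0) (0, \<gamma>) = rho (P \<alpha>) (\<gamma> X) - brP \<alpha> \<gamma> X"
  using cubN_metric [OF mem_D [OF a] mem_A mem_D [OF c], of X] cubN_DDA [OF a c, of X]
  by (simp add: std_pair_def anc_D eq_diff_eq)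

lemma cubN_ADD:
  assumes a: "\<alpha> \<in> dual1 sm" and c: "\<gamma> \<in> dual1 sm"
  shows "cubN (X, 0) (0, \<alpha>) (0, \<gamma>) = rho (P \<gamma>) (\<alpha> X) - (rho (P \<alpha>) (\<gamma> X) - brP \<alpha> \<gamma> X)"
  using cubN_sym [OF mem_A mem_D [OF a] mem_D [OF c], of X] cubN_DAD [OF a c, of X]
  by (simp add: std_pair_def anc_D eq_diff_eq)

lemma cubN_ADA:
  assumes a: "\<alpha> \<in> dual1 sm"
  shows "cubN (X, 0) (0, \<alpha>) (W, 0) = rhoN W (\<alpha> X) + dn (form1 \<alpha>) [X, W]"
  using cubN_sym [OF mem_A mem_D [OF a] mem_A, of X W] cubN_DAA [OF a, of X W]
  by (simp add: std_pair_def anc_A algebra_simps)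

lemma dbl_bracket_eq:
  assumes "e1 \<in> E" "e2 \<in> E"
  shows "nbr br rho N P S e1 e2 = dbl_bracket sm br rho N P Q e1 e2"
proof -
  obtain x a where e1: "e1 = (x, 0) + (0, a)" and a: "a \<in> dual1 sm" using assms(1) by (auto simp: plus_prod_def)
  obtain y b where e2: "e2 = (y, 0) + (0, b)" and b: "b \<in> dual1 sm" using assms(2) by (auto simp: plus_prod_def)
  have E1: "e1 = (x, a)" and E2: "e2 = (y, b)" by (simp_all add: e1 e2)
  note mem = mem_A mem_D a b
  have d0: "dN br rho N (form0 f) = form1 (dNf f)" for f
    by (simp add: dN_eq_def def.d_form0)
  have d1: "dN br rho N (form1 \<phi>) = dn (form1 \<phi>)" if "\<phi> \<in> dual1 sm" for \<phi>
    by (rule dN_eq_def [OF mform_one [OF that]])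
  have f1: "form1 \<phi> [X] = \<phi> X" for \<phi> :: "'a \<Rightarrow> 'r" and X by (simp add: form1_def)
  let ?B = "nbr br rho N P S e1 e2"
  let ?h = "b x - a y"
  let ?F = "\<lambda>Z. rhoN x (Z y) - rhoN y (Z x) - dN br rho N (form1 Z) [x, y]
      + (rho (P a) (Z y) - brP a Z y) - (rho (P b) (Z x) - brP b Z x) + scaleR (1/2) (rho (P Z) ?h)"
  \<comment> \<open>The A-part of the double is prescribed by its pairings with A*, so it is enough
    to compare these; \<open>dual_elem\<close> then rebuilds the vector from its values on
    \<open>ff i\<close>.\<close>
  have F: "?F Z = Z (fst ?B)" if Z: "Z \<in> dual1 sm" for Z
  proof -
    have "Z (fst ?B) = pr ?B (0, Z)"
      using dualD(3) [OF E_snd [OF nbr_E [OF assms]]] by (simp add: std_pair_def)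
    also have "\<dots> = cubN e1 e2 (0, Z) - scaleR (1/2) (rho (P Z) (a y + b x))"
      by (simp only: pr_nbr_cubN [OF assms mem_D [OF Z]] anc_D) (simp add: E1 E2 std_pair_def add.commute)
    also have "cubN e1 e2 (0, Z) = Z (brN x y) + (rho (P Z) (b x) - (rho (P b) (Z x) - brP b Z x))
        + (rho (P a) (Z y) - brP a Z y)"
      unfolding e1 e2 using Z a b
      by (simp only: cubN_add mem E_linear cubN_AAD cubN_ADD cubN_DAD cubN_DDD) simp
    finally have f: "Z (fst ?B) = \<dots> - scaleR (1/2) (rho (P Z) (a y + b x))" .
    let ?K = "Z (brN x y) - (rho (P b) (Z x) - brP b Z x) + (rho (P a) (Z y) - brP a Z y)"
    \<comment> \<open>The double carries half the derivative of b x - a y, the deformed bracket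
      minus half that of a y + b x. The full derivative of b x, created when the 1-form
      \<open>b\<close> sits in the second slot of \<open>cubN\<close>, makes up the
      difference.\<close>
    have "?F Z = ?K + scaleR (1/2) (rho (P Z) (b x) - rho (P Z) (a y))"
      by (simp add: d1 Z dn_apply2 rhoD)
    also have "\<dots> = ?K + (rho (P Z) (b x) - scaleR (1/2) (rho (P Z) (a y) + rho (P Z) (b x)))"
      by (simp only: scaleR_half(2))
    also have "\<dots> = Z (fst ?B)" unfolding f by (simp add: rhoD)
    finally show ?thesis .
  qed
  have "fst ?B = (\<Sum>i<nb. sm (ff i (fst ?B)) (ee i))" by (rule expand)
  also have "\<dots> = (\<Sum>i<nb. sm (?F (ff i)) (ee i))"
    by (intro sum.cong refl) (simp only: F ff_dual lessThan_iff)
  also have "\<dots> = dual_elem sm ?F" by (simp only: dual_elem_def sum_dbasis)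
  finally have 1: "fst ?B = dual_elem sm ?F" .
  have 2: "snd ?B W = brP a b W + (dn (form1 b) [x, W] + rhoN W (b x)) - (dn (form1 a) [y, W] + rhoN W (a y))
      - scaleR (1/2) (rhoN W ?h) + Q [x, y, W]" for W
  proof -
    have "snd ?B W = pr ?B (W, 0)" by (simp add: std_pair_def)
    also have "\<dots> = cubN e1 e2 (W, 0) - scaleR (1/2) (rhoN W (a y + b x))"
      by (simp only: pr_nbr_cubN [OF assms mem_A] anc_A) (simp add: E1 E2 std_pair_def add.commute)
    also have "cubN e1 e2 (W, 0) = Q [x, y, W] + (rhoN W (b x) + dn (form1 b) [x, W])
        + (- dn (form1 a) [y, W] + brP a b W)"
      unfolding e1 e2 using a b
      by (simp only: cubN_add mem E_linear cubN_AAA cubN_ADA cubN_DAA cubN_DDA) simp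
    finally have f: "snd ?B W = \<dots> - scaleR (1/2) (rhoN W (a y + b x))" .
    let ?K = "brP a b W + dn (form1 b) [x, W] - dn (form1 a) [y, W] + Q [x, y, W]"
    have "snd ?B W = ?K + (rhoN W (b x) - scaleR (1/2) (rhoN W (a y) + rhoN W (b x)))"
      unfolding f by (simp add: def.rhoD)
    also have "\<dots> = ?K + (rhoN W (b x) - rhoN W (a y) - scaleR (1/2) (rhoN W (b x) - rhoN W (a y)))"
      by (simp only: scaleR_half(2,3))
    finally show ?thesis by (simp add: def.rhoD)
  qed
  show ?thesis
  proof (rule prod_eqI)
    show "fst ?B = fst (dbl_bracket sm br rho N P Q e1 e2)"
      unfolding 1 by (simp add: dbl_bracket_def Let_def E1 E2 d0 f1)
    show "snd ?B = snd (dbl_bracket sm br rho N P Q e1 e2)"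
      by (rule ext) (simp add: 2, simp add: dbl_bracket_def Let_def E1 E2 d0 d1 a b f1 ictr_def)
  qed
qed

lemma dbl_anchor_eq: "anc e f = dbl_anchor br rho N P e f"
  by (simp add: dbl_anchor_def nanchor_def dN_eq_def def.d_form0) (simp add: form1_def rhoN_def)

lemma dbl_pair_eq: "a \<in> E \<Longrightarrow> b \<in> E \<Longrightarrow> npair N P S a b = dbl_pair a b"
  by (simp add: npair_eq dbl_pair_def std_pair_def del: mem_Sigma_iff)

end

theorem mainTheorem9:
  fixes sm :: "'r::{comm_ring_1,real_algebra_1} \<Rightarrow> 'a::ab_group_add \<Rightarrow> 'a"
    and br :: "'a \<Rightarrow> 'a \<Rightarrow> 'a"
    and rho :: "'a \<Rightarrow> 'r \<Rightarrow> 'r"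
    and N :: "'a \<Rightarrow> 'a"
    and P :: "('a \<Rightarrow> 'r) \<Rightarrow> 'a"
    and S :: "'a \<Rightarrow> 'a \<Rightarrow> 'r"
  assumes A: "lie_algebroid UNIV sm br rho"
    and paired: "paired_operator sm N P S"
    and sq: "\<forall>e \<in> UNIV \<times> dual1 sm. pop N P S (pop N P S e) = - e"
    and T_dual: "\<forall>\<alpha>\<in>dual1 sm. \<forall>\<beta>\<in>dual1 sm. ntorsion br rho N P S (0, \<alpha>) (0, \<beta>) = 0"
    and T_A: "\<forall>X Y. ntorsion br rho N P S (X, 0) (Y, 0) = 0"
  shows "courant_algebroid (UNIV \<times> dual1 sm) (esm sm) (npair N P S) (nanchor rho N P) (nbr br rho N P S)
       \<and> quasi_lie_bialgebroid_piN sm br rho N P (extd br rho (form2 S))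
       \<and> (\<forall>e1 \<in> UNIV \<times> dual1 sm. \<forall>e2 \<in> UNIV \<times> dual1 sm.
            nbr br rho N P S e1 e2 = dbl_bracket sm br rho N P (extd br rho (form2 S)) e1 e2)
       \<and> (\<forall>e \<in> UNIV \<times> dual1 sm. \<forall>f. nanchor rho N P e f = dbl_anchor br rho N P e f)
       \<and> (\<forall>e1 \<in> UNIV \<times> dual1 sm. \<forall>e2 \<in> UNIV \<times> dual1 sm. npair N P S e1 e2 = dbl_pair e1 e2)"
proof -
  interpret complex_paired sm br rho N P S
  proof
    fix X Y Z f g and \<alpha> \<beta> :: "'a \<Rightarrow> 'r"
    show "r_module UNIV sm" "fg_projective UNIV sm" using A unfolding lie_algebroid_def by blast+
    note L = A [unfolded lie_algebroid_def ball_UNIV, THEN conjunct2, THEN conjunct2, THEN conjunct2]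
    show "br (X + Y) Z = br X Z + br Y Z"
      by (rule L [THEN conjunct1, rule_format])
    note L = L [THEN conjunct2, THEN conjunct2]
    show "br X Y = - br Y X" by (rule L [THEN conjunct1, rule_format])
    note L = L [THEN conjunct2]
    show "br X (br Y Z) + br Y (br Z X) + br Z (br X Y) = 0" by (rule L [THEN conjunct1, rule_format])
    note L = L [THEN conjunct2]
    show "is_derivation (rho X)" by (rule L [THEN conjunct1, rule_format])
    note L = L [THEN conjunct2]
    show "rho (X + Y) f = rho X f + rho Y f" by (rule L [THEN conjunct1, rule_format])
    note L = L [THEN conjunct2]
    show "rho (sm g X) f = g * rho X f" by (rule L [THEN conjunct1, rule_format])
    note L = L [THEN conjunct2]
    show "rho (br X Y) f = rho X (rho Y f) - rho Y (rho X f)" by (rule L [THEN conjunct1, rule_format])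
    show "br X (sm f Y) = sm f (br X Y) + sm (rho X f) Y" by (rule L [THEN conjunct2, rule_format])
    show "N (X + Y) = N X + N Y" "N (sm f X) = sm f (N X)" "S X \<in> dual1 sm"
      "S (X + Y) = S X + S Y" "S (sm f X) = dsm f (S X)"
      using paired unfolding paired_operator_def by blast+
    show "S X Y = - S Y X" using paired unfolding paired_operator_def by blast
    show "\<alpha> \<in> dual1 sm \<Longrightarrow> P (dsm f \<alpha>) = sm f (P \<alpha>)" using paired unfolding paired_operator_def by blast
    show "\<alpha> \<in> dual1 sm \<Longrightarrow> \<beta> \<in> dual1 sm \<Longrightarrow> P (\<alpha> + \<beta>) = P \<alpha> + P \<beta>"
      using paired unfolding paired_operator_def by blast
    show "\<alpha> \<in> dual1 sm \<Longrightarrow> \<beta> \<in> dual1 sm \<Longrightarrow> \<beta> (P \<alpha>) = - \<alpha> (P \<beta>)"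
      using paired unfolding paired_operator_def by blast
    show "\<alpha> \<in> dual1 sm \<Longrightarrow> \<beta> \<in> dual1 sm \<Longrightarrow> ntorsion br rho N P S (0, \<alpha>) (0, \<beta>) = 0"
      using T_dual by blast
    show "ntorsion br rho N P S (X, 0) (Y, 0) = 0" using T_A by blast
  next
    fix e :: "'a \<times> ('a \<Rightarrow> 'r)"
    show "e \<in> UNIV \<times> dual1 sm \<Longrightarrow> pop N P S (pop N P S e) = - e" using sq by blast
  qed
  show ?thesis
    using courant_algebroid quasi_lie_bialgebroid dbl_bracket_eq dbl_anchor_eq dbl_pair_eq
    unfolding Q_def by blast
qed

end
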